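(* Let $G=(V,E,w)$ be a finite connected weighted graph with graph Laplacian $L$ and eigenvalues $\lambda_1\le\cdots\le\lambda_{|V|}$. Let $\psi$ be an eigenvector of $L$ that is non-zero at every vertex, with eigenvalue $\lambda_k$, where $k=\min\{m:L\psi=\lambda_m\psi\}$. Let $B_\sigma$, $\sigma\in[0,\infty)$, be the vertex-based family of bilinear forms on the $\psi$-subdivision graph $G_{\psi,\sigma}$, and let $S=\{i:\psi_i>0\}\cup\{i:\psi_i<0\}$, regarded as a vertex subset of $G_{\psi,\infty}$, with D-subgraph $S^{(D)}$. Then: (a) as $\sigma\to\infty$, the eigenvalues of $B_\sigma$ converge to the Dirichlet eigenvalues of the D-subgraph $S^{(D)}$; (b) the number of D-connected components of $S^{(D)}$ is the multiplicity of $\lambda_k$ for $B_\infty$, and the nodal deficiency of $\psi$ on $G_{\psi,\infty}$ is $\delta(\psi)=k-\nu(\psi)$; (c) by construction, there are $k-\nu(\psi)+|V_{gh}|$ eigenvalue branches that cross $\lambda_k$ as $\sigma\to\infty$.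
   Context: $G=(V,E,w)$ is a finite connected weighted undirected graph without multiple edges, with weights $w_{ij}=w_{ji}>0$ on edges and $w_{ij}=0$ for non-edges. The graph Laplacian of a weighted graph is $L=D-W$ with $W=(w_{ij})$ and $D$ the diagonal matrix with entries $\sum_j w_{ij}$. Eigenvalues are listed with multiplicity in increasing order, $0=\lambda_1\le\cdots\le\lambda_{|V|}$ for $L$. Let $E_\pm=\{(i,j)\in E:\psi_i\psi_j<0\}$, $q_{ij}=-\psi_i/\psi_j$, and let $V_{gh}=\{0_{ij}:(i,j)\in E_\pm\}$ be a set of new "ghost" vertices, one for each sign-change edge ($0_{ij}=0_{ji}$). For $\sigma\in[0,\infty)$ the $\psi$-subdivision graph $G_{\psi,\sigma}$ has vertex set $V\cup V_{gh}$, edge set $E\cup\{(i,0_{ij}),(0_{ij},j):(i,j)\in E_\pm\}$, and weights: $w_{ij}$ on $(i,j)\in E\setminus E_\pm$; $\frac{1}{1+\sigma}w_{ij}$ on $(i,j)\in E_\pm$; $\frac{\sigma}{1+\sigma}w_{ij}(1+q_{ji})$ on $(i,0_{ij})$ and $\frac{\sigma}{1+\sigma}w_{ij}(1+q_{ij})$ on $(j,0_{ij})$. Let $L_{\psi,\sigma}$ be its graph Laplacian. $G_{\psi,\infty}$ and $L_{\psi,\infty}$ are obtained by letting $\sigma\to\infty$ in the weights (the edges of $E_\pm$ disappear; $(i,0_{ij})$ has weight $(1+q_{ji})w_{ij}$). $B_\sigma(u,v)=\langle u,L_{\psi,\sigma}v\rangle+\sigma\sum_{x\in V_{gh}}u_xv_x$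 for $u,v\in\mathbb{R}^{V\cup V_{gh}}$; its eigenvalues are those of the symmetric matrix representing it. An eigenvalue branch is one of the real-analytic functions of $\sigma\in[0,\infty)$ which together give the eigenvalues of $B_\sigma$ with multiplicity. A branch crosses $\lambda_k$ if it is strictly below $\lambda_k$ at $\sigma=0$ and strictly above $\lambda_k$ for all sufficiently large $\sigma$, with limit (possibly $+\infty$) strictly larger than $\lambda_k$. The eigenvalue problem for the limiting form $B_\infty$ asks for functions $u$ vanishing on $V_{gh}$ with $(L_{\psi,\infty}u)_i=\lambda u_i$ at the vertices $i\in S$. The D-subgraph $S^{(D)}$ is the subgraph of $G_{\psi,\infty}$ formed by $S$, its vertex boundary (vertices outside $S$ adjacent to $S$, here $V_{gh}$), the edges within $S$ and the edges joining $S$ to its boundary. The Dirichlet eigenvalues of $S^{(D)}$ are the eigenvalues, with multiplicity, of the matrix $L_{\psi,\infty}$ with the rows and columns of vertices outside $S$ removed. The D-connected components of $S^{(D)}$ are the classes of vertices of $S$ that can be joined by paths in $S^{(D)}$ not passing through the vertex boundary $V_{gh}$. They are the nodal domains of $\psi$ (the connected components of $G$ after the edges of $E_\pm$ are removed), whose number is $\nu(\psi)$. *)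

theory Defs
  imports "HOL-Analysis.Analysis"
begin

section \<open>Weighted graphs and their Laplacians\<close>

text \<open>
  A weighted graph is a symmetric, non-negative weight function on a finite type; its edges are the
  pairs of positive weight. When the vertex set is not the whole type, the weights vanish off the
  vertex set, and the vertex set is passed separately wherever it matters.
\<close>

definition weighted_graph :: "('a \<Rightarrow> 'a \<Rightarrow> real) \<Rightarrow> bool" where
  "weighted_graph w \<longleftrightarrow> (\<forall>i j. w i j = w j i) \<and> (\<forall>i j. 0 \<le> w i j)"

definition edges :: "('a \<Rightarrow> 'a \<Rightarrow> real) \<Rightarrow> ('a \<times> 'a) set" where
  "edges w = {(i, j). 0 < w i j}"

definition connected_graph :: "('a \<Rightarrow> 'a \<Rightarrow> real) \<Rightarrow> bool" where
  "connected_graph w \<longleftrightarrow> (\<forall>i j. (i, j) \<in> (edges w)\<^sup>*)"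

definition laplacian :: "('a::finite \<Rightarrow> 'a \<Rightarrow> real) \<Rightarrow> real^'a^'a" where
  "laplacian w = (\<chi> i j. (if i = j then \<Sum>l\<in>UNIV. w i l else 0) - w i j)"

text \<open>The classes of vertices in \<open>A\<close> joined by paths of \<open>R\<close>-steps that stay in \<open>A\<close>
  (for symmetric \<open>R\<close>).\<close>

definition graph_components :: "'a set \<Rightarrow> ('a \<times> 'a) set \<Rightarrow> 'a set set" where
  "graph_components A R = A // Restr ((Restr R A)\<^sup>*) A"


section \<open>Eigenvalues with multiplicity\<close>

text \<open>
  Eigenvectors of the submatrix of \<open>M\<close> with rows and columns in \<open>A\<close>; a vector indexed by \<open>A\<close> is
  represented by its extension by zero. All matrices considered are symmetric, so the multiplicity
  of an eigenvalue is the dimension of its eigenspace.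
\<close>

definition eigenspace :: "'a::finite set \<Rightarrow> real^'a^'a \<Rightarrow> real \<Rightarrow> (real^'a) set" where
  "eigenspace A M \<mu> =
     {u. (\<forall>i. i \<notin> A \<longrightarrow> u $ i = 0) \<and> (\<forall>i\<in>A. (M *v u) $ i = \<mu> * u $ i)}"

definition eig_mult :: "'a::finite set \<Rightarrow> real^'a^'a \<Rightarrow> real \<Rightarrow> nat" where
  "eig_mult A M \<mu> = dim (eigenspace A M \<mu>)"

definition eigenvalue_mset :: "'a::finite set \<Rightarrow> real^'a^'a \<Rightarrow> real multiset" where
  "eigenvalue_mset A M =
     (\<Sum>\<mu> | 0 < eig_mult A M \<mu>. replicate_mset (eig_mult A M \<mu>) \<mu>)"

text \<open>The \<open>m\<close>-th eigenvalue in increasing order, for \<open>1 \<le> m \<le> card A\<close>.\<close>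

definition eigenvalue :: "'a::finite set \<Rightarrow> real^'a^'a \<Rightarrow> nat \<Rightarrow> real" where
  "eigenvalue A M m = sorted_list_of_multiset (eigenvalue_mset A M) ! (m - 1)"


section \<open>Nodal domains and nodal deficiency\<close>

text \<open>The components of the vertices where \<open>u\<close> is non-zero, after removal of the sign-change
  edges.\<close>

definition nodal_domains :: "('a::finite \<Rightarrow> 'a \<Rightarrow> real) \<Rightarrow> real^'a \<Rightarrow> 'a set set" where
  "nodal_domains w u =
     graph_components {i. u $ i \<noteq> 0} (edges w - {(i, j). u $ i * u $ j < 0})"

definition nodal_count :: "('a::finite \<Rightarrow> 'a \<Rightarrow> real) \<Rightarrow> real^'a \<Rightarrow> nat" where
  "nodal_count w u = card (nodal_domains w u)"

text \<open>\<open>k\<close> is the spectral position of the eigenvector from which \<open>u\<close> arises.\<close>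

definition nodal_deficiency :: "('a::finite \<Rightarrow> 'a \<Rightarrow> real) \<Rightarrow> real^'a \<Rightarrow> nat \<Rightarrow> int" where
  "nodal_deficiency w u k = int k - int (nodal_count w u)"


section \<open>The \<open>\<psi>\<close>-subdivision graph\<close>

definition sign_edges :: "('v::finite \<Rightarrow> 'v \<Rightarrow> real) \<Rightarrow> real^'v \<Rightarrow> ('v \<times> 'v) set" where
  "sign_edges w \<psi> = {(i, j) \<in> edges w. \<psi> $ i * \<psi> $ j < 0}"

text \<open>
  The vertex \<open>i\<close> of \<open>G\<close> becomes \<open>Inl i\<close>, and the ghost vertex \<open>0\<^sub>i\<^sub>j = 0\<^sub>j\<^sub>i\<close> is \<open>Inr {i, j}\<close>.
\<close>

definition ghosts :: "('v::finite \<Rightarrow> 'v \<Rightarrow> real) \<Rightarrow> real^'v \<Rightarrow> ('v + 'v set) set" where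
  "ghosts w \<psi> = {Inr {i, j} | i j. (i, j) \<in> sign_edges w \<psi>}"

definition sub_vertices :: "('v::finite \<Rightarrow> 'v \<Rightarrow> real) \<Rightarrow> real^'v \<Rightarrow> ('v + 'v set) set" where
  "sub_vertices w \<psi> = range Inl \<union> ghosts w \<psi>"

definition q_ratio :: "real^'v \<Rightarrow> 'v \<Rightarrow> 'v \<Rightarrow> real" where
  "q_ratio \<psi> i j = - \<psi> $ i / \<psi> $ j"

text \<open>
  The weight of \<open>(i, 0\<^sub>i\<^sub>j)\<close>, without its \<open>\<sigma>\<close>-dependent factor. The sum has at most one
  term: for \<open>e = {i, j}\<close> a sign-change edge it is \<open>w\<^sub>i\<^sub>j (1 + q\<^sub>j\<^sub>i)\<close>, otherwise it is zero.
\<close>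

definition ghost_weight :: "('v::finite \<Rightarrow> 'v \<Rightarrow> real) \<Rightarrow> real^'v \<Rightarrow> 'v \<Rightarrow> 'v set \<Rightarrow> real" where
  "ghost_weight w \<psi> i e =
     (\<Sum>j | (i, j) \<in> sign_edges w \<psi> \<and> e = {i, j}. w i j * (1 + q_ratio \<psi> j i))"

fun sub_weight_aux ::
    "('v::finite \<Rightarrow> 'v \<Rightarrow> real) \<Rightarrow> real^'v \<Rightarrow> real \<Rightarrow> real \<Rightarrow> 'v + 'v set \<Rightarrow> 'v + 'v set \<Rightarrow> real" where
  "sub_weight_aux w \<psi> a b (Inl i) (Inl j) =
     (if (i, j) \<in> sign_edges w \<psi> then a * w i j else w i j)"
| "sub_weight_aux w \<psi> a b (Inl i) (Inr e) = b * ghost_weight w \<psi> i e"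
| "sub_weight_aux w \<psi> a b (Inr e) (Inl i) = b * ghost_weight w \<psi> i e"
| "sub_weight_aux w \<psi> a b (Inr e) (Inr e') = 0"

definition sub_weight ::
    "('v::finite \<Rightarrow> 'v \<Rightarrow> real) \<Rightarrow> real^'v \<Rightarrow> real \<Rightarrow> 'v + 'v set \<Rightarrow> 'v + 'v set \<Rightarrow> real" where
  "sub_weight w \<psi> \<sigma> = sub_weight_aux w \<psi> (1 / (1 + \<sigma>)) (\<sigma> / (1 + \<sigma>))"

text \<open>The limit as \<open>\<sigma>\<close> tends to infinity.\<close>

definition sub_weight_inf ::
    "('v::finite \<Rightarrow> 'v \<Rightarrow> real) \<Rightarrow> real^'v \<Rightarrow> 'v + 'v set \<Rightarrow> 'v + 'v set \<Rightarrow> real" where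
  "sub_weight_inf w \<psi> = sub_weight_aux w \<psi> 0 1"

lemma sub_weight_inf_limit:
  "((\<lambda>\<sigma>. sub_weight w \<psi> \<sigma> x y) \<longlongrightarrow> sub_weight_inf w \<psi> x y) at_top"
proof -
  have a: "((\<lambda>\<sigma>::real. 1 / (1 + \<sigma>)) \<longlongrightarrow> 0) at_top"
    by (intro tendsto_divide_0[OF tendsto_const] filterlim_at_top_imp_at_infinity
        filterlim_tendsto_add_at_top[OF tendsto_const] filterlim_ident)
  have "((\<lambda>\<sigma>::real. 1 - 1 / (1 + \<sigma>)) \<longlongrightarrow> 1 - 0) at_top"
    by (intro tendsto_diff tendsto_const a)
  moreover have "\<forall>\<^sub>F \<sigma>::real in at_top. 1 - 1 / (1 + \<sigma>) = \<sigma> / (1 + \<sigma>)"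
    using eventually_gt_at_top[of 0] by eventually_elim (simp add: field_simps)
  ultimately have b: "((\<lambda>\<sigma>::real. \<sigma> / (1 + \<sigma>)) \<longlongrightarrow> 1) at_top"
    using Lim_transform_eventually by fastforce
  have "((\<lambda>\<sigma>. 1 / (1 + \<sigma>) * c) \<longlongrightarrow> 0) at_top" "((\<lambda>\<sigma>. \<sigma> / (1 + \<sigma>) * c) \<longlongrightarrow> c) at_top" for c :: real
    using tendsto_mult[OF a tendsto_const[of c]] tendsto_mult[OF b tendsto_const[of c]] by auto
  then show ?thesis
    unfolding sub_weight_def sub_weight_inf_def by (cases x; cases y) auto
qed

definition extend_zero :: "real^'v \<Rightarrow> real^('v + 'v set)" where
  "extend_zero \<psi> = (\<chi> x. case x of Inl i \<Rightarrow> \<psi> $ i | Inr e \<Rightarrow> 0)"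


section \<open>The family of bilinear forms\<close>

definition B_form :: "('v::finite \<Rightarrow> 'v \<Rightarrow> real) \<Rightarrow> real^'v \<Rightarrow> real \<Rightarrow>
    real^('v + 'v set) \<Rightarrow> real^('v + 'v set) \<Rightarrow> real" where
  "B_form w \<psi> \<sigma> u v =
     u \<bullet> (laplacian (sub_weight w \<psi> \<sigma>) *v v) + \<sigma> * (\<Sum>x\<in>ghosts w \<psi>. u $ x * v $ x)"

text \<open>The matrix representing the form; only its rows and columns in \<^term>\<open>sub_vertices w \<psi>\<close>
  matter.\<close>

definition B_matrix ::
    "('v::finite \<Rightarrow> 'v \<Rightarrow> real) \<Rightarrow> real^'v \<Rightarrow> real \<Rightarrow> real^('v + 'v set)^('v + 'v set)" where
  "B_matrix w \<psi> \<sigma> = (\<chi> x y. B_form w \<psi> \<sigma> (axis x 1) (axis y 1))"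

definition pos_neg_set :: "real^'v \<Rightarrow> ('v + 'v set) set" where
  "pos_neg_set \<psi> = {Inl i | i. 0 < \<psi> $ i} \<union> {Inl i | i. \<psi> $ i < 0}"

definition B_inf_eigenspace ::
    "('v::finite \<Rightarrow> 'v \<Rightarrow> real) \<Rightarrow> real^'v \<Rightarrow> real \<Rightarrow> (real^('v + 'v set)) set" where
  "B_inf_eigenspace w \<psi> \<mu> =
     {u. (\<forall>x. x \<notin> sub_vertices w \<psi> \<longrightarrow> u $ x = 0) \<and> (\<forall>x\<in>ghosts w \<psi>. u $ x = 0) \<and>
         (\<forall>x\<in>pos_neg_set \<psi>. (laplacian (sub_weight_inf w \<psi>) *v u) $ x = \<mu> * u $ x)}"


section \<open>D-subgraphs\<close>

definition vertex_boundary :: "('a \<Rightarrow> 'a \<Rightarrow> real) \<Rightarrow> 'a set \<Rightarrow> 'a set" where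
  "vertex_boundary w S = {x. x \<notin> S \<and> (\<exists>y\<in>S. (y, x) \<in> edges w)}"

definition D_vertices :: "('a \<Rightarrow> 'a \<Rightarrow> real) \<Rightarrow> 'a set \<Rightarrow> 'a set" where
  "D_vertices w S = S \<union> vertex_boundary w S"

text \<open>The edges within \<open>S\<close> and those joining \<open>S\<close> to its boundary.\<close>

definition D_edges :: "('a \<Rightarrow> 'a \<Rightarrow> real) \<Rightarrow> 'a set \<Rightarrow> ('a \<times> 'a) set" where
  "D_edges w S = {(x, y) \<in> edges w. x \<in> D_vertices w S \<and> y \<in> D_vertices w S \<and> (x \<in> S \<or> y \<in> S)}"

definition D_components :: "('a \<Rightarrow> 'a \<Rightarrow> real) \<Rightarrow> 'a set \<Rightarrow> 'a set set" where
  "D_components w S = graph_components (D_vertices w S - vertex_boundary w S) (D_edges w S)"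

definition dirichlet_eigenvalue :: "('a::finite \<Rightarrow> 'a \<Rightarrow> real) \<Rightarrow> 'a set \<Rightarrow> nat \<Rightarrow> real" where
  "dirichlet_eigenvalue w S m = eigenvalue S (laplacian w) m"


section \<open>Eigenvalue branches\<close>

text \<open>Local power series expansions relative to \<open>S\<close>; at an end point of an interval this amounts to
  analyticity of an extension beyond it.\<close>

definition real_analytic_on :: "(real \<Rightarrow> real) \<Rightarrow> real set \<Rightarrow> bool" where
  "real_analytic_on f S \<longleftrightarrow>
     (\<forall>s\<in>S. \<exists>c r. 0 < r \<and> (\<forall>t\<in>S. \<bar>t - s\<bar> < r \<longrightarrow> (\<lambda>n. c n * (t - s) ^ n) sums f t))"

text \<open>Branches are indexed by the natural numbers below \<^term>\<open>card (sub_vertices w \<psi>)\<close>, so that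
  coinciding branches are counted separately.\<close>

definition eigenvalue_branches ::
    "('v::finite \<Rightarrow> 'v \<Rightarrow> real) \<Rightarrow> real^'v \<Rightarrow> (nat \<Rightarrow> real \<Rightarrow> real) \<Rightarrow> bool" where
  "eigenvalue_branches w \<psi> b \<longleftrightarrow>
     (\<forall>n < card (sub_vertices w \<psi>). real_analytic_on (b n) {0..}) \<and>
     (\<forall>\<sigma>\<ge>0. image_mset (\<lambda>n. b n \<sigma>) (mset_set {..<card (sub_vertices w \<psi>)})
             = eigenvalue_mset (sub_vertices w \<psi>) (B_matrix w \<psi> \<sigma>))"

definition crosses :: "(real \<Rightarrow> real) \<Rightarrow> real \<Rightarrow> bool" where
  "crosses f \<mu> \<longleftrightarrow> f 0 < \<mu> \<and> (\<forall>\<^sub>F \<sigma> in at_top. \<mu> < f \<sigma>) \<and>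
     (\<exists>l::ereal. ((\<lambda>\<sigma>. ereal (f \<sigma>)) \<longlongrightarrow> l) at_top \<and> ereal \<mu> < l)"

end

theory Submission
  imports Defs "HOL-Complex_Analysis.Complex_Analysis"
    "HOL-Computational_Algebra.Fundamental_Theorem_Algebra"
begin

text \<open>
  Write \<open>x\<close> for the values of a vector on the original vertices and \<open>z\<close> for its values on the ghosts. The
  quadratic form of \<open>B\<^sub>\<sigma>\<close> is \<open>D(x) + \<sigma>/(1+\<sigma>) G(x,z) + \<sigma> |z|\<^sup>2\<close>, where \<open>D\<close> is the Dirichlet energy of the
  original graph and \<open>G\<close> does not depend on \<open>\<sigma>\<close>. The weights of the two half-edges are chosen such that what
  \<open>G\<close> takes away from a sign-change edge is completed to a square (\<open>ghost_energy_squares\<close>). Hence the form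
  increases with \<open>\<sigma>\<close>, and since the number of eigenvalues below a threshold is the largest dimension of a
  subspace on which the form lies below it, everything about sorted eigenvalues is a statement about
  quadratic forms on subspaces.

  Convergence: for large \<open>\<sigma>\<close> the penalty \<open>\<sigma> |z|\<^sup>2\<close> forces \<open>z = 0\<close>, and there the form tends from below to that of
  the Dirichlet Laplacian. A compactness argument on the unit sphere (\<open>count_le_B_eventually\<close>) shows that
  the number of eigenvalues up to \<open>c\<close> is eventually that of the Dirichlet problem, for every \<open>c\<close>; the
  remaining eigenvalues exceed every \<open>c\<close>.

  Nodal domains: with \<open>x = f \<psi>\<close>, the form of the Dirichlet Laplacian minus \<open>\<lambda>\<^sub>k |x|\<^sup>2\<close> becomes
  half the sum of \<open>w\<^sub>i\<^sub>j \<psi>\<^sub>i \<psi>\<^sub>j (f\<^sub>i - f\<^sub>j)\<^sup>2\<close> over the edges without a sign change (\<open>Linf_ground_state\<close>). All these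
  terms are non-negative, so \<open>\<lambda>\<^sub>k\<close> is the lowest Dirichlet eigenvalue, and its eigenfunctions are those with
  \<open>f\<close> constant on every nodal domain; their dimension is the nodal count \<open>\<nu>\<close>.

  Branches: that the eigenvalues of a real-analytic family of symmetric matrices can be labelled
  analytically is Rellich's theorem. It is proved here for families of monic polynomials with only real
  roots. Around a root of multiplicity \<open>m\<close> one recentres so that the coefficient of \<open>z\<^sup>m\<^sup>-\<^sup>1\<close> vanishes; real-rootedness
  then forces the Newton polygon to have an integral slope \<open>r\<close> (\<open>newton_slope\<close>), so substituting
  \<open>(t - s)\<^sup>r z\<close> for \<open>z\<close> keeps the coefficients analytic and splits the multiple root. Local labellings
  are glued along the half-line by the identity theorem.

  Crossings: at \<open>\<sigma> = 0\<close> the form is that of the original graph with isolated ghosts, so \<open>k - 1 + |V\<^sub>g\<^sub>h|\<close> branches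
  start below \<open>\<lambda>\<^sub>k\<close>. For all large \<open>\<sigma>\<close> exactly \<open>\<nu> - 1\<close> are below \<open>\<lambda>\<^sub>k\<close> and one equals \<open>\<lambda>\<^sub>k\<close> (\<open>counts_B_large\<close>; connectedness
  of the graph enters here). Branches are monotone because sorted eigenvalues are, and the one that equals
  \<open>\<lambda>\<^sub>k\<close> eventually is constant by analyticity. So \<open>k - 1 + |V\<^sub>g\<^sub>h| - (\<nu> - 1)\<close> branches cross.
\<close>

(* The dollar sign stands for vector components only. *)
no_notation fps_nth (infixl \<open>$\<close> 75)


section \<open>Spectral theory of symmetric submatrices\<close>

text \<open>A maximizer of the Rayleigh quotient is an eigenvector: if \<open>m\<close> is the maximum, the form \<open>m |v|\<^sup>2 - v \<bullet> T v\<close> is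
  non-negative on \<open>U\<close> and vanishes at \<open>u\<close>, so its linear part at \<open>u\<close> vanishes, which says that \<open>T u - m u\<close> is
  orthogonal to \<open>U\<close>.\<close>

lemma rayleigh_maximizer_eigenvector:
  fixes T :: "'a::euclidean_space \<Rightarrow> 'a"
  assumes lin: "linear T" and U: "subspace U" and inv: "\<And>u. u \<in> U \<Longrightarrow> T u \<in> U"
    and sa: "\<And>u v. u \<in> U \<Longrightarrow> v \<in> U \<Longrightarrow> T u \<bullet> v = u \<bullet> T v"
    and nontriv: "U \<noteq> {0}"
  obtains u m where "u \<in> U" "norm u = 1" "T u = m *\<^sub>R u"
proof -
  define K where "K = U \<inter> sphere 0 1"
  have comp: "compact K"
    unfolding K_def by (intro closed_Int_compact closed_subspace U compact_sphere)
  obtain x where x: "x \<in> U" "x \<noteq> 0" using nontriv subspace_0[OF U] by blast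
  have "x /\<^sub>R norm x \<in> K"
    unfolding K_def using x subspace_scale[OF U] by auto
  hence ne: "K \<noteq> {}" by auto
  have cont: "continuous_on K (\<lambda>u. u \<bullet> T u)"
    by (intro continuous_intros linear_continuous_on linear_conv_bounded_linear[THEN iffD1] lin)
  obtain u where u: "u \<in> K" and max: "\<And>v. v \<in> K \<Longrightarrow> v \<bullet> T v \<le> u \<bullet> T u"
    using continuous_attains_sup[OF comp ne cont] by blast
  define m where "m = u \<bullet> T u"
  have uU: "u \<in> U" and nu: "norm u = 1" using u by (auto simp: K_def)
  have uu: "u \<bullet> u = 1" using nu by (simp add: norm_eq_1)
  have le: "v \<bullet> T v \<le> m * (v \<bullet> v)" if v: "v \<in> U" for v
  proof (cases "v = 0")
    case False
    have "v /\<^sub>R norm v \<in> K" unfolding K_def using v False subspace_scale[OF U] by auto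
    from max[OF this] have "(v \<bullet> T v) / (norm v)\<^sup>2 \<le> m"
      by (simp add: linear_cmul[OF lin] m_def power2_eq_square divide_inverse mult_ac)
    thus ?thesis using False by (simp add: divide_le_eq power2_norm_eq_inner)
  qed (simp add: linear_0[OF lin])
  have orth: "(T u - m *\<^sub>R u) \<bullet> v = 0" if v: "v \<in> U" for v
  proof -
    define a where "a = m * (u \<bullet> v) - T u \<bullet> v"
    define g where "g = m * (v \<bullet> v) - v \<bullet> T v"
    have ge: "0 \<le> 2 * s * a + s\<^sup>2 * g" for s
    proof -
      have "u + s *\<^sub>R v \<in> U" using uU v U by (simp add: subspace_add subspace_scale)
      from le[OF this] have "0 \<le> m * ((u + s *\<^sub>R v) \<bullet> (u + s *\<^sub>R v)) - (u + s *\<^sub>R v) \<bullet> T (u + s *\<^sub>R v)"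
        by simp
      also have "\<dots> = 2 * s * a + s\<^sup>2 * g"
        using sa[OF uU v] uu
        by (simp add: linear_add[OF lin] linear_cmul[OF lin] inner_add a_def g_def m_def[symmetric]
            algebra_simps power2_eq_square inner_commute)
      finally show ?thesis .
    qed
    have "a = 0"
    proof (cases "g = 0")
      case True
      have "0 \<le> - (2 * a\<^sup>2)" using ge[of "-a"] True by (simp add: power2_eq_square)
      thus ?thesis by simp
    next
      case False
      have "0 \<le> g" using le[OF v] by (simp add: g_def)
      with False have "0 < g" by simp
      have "2 * (- a / g) * a + (- a / g)\<^sup>2 * g = - (a\<^sup>2 / g)"
        using False by (simp add: field_simps power2_eq_square)
      hence "0 \<le> - (a\<^sup>2 / g)" using ge[of "- a / g"] by simp
      hence "a\<^sup>2 / g \<le> 0" by simp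
      hence "a\<^sup>2 \<le> 0" using \<open>0 < g\<close> by (simp add: divide_le_0_iff)
      thus ?thesis by simp
    qed
    thus ?thesis by (simp add: a_def inner_diff_left)
  qed
  have "T u - m *\<^sub>R u \<in> U" using inv uU U by (simp add: subspace_diff subspace_scale)
  from orth[OF this] have "T u = m *\<^sub>R u" by simp
  thus ?thesis using that uU nu by blast
qed

text \<open>Induction on the dimension: the orthogonal complement of an eigenvector is again invariant.\<close>

lemma self_adjoint_orthonormal_eigenbasis:
  fixes T :: "'a::euclidean_space \<Rightarrow> 'a"
  assumes lin: "linear T" and U: "subspace U" and inv: "\<And>u. u \<in> U \<Longrightarrow> T u \<in> U"
    and sa: "\<And>u v. u \<in> U \<Longrightarrow> v \<in> U \<Longrightarrow> T u \<bullet> v = u \<bullet> T v"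
  shows "\<exists>B \<subseteq> U. span B = U \<and> pairwise orthogonal B \<and>
           (\<forall>b\<in>B. norm b = 1 \<and> (\<exists>d. T b = d *\<^sub>R b))"
  using U inv sa
proof (induction "dim U" arbitrary: U rule: less_induct)
  case less
  show ?case
  proof (cases "U = {0}")
    case True
    thus ?thesis by (intro exI[of _ "{}"]) auto
  next
    case False
    obtain u m where u: "u \<in> U" "norm u = 1" "T u = m *\<^sub>R u"
      using rayleigh_maximizer_eigenvector[OF lin less.prems(1,2,3) False] by blast
    define U' where "U' = {v \<in> U. u \<bullet> v = 0}"
    have sub: "subspace U'"
      unfolding U'_def using less.prems(1)
      by (auto simp: subspace_def inner_add inner_right_distrib)
    have uu: "u \<bullet> u = 1" using u(2) by (simp add: norm_eq_1)
    have "u \<notin> U'" using uu by (auto simp: U'_def)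
    moreover have "U' \<subseteq> U" by (auto simp: U'_def)
    ultimately have "U' \<subset> U" using u(1) by blast
    hence "dim U' < dim U"
      by (metis less.prems(1) sub dim_psubset span_eq_iff)
    moreover have "T v \<in> U'" if "v \<in> U'" for v
      using that less.prems(2)[of v] less.prems(3)[OF u(1), of v] u(3) by (auto simp: U'_def)
    moreover have "T a \<bullet> b = a \<bullet> T b" if "a \<in> U'" "b \<in> U'" for a b
      using that less.prems(3) by (auto simp: U'_def)
    ultimately obtain B where B: "B \<subseteq> U'" "span B = U'" "pairwise orthogonal B"
      "\<forall>b\<in>B. norm b = 1 \<and> (\<exists>d. T b = d *\<^sub>R b)"
      using less.hyps[of U'] sub by blast
    have "v \<in> span (insert u B)" if v: "v \<in> U" for v
    proof -
      have "v - (u \<bullet> v) *\<^sub>R u \<in> U'"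
        using v u uu less.prems(1) by (auto simp: U'_def subspace_diff subspace_scale inner_diff_right)
      hence "v - (u \<bullet> v) *\<^sub>R u \<in> span B" using B by simp
      thus ?thesis by (rule span_breakdown_eq[THEN iffD2, OF exI])
    qed
    moreover have "insert u B \<subseteq> U" using u B(1) by (auto simp: U'_def)
    ultimately have "span (insert u B) = U"
      by (meson less.prems(1) span_minimal subsetI subset_antisym)
    moreover have "pairwise orthogonal (insert u B)"
      using B(1,3) by (auto simp: pairwise_insert U'_def orthogonal_def inner_commute)
    ultimately show ?thesis
      using u B(4) \<open>insert u B \<subseteq> U\<close> by (intro exI[of _ "insert u B"]) auto
  qed
qed

definition supported :: "'n::finite set \<Rightarrow> (real^'n) set" where
  "supported A = {u. \<forall>i. i \<notin> A \<longrightarrow> u $ i = 0}"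

lemma subspace_supported: "subspace (supported A)"
  by (auto simp: supported_def subspace_def)

text \<open>This is how an eigenvalue equation that holds only in the rows of \<open>A\<close> is used in inner products.\<close>

lemma inner_supported_cong:
  assumes "u \<in> supported A" "\<And>i. i \<in> A \<Longrightarrow> v $ i = v' $ i"
  shows "u \<bullet> v = u \<bullet> v'"
  unfolding inner_vec_def by (rule sum.cong) (use assms in \<open>auto simp: supported_def\<close>)

lemma dim_supported: "dim (supported A :: (real^'n::finite) set) = card A"
proof -
  let ?B = "(\<lambda>i. axis i 1) ` A :: (real^'n) set"
  have "supported A \<subseteq> span ?B"
  proof
    fix u :: "real^'n" assume u: "u \<in> supported A"
    have "u = (\<Sum>i\<in>UNIV. u $ i *\<^sub>R axis i 1)"
      by (simp add: vec_eq_iff axis_def if_distrib cong: if_cong)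
    also have "\<dots> = (\<Sum>i\<in>A. u $ i *\<^sub>R axis i 1)"
      by (rule sum.mono_neutral_right) (use u in \<open>auto simp: supported_def\<close>)
    also have "\<dots> \<in> span ?B" by (intro span_sum span_scale span_base) auto
    finally show "u \<in> span ?B" .
  qed
  moreover have "?B \<subseteq> supported A" by (auto simp: supported_def axis_def)
  moreover have "independent ?B"
    by (rule independent_mono[OF independent_Basis]) (auto simp: Basis_vec_def)
  moreover have "card ?B = card A" by (rule card_image) (auto simp: inj_on_def axis_eq_axis)
  ultimately show ?thesis by (metis dim_unique)
qed

definition symmetric_matrix :: "real^'n^'n \<Rightarrow> bool" where
  "symmetric_matrix M \<longleftrightarrow> (\<forall>i j. M $ i $ j = M $ j $ i)"

lemma symmetric_matrix_inner:
  fixes M :: "real^'n::finite^'n"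
  assumes "symmetric_matrix M"
  shows "(M *v u) \<bullet> v = u \<bullet> (M *v v)"
proof -
  have "transpose M = M" using assms by (simp add: symmetric_matrix_def transpose_def vec_eq_iff)
  thus ?thesis by (metis dot_lmul_matrix inner_commute transpose_matrix_vector)
qed

lemma size_filter_image_mset_set:
  "finite A \<Longrightarrow> size (filter_mset P (image_mset d (mset_set A))) = card {i \<in> A. P (d i)}"
  by (simp add: filter_mset_image_mset)

text \<open>The basis is indexed by \<open>A\<close> itself, so that together with the unit vectors of the other indices it forms
  the columns of a square matrix; \<open>eigenbasis_det\<close> relies on this.\<close>

definition eigenbasis ::
    "'n::finite set \<Rightarrow> real^'n^'n \<Rightarrow> ('n \<Rightarrow> real^'n) \<Rightarrow> ('n \<Rightarrow> real) \<Rightarrow> bool" where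
  "eigenbasis A M f d \<longleftrightarrow>
     (\<forall>i\<in>A. f i \<in> supported A) \<and> (\<forall>i\<in>A. \<forall>j\<in>A. f i \<bullet> f j = (if i = j then 1 else 0)) \<and>
     (\<forall>i\<in>A. \<forall>x\<in>A. (M *v f i) $ x = d i * f i $ x)"

lemma eigenbasis_exists:
  fixes M :: "real^'n::finite^'n"
  assumes sym: "symmetric_matrix M"
  shows "\<exists>f d. eigenbasis A M f d"
proof -
  define T where "T = (\<lambda>u. \<chi> i. if i \<in> A then (M *v u) $ i else 0)"
  have lin: "linear T"
    unfolding T_def
    by (rule linearI) (auto simp: vec_eq_iff matrix_vector_right_distrib matrix_vector_mult_scaleR)
  have T_supp: "T u \<in> supported A" for u by (simp add: T_def supported_def)
  have T_inner: "u \<bullet> T v = u \<bullet> (M *v v)" if "u \<in> supported A" for u v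
    using that by (rule inner_supported_cong) (simp add: T_def)
  have "T u \<bullet> v = u \<bullet> T v" if "u \<in> supported A" "v \<in> supported A" for u v
    using T_inner[OF that(1), of v] T_inner[OF that(2), of u] symmetric_matrix_inner[OF sym, of u v]
    by (simp add: inner_commute)
  from self_adjoint_orthonormal_eigenbasis[OF lin subspace_supported T_supp this]
  obtain B where B: "B \<subseteq> supported A" "span B = supported A" "pairwise orthogonal B"
    "\<forall>b\<in>B. norm b = 1 \<and> (\<exists>d. T b = d *\<^sub>R b)"
    by blast
  have "0 \<notin> B" using B(4) by auto
  hence indep: "independent B" using B(3) pairwise_orthogonal_independent by blast
  hence "card B = card A" by (metis B(2) dim_span dim_supported indep dim_eq_card_independent)
  moreover have "finite B" using indep independent_imp_finite by blast
  ultimately obtain f where f: "bij_betw f A B"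
    using finite_same_card_bij[of A B] finite by metis
  obtain e where e: "\<forall>b\<in>B. T b = e b *\<^sub>R b" using B(4) by metis
  have fB: "f i \<in> B" if "i \<in> A" for i using f that by (auto simp: bij_betw_def)
  have "f i \<bullet> f j = (if i = j then 1 else 0)" if "i \<in> A" "j \<in> A" for i j
  proof (cases "i = j")
    case True
    thus ?thesis using B(4) fB[OF that(1)] by (simp add: norm_eq_1)
  next
    case False
    hence "f i \<noteq> f j" using f that by (auto simp: bij_betw_def inj_on_def)
    thus ?thesis using B(3) fB that False by (auto simp: pairwise_def orthogonal_def)
  qed
  moreover have "(M *v f i) $ x = e (f i) * f i $ x" if "i \<in> A" "x \<in> A" for i x
  proof -
    have "T (f i) $ x = (e (f i) *\<^sub>R f i) $ x" using e fB[OF that(1)] by simp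
    thus ?thesis using that(2) by (simp add: T_def)
  qed
  ultimately have "eigenbasis A M f (\<lambda>i. e (f i))"
    using fB B(1) by (auto simp: eigenbasis_def)
  thus ?thesis by blast
qed

context
  fixes A :: "'n::finite set" and M :: "real^'n^'n" and f d
  assumes eb: "eigenbasis A M f d"
begin

lemma eigenbasis_inner: "i \<in> A \<Longrightarrow> j \<in> A \<Longrightarrow> f i \<bullet> f j = (if i = j then 1 else 0)"
  using eb by (auto simp: eigenbasis_def)

lemma eigenbasis_supported: "i \<in> A \<Longrightarrow> f i \<in> supported A"
  using eb by (auto simp: eigenbasis_def)

lemma eigenbasis_inj: "inj_on f A"
proof (rule inj_onI)
  fix i j assume "i \<in> A" "j \<in> A" "f i = f j"
  hence "(if i = j then 1 else 0) = (1::real)"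
    using eigenbasis_inner[of i j] eigenbasis_inner[of i i] by simp
  thus "i = j" by (simp split: if_splits)
qed

lemma eigenbasis_independent:
  assumes "J \<subseteq> A" shows "independent (f ` J)"
proof (rule pairwise_orthogonal_independent)
  show "pairwise orthogonal (f ` J)"
    using assms eigenbasis_inner by (auto simp: pairwise_def orthogonal_def subset_iff)
  have "f i \<noteq> 0" if "i \<in> A" for i using eigenbasis_inner[OF that that] by auto
  thus "0 \<notin> f ` J" using assms by (metis image_iff subsetD)
qed

lemma eigenbasis_dim_span: "J \<subseteq> A \<Longrightarrow> dim (span (f ` J)) = card J"
  by (metis eigenbasis_independent dim_span dim_eq_card_independent card_image inj_on_subset eigenbasis_inj)

lemma eigenbasis_span: "span (f ` A) = supported A"
proof (rule subspace_dim_equal)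
  show "span (f ` A) \<subseteq> supported A"
    by (intro span_minimal subspace_supported) (use eigenbasis_supported in auto)
  show "dim (supported A) \<le> dim (span (f ` A))"
    using eigenbasis_dim_span[of A] by (simp add: dim_supported)
qed (auto simp: subspace_supported)

lemma eigenbasis_expand_span:
  assumes J: "J \<subseteq> A" and u: "u \<in> span (f ` J)"
  shows "u = (\<Sum>i\<in>J. (f i \<bullet> u) *\<^sub>R f i)" and "\<And>i. i \<in> A - J \<Longrightarrow> f i \<bullet> u = 0"
proof -
  have fin: "finite (f ` J)" by simp
  obtain c where c: "u = (\<Sum>v\<in>f ` J. c v *\<^sub>R v)"
    using u unfolding span_finite[OF fin] by auto
  hence c': "u = (\<Sum>i\<in>J. c (f i) *\<^sub>R f i)"
    using inj_on_subset[OF eigenbasis_inj J] by (simp add: sum.reindex)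
  have coef: "f i \<bullet> u = (if i \<in> J then c (f i) else 0)" if "i \<in> A" for i
  proof -
    have "f i \<bullet> u = (\<Sum>j\<in>J. c (f j) * (if i = j then 1 else 0))"
      unfolding c' inner_sum_right
      by (rule sum.cong) (use J that eigenbasis_inner in auto)
    thus ?thesis by (simp add: if_distrib[of "\<lambda>a. _ * a"] cong: if_cong)
  qed
  show "u = (\<Sum>i\<in>J. (f i \<bullet> u) *\<^sub>R f i)"
    by (subst c', rule sum.cong) (use J coef in auto)
  show "f i \<bullet> u = 0" if "i \<in> A - J" for i using coef[of i] that by simp
qed

lemma eigenbasis_form:
  assumes u: "u \<in> supported A"
  shows "u \<bullet> u = (\<Sum>i\<in>A. (f i \<bullet> u)\<^sup>2)" and "u \<bullet> (M *v u) = (\<Sum>i\<in>A. d i * (f i \<bullet> u)\<^sup>2)"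
proof -
  have ex: "u = (\<Sum>i\<in>A. (f i \<bullet> u) *\<^sub>R f i)"
    using eigenbasis_expand_span(1)[of A u] u eigenbasis_span by simp
  have "u \<bullet> u = (\<Sum>i\<in>A. (f i \<bullet> u) *\<^sub>R f i) \<bullet> u" using ex by simp
  thus "u \<bullet> u = (\<Sum>i\<in>A. (f i \<bullet> u)\<^sup>2)" by (simp add: inner_sum_left power2_eq_square)
  have "M *v u = (\<Sum>i\<in>A. (f i \<bullet> u) *\<^sub>R (M *v f i))"
    by (subst ex) (simp add: linear_sum[OF matrix_vector_mul_linear] matrix_vector_mult_scaleR)
  hence "u \<bullet> (M *v u) = (\<Sum>i\<in>A. (f i \<bullet> u) * (u \<bullet> (M *v f i)))"
    by (simp add: inner_sum_right)
  also have "\<dots> = (\<Sum>i\<in>A. (f i \<bullet> u) * (u \<bullet> (d i *\<^sub>R f i)))"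
    by (rule sum.cong, simp, subst inner_supported_cong[OF u])
      (use eb in \<open>auto simp: eigenbasis_def\<close>)
  finally show "u \<bullet> (M *v u) = (\<Sum>i\<in>A. d i * (f i \<bullet> u)\<^sup>2)"
    by (simp add: inner_commute power2_eq_square mult_ac)
qed

lemma eigenbasis_form_span:
  assumes J: "J \<subseteq> A" and u: "u \<in> span (f ` J)"
  shows "u \<bullet> u = (\<Sum>i\<in>J. (f i \<bullet> u)\<^sup>2)" and "u \<bullet> (M *v u) = (\<Sum>i\<in>J. d i * (f i \<bullet> u)\<^sup>2)"
proof -
  have us: "u \<in> supported A" using u span_mono[OF image_mono[OF J]] eigenbasis_span by blast
  show "u \<bullet> u = (\<Sum>i\<in>J. (f i \<bullet> u)\<^sup>2)"
    unfolding eigenbasis_form(1)[OF us]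
    by (rule sum.mono_neutral_right) (use J eigenbasis_expand_span(2)[OF J u] in auto)
  show "u \<bullet> (M *v u) = (\<Sum>i\<in>J. d i * (f i \<bullet> u)\<^sup>2)"
    unfolding eigenbasis_form(2)[OF us]
    by (rule sum.mono_neutral_right) (use J eigenbasis_expand_span(2)[OF J u] in auto)
qed

lemma eigenbasis_span_le:
  assumes J: "J \<subseteq> A" and u: "u \<in> span (f ` J)"
  shows "(\<And>i. i \<in> J \<Longrightarrow> d i \<le> c) \<Longrightarrow> u \<bullet> (M *v u) \<le> c * (u \<bullet> u)"
    and "(\<And>i. i \<in> J \<Longrightarrow> c \<le> d i) \<Longrightarrow> c * (u \<bullet> u) \<le> u \<bullet> (M *v u)"
  unfolding eigenbasis_form_span[OF J u] sum_distrib_left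
  by (intro sum_mono mult_right_mono; simp)+

lemma eigenbasis_span_less:
  assumes J: "J \<subseteq> A" and u: "u \<in> span (f ` J)" "u \<noteq> 0"
  shows "(\<And>i. i \<in> J \<Longrightarrow> d i < c) \<Longrightarrow> u \<bullet> (M *v u) < c * (u \<bullet> u)"
    and "(\<And>i. i \<in> J \<Longrightarrow> c < d i) \<Longrightarrow> c * (u \<bullet> u) < u \<bullet> (M *v u)"
proof -
  have "(\<Sum>i\<in>J. (f i \<bullet> u)\<^sup>2) \<noteq> 0"
    unfolding eigenbasis_form_span(1)[OF J u(1), symmetric] using u(2) by simp
  then obtain j where "j \<in> J" "(f j \<bullet> u)\<^sup>2 \<noteq> 0" by (rule sum.not_neutral_contains_not_neutral)
  hence j: "j \<in> J" "0 < (f j \<bullet> u)\<^sup>2" by auto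
  show "u \<bullet> (M *v u) < c * (u \<bullet> u)" if "\<And>i. i \<in> J \<Longrightarrow> d i < c"
    unfolding eigenbasis_form_span[OF J u(1)] sum_distrib_left
  proof (rule sum_strict_mono_ex1)
    show "\<forall>i\<in>J. d i * (f i \<bullet> u)\<^sup>2 \<le> c * (f i \<bullet> u)\<^sup>2"
      using that by (simp add: mult_right_mono less_imp_le)
    show "\<exists>i\<in>J. d i * (f i \<bullet> u)\<^sup>2 < c * (f i \<bullet> u)\<^sup>2"
      by (intro bexI[of _ j] mult_strict_right_mono that j)
  qed simp
  show "c * (u \<bullet> u) < u \<bullet> (M *v u)" if "\<And>i. i \<in> J \<Longrightarrow> c < d i"
    unfolding eigenbasis_form_span[OF J u(1)] sum_distrib_left
  proof (rule sum_strict_mono_ex1)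
    show "\<forall>i\<in>J. c * (f i \<bullet> u)\<^sup>2 \<le> d i * (f i \<bullet> u)\<^sup>2"
      using that by (simp add: mult_right_mono less_imp_le)
    show "\<exists>i\<in>J. c * (f i \<bullet> u)\<^sup>2 < d i * (f i \<bullet> u)\<^sup>2"
      by (intro bexI[of _ j] mult_strict_right_mono that j)
  qed simp
qed

lemma eigenbasis_eigenspace:
  assumes sym: "symmetric_matrix M"
  shows "eigenspace A M \<mu> = span (f ` {i \<in> A. d i = \<mu>})" (is "?E = span (f ` ?J)")
proof (intro subset_antisym subsetI)
  fix u assume "u \<in> ?E"
  hence us: "u \<in> supported A" and ue: "\<And>x. x \<in> A \<Longrightarrow> (M *v u) $ x = (\<mu> *\<^sub>R u) $ x"
    by (auto simp: eigenspace_def supported_def)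
  have z: "f i \<bullet> u = 0" if i: "i \<in> A" "d i \<noteq> \<mu>" for i
  proof -
    have "\<mu> * (f i \<bullet> u) = f i \<bullet> (M *v u)"
      using inner_supported_cong[OF eigenbasis_supported[OF i(1)] ue] by simp
    also have "\<dots> = u \<bullet> (M *v f i)" by (metis inner_commute symmetric_matrix_inner[OF sym])
    also have "\<dots> = u \<bullet> (d i *\<^sub>R f i)"
      by (rule inner_supported_cong[OF us]) (use eb i in \<open>auto simp: eigenbasis_def\<close>)
    finally show ?thesis using i(2) by (simp add: inner_commute)
  qed
  have "u = (\<Sum>i\<in>A. (f i \<bullet> u) *\<^sub>R f i)"
    using eigenbasis_expand_span(1)[of A u] us eigenbasis_span by simp
  also have "\<dots> = (\<Sum>i\<in>?J. (f i \<bullet> u) *\<^sub>R f i)"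
    by (rule sum.mono_neutral_right) (use z in auto)
  also have "\<dots> \<in> span (f ` ?J)" by (intro span_sum span_scale span_base) auto
  finally show "u \<in> span (f ` ?J)" .
next
  fix u assume u: "u \<in> span (f ` ?J)"
  have "subspace ?E"
    by (auto simp: eigenspace_def subspace_def matrix_vector_right_distrib matrix_vector_mult_scaleR
        algebra_simps)
  moreover have "f ` ?J \<subseteq> ?E" using eb by (auto simp: eigenbasis_def eigenspace_def supported_def)
  ultimately show "u \<in> ?E" using u span_minimal by blast
qed

lemma eigenbasis_eig_mult:
  assumes "symmetric_matrix M" shows "eig_mult A M \<mu> = card {i \<in> A. d i = \<mu>}"
  unfolding eig_mult_def eigenbasis_eigenspace[OF assms] by (rule eigenbasis_dim_span) auto

lemma eigenbasis_eigenvalue_mset: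
  assumes sym: "symmetric_matrix M" shows "eigenvalue_mset A M = image_mset d (mset_set A)"
proof (rule multiset_eqI)
  fix x
  have set: "{\<mu>. 0 < eig_mult A M \<mu>} = d ` A"
    by (auto simp: eigenbasis_eig_mult[OF sym] card_gt_0_iff)
  have "count (eigenvalue_mset A M) x = (\<Sum>\<mu>\<in>d ` A. if \<mu> = x then eig_mult A M x else 0)"
    unfolding eigenvalue_mset_def set count_sum by (rule sum.cong) (auto simp: count_replicate_mset)
  also have "\<dots> = card {i \<in> A. d i = x}"
    by (auto simp: eigenbasis_eig_mult[OF sym] card_eq_0_iff)
  also have "\<dots> = count (image_mset d (mset_set A)) x"
    using arg_cong[OF filter_eq_replicate_mset[of x "image_mset d (mset_set A)"], of size]
    by (simp add: size_filter_image_mset_set)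
  finally show "count (eigenvalue_mset A M) x = count (image_mset d (mset_set A)) x" .
qed

text \<open>The dimension count behind all min-max inequalities below: two subspaces whose dimensions add up to more
  than \<open>card A\<close> meet outside zero.\<close>

lemma eigenbasis_disjoint_dim:
  assumes F: "subspace F" "F \<subseteq> supported A" and J: "J \<subseteq> A"
    and disj: "\<And>u. u \<in> F \<Longrightarrow> u \<in> span (f ` J) \<Longrightarrow> u = 0"
  shows "dim F + card J \<le> card A"
proof -
  have "F \<inter> span (f ` J) = {0}" using disj F(1) by (auto simp: subspace_0 span_zero)
  hence "dim F + dim (span (f ` J)) = dim {x + y |x y. x \<in> F \<and> y \<in> span (f ` J)}"
    using dim_sums_Int[OF F(1) subspace_span, of "f ` J"] by simp
  also have "\<dots> \<le> dim (supported A)"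
  proof (rule dim_subset)
    have "span (f ` J) \<subseteq> supported A"
      using span_mono[OF image_mono[OF J]] eigenbasis_span by blast
    thus "{x + y |x y. x \<in> F \<and> y \<in> span (f ` J)} \<subseteq> supported A"
      using F(2) subspace_add[OF subspace_supported] by blast
  qed
  finally show ?thesis using eigenbasis_dim_span[OF J] by (simp add: dim_supported)
qed

text \<open>The characteristic polynomial of the submatrix as the determinant of a matrix of full size: the rows and
  columns outside \<open>A\<close> are those of the identity. Multiplying by the matrix of eigenvectors and unit vectors
  turns it into a diagonal matrix.\<close>

lemma eigenbasis_det:
  "det (\<chi> i j. if i \<in> A \<and> j \<in> A then (if i = j then z else 0) - M $ i $ j
               else if i = j then 1 else 0) = (\<Prod>i\<in>A. z - d i)"
proof -
  define C where "C = (\<chi> i j. if i \<in> A \<and> j \<in> A then (if i = j then z else 0) - M $ i $ j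
               else if i = j then 1 else 0)"
  define g where "g = (\<lambda>i. if i \<in> A then f i else axis i 1)"
  define e where "e = (\<lambda>i. if i \<in> A then z - d i else 1)"
  define F where "F = (\<chi> i j. g j $ i)"
  have ax: "axis i (1::real) $ j = (if j = i then 1 else 0)" for i j :: 'n
    by (simp add: axis_def)
  have gg: "g i \<bullet> g j = (if i = j then 1 else 0)" for i j
    using eigenbasis_inner eigenbasis_supported
    by (auto simp: g_def inner_axis' inner_axis supported_def ax)
  have "transpose F ** F = mat 1"
    using gg by (simp add: vec_eq_iff matrix_matrix_mult_def transpose_def F_def mat_def inner_vec_def)
  hence "det (transpose F ** F) = det (mat 1 :: real^'n^'n)" by simp
  hence "det F * det F = 1" by (simp add: det_mul)
  hence nz: "det F \<noteq> 0" by auto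
  have Cg: "(C *v g j) $ i = e j * g j $ i" for i j
  proof (cases "j \<in> A")
    case True
    hence z: "g j $ x = 0" if "x \<notin> A" for x
      using eigenbasis_supported[OF True] that by (auto simp: supported_def g_def)
    show ?thesis
    proof (cases "i \<in> A")
      case i: True
      have "(C *v g j) $ i = (\<Sum>x\<in>UNIV. ((if i = x then z else 0) - M $ i $ x) * g j $ x)"
        unfolding matrix_vector_mult_def vec_lambda_beta C_def
        by (rule sum.cong) (use i z in auto)
      also have "\<dots> = z * g j $ i - (M *v g j) $ i"
        by (simp add: left_diff_distrib sum_subtractf matrix_vector_mult_def if_distrib
            [of "\<lambda>a. a * _"] cong: if_cong)
      finally show ?thesis
        using eb True i by (simp add: eigenbasis_def g_def e_def algebra_simps)
    next
      case i: False
      have "(C *v g j) $ i = (\<Sum>x\<in>UNIV. (if i = x then 1 else 0) * g j $ x)"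
        unfolding matrix_vector_mult_def vec_lambda_beta C_def
        by (rule sum.cong) (use i in auto)
      thus ?thesis using z[OF i] by (simp add: if_distrib[of "\<lambda>a. a * _"] cong: if_cong)
    qed
  next
    case False
    thus ?thesis
      by (auto simp: C_def g_def e_def matrix_vector_mult_basis column_def ax)
  qed
  have "C ** F = F ** (\<chi> i j. if i = j then e i else 0)"
  proof -
    have "(C ** F) $ i $ j = e j * g j $ i" for i j
      using Cg[of j i] by (simp add: matrix_matrix_mult_def matrix_vector_mult_def F_def)
    thus ?thesis
      by (simp add: vec_eq_iff matrix_matrix_mult_def F_def if_distrib[of "\<lambda>a. _ * a"] mult.commute
          cong: if_cong)
  qed
  hence "det C * det F = det F * det (\<chi> i j. if i = j then e i else 0)"
    by (simp only: det_mul[symmetric])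
  moreover have "det (\<chi> i j. if i = j then e i else 0) = (\<Prod>i\<in>UNIV. e i)"
    by (subst det_diagonal) auto
  ultimately have "det C = (\<Prod>i\<in>UNIV. e i)" using nz by simp
  also have "\<dots> = (\<Prod>i\<in>A. e i)"
    by (rule prod.mono_neutral_right) (auto simp: e_def)
  also have "\<dots> = (\<Prod>i\<in>A. z - d i)" by (rule prod.cong) (auto simp: e_def)
  finally show ?thesis unfolding C_def .
qed

end

text \<open>The min-max principle takes its simplest form for the number of eigenvalues below a threshold. The
  sorted eigenvalues are recovered from these numbers by \<open>eigenvalue_le_iff_count\<close> and
  \<open>eigenvalue_less_iff_count\<close>.\<close>

definition count_le :: "'n::finite set \<Rightarrow> real^'n^'n \<Rightarrow> real \<Rightarrow> nat" where
  "count_le A M c = size (filter_mset (\<lambda>x. x \<le> c) (eigenvalue_mset A M))"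

definition count_less :: "'n::finite set \<Rightarrow> real^'n^'n \<Rightarrow> real \<Rightarrow> nat" where
  "count_less A M c = size (filter_mset (\<lambda>x. x < c) (eigenvalue_mset A M))"

lemma sorted_list_nth_iff_filter:
  fixes X :: "'a::linorder multiset"
  assumes m: "1 \<le> m" "m \<le> size X" and P: "\<And>x y. x \<le> y \<Longrightarrow> P y \<Longrightarrow> P x"
  shows "P (sorted_list_of_multiset X ! (m - 1)) \<longleftrightarrow> m \<le> size (filter_mset P X)"
proof -
  define xs where "xs = sorted_list_of_multiset X"
  have sorted: "sorted xs" and X: "mset xs = X" by (simp_all add: xs_def)
  have len: "length xs = size X" using X size_mset by metis
  define I where "I = {i. i < length xs \<and> P (xs ! i)}"
  have "size (filter_mset P X) = card I"
    unfolding X[symmetric] mset_filter[symmetric] size_mset I_def by (rule length_filter_conv_card)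
  moreover have "finite I" by (simp add: I_def)
  moreover have "{..<m} \<subseteq> I" if "P (xs ! (m - 1))"
  proof
    fix i assume "i \<in> {..<m}"
    hence "xs ! i \<le> xs ! (m - 1)" using m len by (intro sorted_nth_mono[OF sorted]) auto
    thus "i \<in> I" using P[OF _ that] \<open>i \<in> {..<m}\<close> m len by (auto simp: I_def)
  qed
  moreover have "I \<subseteq> {..<m - 1}" if "\<not> P (xs ! (m - 1))"
  proof
    fix i assume i: "i \<in> I"
    show "i \<in> {..<m - 1}"
    proof (rule ccontr)
      assume "i \<notin> {..<m - 1}"
      hence "xs ! (m - 1) \<le> xs ! i" using i by (intro sorted_nth_mono[OF sorted]) (auto simp: I_def)
      thus False using that i P by (auto simp: I_def)
    qed
  qed
  ultimately show ?thesis
    unfolding xs_def[symmetric]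
    using card_mono[of I "{..<m}"] card_mono[of "{..<m - 1}" I] m by (cases "P (xs ! (m - 1))") auto
qed

context
  fixes A :: "'n::finite set" and M :: "real^'n^'n"
  assumes sym: "symmetric_matrix M"
begin

lemma size_eigenvalue_mset: "size (eigenvalue_mset A M) = card A"
proof -
  obtain f d where "eigenbasis A M f d" using eigenbasis_exists[OF sym] by blast
  thus ?thesis using eigenbasis_eigenvalue_mset sym by fastforce
qed

lemma eigenvalue_le_iff_count:
  assumes "1 \<le> m" "m \<le> card A"
  shows "eigenvalue A M m \<le> c \<longleftrightarrow> m \<le> count_le A M c"
  unfolding eigenvalue_def count_le_def
  by (rule sorted_list_nth_iff_filter) (use assms size_eigenvalue_mset in auto)

lemma eigenvalue_less_iff_count:
  assumes "1 \<le> m" "m \<le> card A"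
  shows "eigenvalue A M m < c \<longleftrightarrow> m \<le> count_less A M c"
  unfolding eigenvalue_def count_less_def
  by (rule sorted_list_nth_iff_filter[where P = "\<lambda>x. x < c"]) (use assms size_eigenvalue_mset in auto)

text \<open>The first position at which a value occurs in the sorted spectrum counts what lies strictly below it.\<close>

lemma count_less_eigenvalue_least:
  assumes k: "1 \<le> k" "k \<le> card A"
    and least: "\<And>m. 1 \<le> m \<Longrightarrow> m \<le> card A \<Longrightarrow> eigenvalue A M m = eigenvalue A M k \<Longrightarrow> k \<le> m"
  shows "count_less A M (eigenvalue A M k) = k - 1"
proof (rule antisym)
  show "count_less A M (eigenvalue A M k) \<le> k - 1"
    using eigenvalue_less_iff_count[OF k, of "eigenvalue A M k"] by simp
  show "k - 1 \<le> count_less A M (eigenvalue A M k)"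
  proof (cases "k = 1")
    case False
    hence m: "1 \<le> k - 1" "k - 1 \<le> card A" using k by auto
    have "eigenvalue A M (k - 1) \<le> eigenvalue A M k"
      using eigenvalue_le_iff_count[OF m, of "eigenvalue A M k"]
        eigenvalue_le_iff_count[OF k, of "eigenvalue A M k"] by simp
    moreover have "eigenvalue A M (k - 1) \<noteq> eigenvalue A M k"
      using least[OF m] k by auto
    ultimately show ?thesis using eigenvalue_less_iff_count[OF m, of "eigenvalue A M k"] by simp
  qed simp
qed

lemma count_le_split: "count_le A M c = count_less A M c + eig_mult A M c"
proof -
  obtain f d where eb: "eigenbasis A M f d" using eigenbasis_exists[OF sym] by blast
  have "card {i \<in> A. d i \<le> c} = card ({i \<in> A. d i < c} \<union> {i \<in> A. d i = c})"
    by (intro arg_cong[of _ _ card]) auto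
  also have "\<dots> = card {i \<in> A. d i < c} + card {i \<in> A. d i = c}"
    by (rule card_Un_disjoint) auto
  finally show ?thesis
    by (simp add: count_le_def count_less_def eigenbasis_eigenvalue_mset[OF eb sym]
        eigenbasis_eig_mult[OF eb sym] size_filter_image_mset_set)
qed

lemma count_le_le_card: "count_le A M c \<le> card A"
  unfolding count_le_def size_eigenvalue_mset[symmetric] by (rule size_mset_mono) simp

lemma obtain_eigenbasis_counts:
  obtains f d where "eigenbasis A M f d"
    "\<And>c. count_le A M c = card {i \<in> A. d i \<le> c}" "\<And>c. count_le A M c + card {i \<in> A. c < d i} = card A"
    "\<And>c. count_less A M c = card {i \<in> A. d i < c}" "\<And>c. count_less A M c + card {i \<in> A. c \<le> d i} = card A"
proof -
  obtain f d where eb: "eigenbasis A M f d" using eigenbasis_exists[OF sym] by blast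
  have le: "count_le A M c = card {i \<in> A. d i \<le> c}" and less: "count_less A M c = card {i \<in> A. d i < c}" for c
    by (simp_all add: count_le_def count_less_def eigenbasis_eigenvalue_mset[OF eb sym] size_filter_image_mset_set)
  have "card {i \<in> A. d i \<le> c} + card {i \<in> A. c < d i} = card A"
    "card {i \<in> A. d i < c} + card {i \<in> A. c \<le> d i} = card A" for c
    by (subst card_Un_disjoint[symmetric]; auto intro!: arg_cong[of _ _ card])+
  thus ?thesis using that[OF eb] le less by simp
qed

text \<open>This and the next lemma bound the counts from below by trial subspaces. A trial subspace meets the span of
  the remaining eigenvectors, on which the form has the opposite sign, only in zero.\<close>

lemma dim_le_count_le:
  assumes F: "subspace F" "F \<subseteq> supported A" and le: "\<And>u. u \<in> F \<Longrightarrow> u \<bullet> (M *v u) \<le> c * (u \<bullet> u)"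
  shows "dim F \<le> count_le A M c"
proof -
  obtain f d where eb: "eigenbasis A M f d" and n: "count_le A M c + card {i \<in> A. c < d i} = card A"
    using obtain_eigenbasis_counts by metis
  have "dim F + card {i \<in> A. c < d i} \<le> card A"
  proof (rule eigenbasis_disjoint_dim[OF eb F])
    show "{i \<in> A. c < d i} \<subseteq> A" by auto
    fix u assume u: "u \<in> F" "u \<in> span (f ` {i \<in> A. c < d i})"
    show "u = 0"
    proof (rule ccontr)
      assume "u \<noteq> 0"
      have "c * (u \<bullet> u) < u \<bullet> (M *v u)"
        by (rule eigenbasis_span_less(2)[OF eb _ u(2) \<open>u \<noteq> 0\<close>]) auto
      thus False using le[OF u(1)] by simp
    qed
  qed
  thus ?thesis using n by simp
qed

lemma dim_le_count_less:
  assumes F: "subspace F" "F \<subseteq> supported A"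
    and less: "\<And>u. u \<in> F \<Longrightarrow> u \<noteq> 0 \<Longrightarrow> u \<bullet> (M *v u) < c * (u \<bullet> u)"
  shows "dim F \<le> count_less A M c"
proof -
  obtain f d where eb: "eigenbasis A M f d" and n: "count_less A M c + card {i \<in> A. c \<le> d i} = card A"
    using obtain_eigenbasis_counts by metis
  have "dim F + card {i \<in> A. c \<le> d i} \<le> card A"
  proof (rule eigenbasis_disjoint_dim[OF eb F])
    show "{i \<in> A. c \<le> d i} \<subseteq> A" by auto
    fix u assume u: "u \<in> F" "u \<in> span (f ` {i \<in> A. c \<le> d i})"
    show "u = 0"
    proof (rule ccontr)
      assume "u \<noteq> 0"
      have "c * (u \<bullet> u) \<le> u \<bullet> (M *v u)"
        by (rule eigenbasis_span_le(2)[OF eb _ u(2)]) auto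
      thus False using less[OF u(1) \<open>u \<noteq> 0\<close>] by simp
    qed
  qed
  thus ?thesis using n by simp
qed

text \<open>Upper bounds for the counts come from subspaces on which the form lies above the threshold, by the same
  argument with the two spans exchanged.\<close>

lemma count_le_upper:
  assumes F: "subspace F" "F \<subseteq> supported A"
    and gt: "\<And>u. u \<in> F \<Longrightarrow> u \<noteq> 0 \<Longrightarrow> c * (u \<bullet> u) < u \<bullet> (M *v u)"
  shows "dim F + count_le A M c \<le> card A"
proof -
  obtain f d where eb: "eigenbasis A M f d" and n: "count_le A M c = card {i \<in> A. d i \<le> c}"
    using obtain_eigenbasis_counts by metis
  show ?thesis unfolding n
  proof (rule eigenbasis_disjoint_dim[OF eb F])
    show "{i \<in> A. d i \<le> c} \<subseteq> A" by auto
    fix u assume u: "u \<in> F" "u \<in> span (f ` {i \<in> A. d i \<le> c})"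
    show "u = 0"
    proof (rule ccontr)
      assume "u \<noteq> 0"
      have "u \<bullet> (M *v u) \<le> c * (u \<bullet> u)"
        by (rule eigenbasis_span_le(1)[OF eb _ u(2)]) auto
      thus False using gt[OF u(1) \<open>u \<noteq> 0\<close>] by simp
    qed
  qed
qed

lemma count_less_upper:
  assumes F: "subspace F" "F \<subseteq> supported A"
    and ge: "\<And>u. u \<in> F \<Longrightarrow> c * (u \<bullet> u) \<le> u \<bullet> (M *v u)"
  shows "dim F + count_less A M c \<le> card A"
proof -
  obtain f d where eb: "eigenbasis A M f d" and n: "count_less A M c = card {i \<in> A. d i < c}"
    using obtain_eigenbasis_counts by metis
  show ?thesis unfolding n
  proof (rule eigenbasis_disjoint_dim[OF eb F])
    show "{i \<in> A. d i < c} \<subseteq> A" by auto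
    fix u assume u: "u \<in> F" "u \<in> span (f ` {i \<in> A. d i < c})"
    show "u = 0"
    proof (rule ccontr)
      assume "u \<noteq> 0"
      have "u \<bullet> (M *v u) < c * (u \<bullet> u)"
        by (rule eigenbasis_span_less(1)[OF eb _ u(2) \<open>u \<noteq> 0\<close>]) auto
      thus False using ge[OF u(1)] by simp
    qed
  qed
qed

text \<open>The bounds are attained: the spans of the eigenvectors on either side of the threshold are subspaces
  of extremal dimension.\<close>

lemma count_le_subspace:
  obtains F where "subspace F" "F \<subseteq> supported A" "dim F = count_le A M c"
    "\<And>u. u \<in> F \<Longrightarrow> u \<bullet> (M *v u) \<le> c * (u \<bullet> u)"
proof -
  obtain f d where eb: "eigenbasis A M f d" and n: "count_le A M c = card {i \<in> A. d i \<le> c}"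
    using obtain_eigenbasis_counts by metis
  let ?J = "{i \<in> A. d i \<le> c}"
  have J: "?J \<subseteq> A" by auto
  show ?thesis
  proof (rule that[OF subspace_span])
    show "span (f ` ?J) \<subseteq> supported A"
      using span_mono[OF image_mono[OF J]] eigenbasis_span[OF eb] by blast
    show "dim (span (f ` ?J)) = count_le A M c" unfolding eigenbasis_dim_span[OF eb J] using n by simp
    fix u assume u: "u \<in> span (f ` ?J)"
    show "u \<bullet> (M *v u) \<le> c * (u \<bullet> u)" by (rule eigenbasis_span_le(1)[OF eb J u]) auto
  qed
qed

lemma count_le_cosubspace:
  obtains F where "subspace F" "F \<subseteq> supported A" "dim F + count_le A M c = card A"
    "\<And>u. u \<in> F \<Longrightarrow> u \<noteq> 0 \<Longrightarrow> c * (u \<bullet> u) < u \<bullet> (M *v u)"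
proof -
  obtain f d where eb: "eigenbasis A M f d" and n: "count_le A M c + card {i \<in> A. c < d i} = card A"
    using obtain_eigenbasis_counts by metis
  let ?J = "{i \<in> A. c < d i}"
  have J: "?J \<subseteq> A" by auto
  show ?thesis
  proof (rule that[OF subspace_span])
    show "span (f ` ?J) \<subseteq> supported A"
      using span_mono[OF image_mono[OF J]] eigenbasis_span[OF eb] by blast
    show "dim (span (f ` ?J)) + count_le A M c = card A" unfolding eigenbasis_dim_span[OF eb J] using n by simp
    fix u assume u: "u \<in> span (f ` ?J)" "u \<noteq> 0"
    show "c * (u \<bullet> u) < u \<bullet> (M *v u)" by (rule eigenbasis_span_less(2)[OF eb J u]) auto
  qed
qed

lemma count_less_subspace:
  obtains F where "subspace F" "F \<subseteq> supported A" "dim F = count_less A M c"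
    "\<And>u. u \<in> F \<Longrightarrow> u \<noteq> 0 \<Longrightarrow> u \<bullet> (M *v u) < c * (u \<bullet> u)"
proof -
  obtain f d where eb: "eigenbasis A M f d" and n: "count_less A M c = card {i \<in> A. d i < c}"
    using obtain_eigenbasis_counts by metis
  let ?J = "{i \<in> A. d i < c}"
  have J: "?J \<subseteq> A" by auto
  show ?thesis
  proof (rule that[OF subspace_span])
    show "span (f ` ?J) \<subseteq> supported A"
      using span_mono[OF image_mono[OF J]] eigenbasis_span[OF eb] by blast
    show "dim (span (f ` ?J)) = count_less A M c" unfolding eigenbasis_dim_span[OF eb J] using n by simp
    fix u assume u: "u \<in> span (f ` ?J)" "u \<noteq> 0"
    show "u \<bullet> (M *v u) < c * (u \<bullet> u)" by (rule eigenbasis_span_less(1)[OF eb J u]) auto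
  qed
qed

lemma count_less_cosubspace:
  obtains F where "subspace F" "F \<subseteq> supported A" "dim F + count_less A M c = card A"
    "\<And>u. u \<in> F \<Longrightarrow> c * (u \<bullet> u) \<le> u \<bullet> (M *v u)"
proof -
  obtain f d where eb: "eigenbasis A M f d" and n: "count_less A M c + card {i \<in> A. c \<le> d i} = card A"
    using obtain_eigenbasis_counts by metis
  let ?J = "{i \<in> A. c \<le> d i}"
  have J: "?J \<subseteq> A" by auto
  show ?thesis
  proof (rule that[OF subspace_span])
    show "span (f ` ?J) \<subseteq> supported A"
      using span_mono[OF image_mono[OF J]] eigenbasis_span[OF eb] by blast
    show "dim (span (f ` ?J)) + count_less A M c = card A" unfolding eigenbasis_dim_span[OF eb J] using n by simp
    fix u assume u: "u \<in> span (f ` ?J)"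
    show "c * (u \<bullet> u) \<le> u \<bullet> (M *v u)" by (rule eigenbasis_span_le(2)[OF eb J u]) auto
  qed
qed

end

lemma inner_matrix_scale:
  fixes M :: "real^'n::finite^'n"
  shows "(c *\<^sub>R u) \<bullet> (M *v (c *\<^sub>R u)) = c\<^sup>2 * (u \<bullet> (M *v u))"
  by (simp add: matrix_vector_mult_scaleR power2_eq_square)

lemma supported_mono: "A \<subseteq> C \<Longrightarrow> supported A \<subseteq> supported C"
  by (auto simp: supported_def)

text \<open>Subspaces living on disjoint sets of indices form a direct sum.\<close>

lemma direct_sum_supported:
  fixes F G :: "(real^'n::finite) set"
  assumes F: "subspace F" "F \<subseteq> supported A" and G: "subspace G" "G \<subseteq> supported C" and AC: "A \<inter> C = {}"
  defines "H \<equiv> {x + y |x y. x \<in> F \<and> y \<in> G}"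
  shows "subspace H" "H \<subseteq> supported (A \<union> C)" "dim H = dim F + dim G"
proof -
  show "subspace H" unfolding H_def using F(1) G(1) by (rule subspace_sums)
  show "H \<subseteq> supported (A \<union> C)" using F(2) G(2) by (fastforce simp: H_def supported_def)
  have "x = 0" if "x \<in> F" "x \<in> G" for x
  proof -
    have "x \<in> supported A" "x \<in> supported C" using that F(2) G(2) by auto
    hence "x $ i = 0" for i using AC by (cases "i \<in> A") (auto simp: supported_def)
    thus ?thesis by (simp add: vec_eq_iff)
  qed
  hence "F \<inter> G = {0}" using subspace_0 F(1) G(1) by auto
  thus "dim H = dim F + dim G"
    using dim_sums_Int[OF F(1) G(1)] by (simp add: H_def)
qed

lemma dim_subspace_hyperplane:
  fixes F :: "'a::euclidean_space set"
  assumes F: "subspace F" and a: "a \<noteq> 0"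
  shows "dim F \<le> dim (F \<inter> {u. a \<bullet> u = 0}) + 1"
proof -
  have "dim {x + y |x y. x \<in> F \<and> y \<in> {u. a \<bullet> u = 0}} + dim (F \<inter> {u. a \<bullet> u = 0}) = dim F + dim {u. a \<bullet> u = 0}"
    by (rule dim_sums_Int[OF F subspace_hyperplane])
  moreover have "dim {x + y |x y. x \<in> F \<and> y \<in> {u. a \<bullet> u = 0}} \<le> DIM('a)" by (rule dim_subset_UNIV)
  moreover have "dim {u. a \<bullet> u = 0} = DIM('a) - 1" using a by (rule dim_hyperplane)
  moreover have "0 < DIM('a)" by simp
  ultimately show ?thesis by linarith
qed

section \<open>Germs of real-analytic functions and the implicit function theorem\<close>

text \<open>Analyticity near \<open>s\<close> is expressed by a holomorphic function on a complex neighbourhood, because locally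
  uniform limits of holomorphic functions are holomorphic; that the values on the real line are real is a
  condition of its own.\<close>

definition real_germ :: "(complex \<Rightarrow> complex) \<Rightarrow> real \<Rightarrow> bool" where
  "real_germ f s \<longleftrightarrow> f analytic_on {of_real s} \<and> (\<forall>\<^sub>F t in nhds s. f (of_real t) \<in> \<real>)"

lemma real_germ_const: "c \<in> \<real> \<Longrightarrow> real_germ (\<lambda>_. c) s"
  by (simp add: real_germ_def)

lemma real_germ_ident: "real_germ (\<lambda>t. t) s"
  by (simp add: real_germ_def)

lemma real_germ_add: "real_germ f s \<Longrightarrow> real_germ g s \<Longrightarrow> real_germ (\<lambda>t. f t + g t) s"
  unfolding real_germ_def by (auto intro: analytic_on_add elim: eventually_elim2)

lemma real_germ_diff: "real_germ f s \<Longrightarrow> real_germ g s \<Longrightarrow> real_germ (\<lambda>t. f t - g t) s"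
  unfolding real_germ_def by (auto intro: analytic_on_diff elim: eventually_elim2)

lemma real_germ_mult: "real_germ f s \<Longrightarrow> real_germ g s \<Longrightarrow> real_germ (\<lambda>t. f t * g t) s"
  unfolding real_germ_def by (auto intro: analytic_on_mult elim: eventually_elim2)

lemma real_germ_power: "real_germ f s \<Longrightarrow> real_germ (\<lambda>t. f t ^ n) s"
  by (induction n) (auto intro: real_germ_const real_germ_mult)

lemma real_germ_sum: "(\<And>i. i \<in> I \<Longrightarrow> real_germ (f i) s) \<Longrightarrow> real_germ (\<lambda>t. \<Sum>i\<in>I. f i t) s"
  by (induction I rule: infinite_finite_induct) (auto intro: real_germ_const real_germ_add)

lemma real_germ_prod: "(\<And>i. i \<in> I \<Longrightarrow> real_germ (f i) s) \<Longrightarrow> real_germ (\<lambda>t. \<Prod>i\<in>I. f i t) s"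
  by (induction I rule: infinite_finite_induct) (auto intro: real_germ_const real_germ_mult)

lemmas real_germ_intros =
  real_germ_const real_germ_ident real_germ_add real_germ_diff real_germ_mult real_germ_power
  real_germ_sum real_germ_prod

lemma real_germ_isCont: "real_germ f s \<Longrightarrow> isCont f (of_real s)"
  by (simp add: real_germ_def analytic_at_imp_isCont)

lemma real_germ_ball:
  assumes "real_germ f s"
  obtains r where "0 < r" "f holomorphic_on ball (of_real s) r"
    "\<And>t. \<bar>t - s\<bar> < r \<Longrightarrow> f (of_real t) \<in> \<real>"
proof -
  obtain e where e: "0 < e" "f holomorphic_on ball (of_real s) e"
    using assms unfolding real_germ_def analytic_on_def by auto
  obtain d where d: "0 < d" "\<And>t. dist t s < d \<Longrightarrow> f (of_real t) \<in> \<real>"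
    using assms unfolding real_germ_def eventually_nhds_metric by auto
  show ?thesis
    by (rule that[of "min d e"])
      (use d e in \<open>auto simp: dist_real_def intro: holomorphic_on_subset\<close>)
qed

lemma real_germI:
  assumes "0 < r" "f holomorphic_on ball (of_real s) r" "\<And>t. \<bar>t - s\<bar> < r \<Longrightarrow> f (of_real t) \<in> \<real>"
  shows "real_germ f s"
  using assms unfolding real_germ_def analytic_on_def eventually_nhds_metric dist_real_def by auto

lemma real_germ_real_at: "real_germ f s \<Longrightarrow> f (of_real s) \<in> \<real>"
  unfolding real_germ_def using eventually_nhds_x_imp_x by blast

lemma real_germ_common_ball:
  assumes "finite I" "\<And>i. i \<in> I \<Longrightarrow> real_germ (f i) s"
  shows "\<exists>r>0. \<forall>i\<in>I. f i holomorphic_on ball (of_real s) r \<and>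
           (\<forall>t. \<bar>t - s\<bar> < r \<longrightarrow> f i (of_real t) \<in> \<real>)"
  using assms
proof (induction I rule: finite_induct)
  case empty
  show ?case by (intro exI[of _ 1]) auto
next
  case (insert i I)
  then obtain r where r: "0 < r" "\<forall>i\<in>I. f i holomorphic_on ball (of_real s) r \<and>
           (\<forall>t. \<bar>t - s\<bar> < r \<longrightarrow> f i (of_real t) \<in> \<real>)" by auto
  obtain r' where r': "0 < r'" "f i holomorphic_on ball (of_real s) r'"
    "\<And>t. \<bar>t - s\<bar> < r' \<Longrightarrow> f i (of_real t) \<in> \<real>"
    using real_germ_ball[of "f i" s] insert by auto
  show ?case
    by (intro exI[of _ "min r r'"])
      (use r r' in \<open>auto intro: holomorphic_on_subset\<close>)
qed

lemma eventually_nhds_of_real: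
  "eventually P (nhds (of_real s :: complex)) \<Longrightarrow> \<forall>\<^sub>F t in nhds s. P (of_real t)"
  by (erule eventually_compose_filterlim) (intro tendsto_of_real filterlim_ident)

text \<open>The analytic implicit function theorem at a simple root of a polynomial in \<open>z\<close> whose coefficients depend
  on \<open>t\<close>. The root is the limit of the simplified Newton iteration \<open>\<Phi> t z = z - p(t,z) / D\<close>, with the fixed
  denominator \<open>D = \<partial>p/\<partial>z (s,0)\<close>. Near \<open>(s,0)\<close> it contracts by the factor 1/2, so the iterates, which are
  holomorphic in \<open>t\<close> and real for real \<open>t\<close>, converge uniformly.\<close>

lemma real_germ_implicit_root:
  fixes d :: "nat \<Rightarrow> complex \<Rightarrow> complex"
  assumes germ: "\<And>k. k \<le> N \<Longrightarrow> real_germ (d k) s"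
    and d0: "d 0 (of_real s) = 0" and d1: "d 1 (of_real s) \<noteq> 0" and N: "1 \<le> N"
  obtains \<mu> where "real_germ \<mu> s" "\<mu> (of_real s) = 0"
    "\<forall>\<^sub>F t in nhds (of_real s). (\<Sum>k\<le>N. d k t * \<mu> t ^ k) = 0"
proof -
  obtain r0 where r0: "0 < r0" "\<And>k. k \<le> N \<Longrightarrow> d k holomorphic_on ball (of_real s) r0"
    "\<And>k t. k \<le> N \<Longrightarrow> \<bar>t - s\<bar> < r0 \<Longrightarrow> d k (of_real t) \<in> \<real>"
    using real_germ_common_ball[of "{..N}" d s] germ by auto
  define D where "D = d 1 (of_real s)"
  define \<Phi> where "\<Phi> = (\<lambda>t z. z - (\<Sum>k\<le>N. d k t * z ^ k) / D)"
  \<comment> \<open>\<open>H\<close> is the difference quotient of \<open>\<Phi> t\<close>; it vanishes at \<open>(s,0,0)\<close> by the choice of \<open>D\<close>.\<close>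
  define H where "H = (\<lambda>(t, z, z'). 1 - (\<Sum>k\<le>N. d k t * (\<Sum>i<k. z' ^ (k - Suc i) * z ^ i)) / D)"
  have \<Phi>_diff: "\<Phi> t z - \<Phi> t z' = (z - z') * H (t, z, z')" for t z z'
  proof -
    have "(\<Sum>k\<le>N. d k t * z ^ k) - (\<Sum>k\<le>N. d k t * z' ^ k) =
      (\<Sum>k\<le>N. d k t * (z ^ k - z' ^ k))" by (simp add: sum_subtractf algebra_simps)
    also have "\<dots> = (z - z') * (\<Sum>k\<le>N. d k t * (\<Sum>i<k. z' ^ (k - Suc i) * z ^ i))"
      by (simp add: power_diff_sumr2 sum_distrib_left mult_ac)
    finally have eq: "(\<Sum>k\<le>N. d k t * z ^ k) - (\<Sum>k\<le>N. d k t * z' ^ k) = \<dots>" .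
    have "\<Phi> t z - \<Phi> t z' = (z - z') - ((\<Sum>k\<le>N. d k t * z ^ k) - (\<Sum>k\<le>N. d k t * z' ^ k)) / D"
      by (simp add: \<Phi>_def diff_divide_distrib)
    thus ?thesis unfolding eq H_def by (simp add: right_diff_distrib)
  qed
  have contd: "continuous_on (ball (of_real s) r0) (d k)" if "k \<le> N" for k
    using r0(2)[OF that] by (rule holomorphic_on_imp_continuous_on)
  have "continuous_on (ball (of_real s) r0 \<times> UNIV \<times> UNIV) H"
    unfolding H_def case_prod_unfold
    by (intro continuous_intros continuous_on_compose2[OF contd]) (use d1 in \<open>auto simp: D_def\<close>)
  hence "isCont H (of_real s, 0, 0)"
    using r0(1) by (subst (asm) continuous_on_eq_continuous_at) (auto intro!: open_Times)
  moreover have "H (of_real s, 0, 0) = 0"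
  proof -
    have "(\<Sum>k\<le>N. d k (of_real s) * (\<Sum>i<k. 0 ^ (k - Suc i) * 0 ^ i)) =
        (\<Sum>k\<le>N. if k = 1 then d 1 (of_real s) else 0)"
    proof (rule sum.cong[OF refl])
      fix k :: nat
      have "(\<Sum>i<k. (0::complex) ^ (k - Suc i) * 0 ^ i) = (\<Sum>i<k. if i = 0 then (if k = 1 then 1 else 0) else 0)"
        by (rule sum.cong) (auto simp: power_0_left)
      thus "d k (of_real s) * (\<Sum>i<k. 0 ^ (k - Suc i) * 0 ^ i) = (if k = 1 then d 1 (of_real s) else 0)"
        by (auto simp: sum.delta)
    qed
    thus ?thesis using N d1 by (simp add: H_def D_def)
  qed
  ultimately obtain e where e: "0 < e" "\<And>p. dist p (of_real s, 0, 0) < e \<Longrightarrow> norm (H p) < 1/2"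
    unfolding continuous_at_eps_delta by (metis dist_0_norm dist_commute half_gt_zero zero_less_one)
  define \<rho> where "\<rho> = e / 4"
  have \<rho>: "0 < \<rho>" using e by (simp add: \<rho>_def)
  have contr: "norm (\<Phi> t z - \<Phi> t z') \<le> norm (z - z') / 2"
    if "dist t (of_real s) < \<rho>" "norm z \<le> \<rho>" "norm z' \<le> \<rho>" for t z z'
  proof -
    have "dist (t, z, z') (of_real s, 0, 0) \<le> dist t (of_real s) + (norm z + norm z')"
      unfolding dist_norm by (simp, meson norm_Pair_le order_trans add_left_mono)
    also have "\<dots> < e" using that e(1) unfolding \<rho>_def by linarith
    finally have "norm (H (t, z, z')) \<le> 1/2" using e(2) by fastforce
    thus ?thesis unfolding \<Phi>_diff norm_mult
      by (metis mult_left_mono norm_ge_zero times_divide_eq_right mult.right_neutral)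
  qed
  have "isCont (d 0) (of_real s)" using germ[of 0] real_germ_isCont by simp
  moreover have "0 < \<rho> / 2 * norm D" using \<rho> d1 by (simp add: D_def)
  ultimately obtain r1 where r1: "0 < r1"
    "\<And>t. dist t (of_real s) < r1 \<Longrightarrow> dist (d 0 t) (d 0 (of_real s)) < \<rho> / 2 * norm D"
    unfolding continuous_at_eps_delta by blast
  have \<Phi>0: "\<Phi> t 0 = - d 0 t / D" for t
    by (simp add: \<Phi>_def power_0_left if_distrib[of "\<lambda>a. _ * a"] cong: if_cong)
  have \<Phi>0_le: "norm (\<Phi> t 0) \<le> \<rho> / 2" if "dist t (of_real s) < r1" for t
    using r1(2)[OF that] d0 d1 by (simp add: \<Phi>0 norm_divide D_def divide_le_eq)
  define r where "r = min r0 (min r1 \<rho>)"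
  have r: "0 < r" using r0 r1 \<rho> by (simp add: r_def)
  define B where "B = ball (of_real s :: complex) r"
  have B: "dist t (of_real s) < r0 \<and> dist t (of_real s) < r1 \<and> dist t (of_real s) < \<rho>" if "t \<in> B" for t
    using that by (auto simp: B_def r_def dist_commute)
  define m where "m = rec_nat (\<lambda>t. 0) (\<lambda>_ f t. \<Phi> t (f t))"
  have m0: "m 0 t = 0" and mS: "m (Suc n) t = \<Phi> t (m n t)" for n t by (simp_all add: m_def)
  have m_bound: "norm (m n t) \<le> \<rho>" if "t \<in> B" for n t
  proof (induction n)
    case 0
    thus ?case using \<rho> by (simp add: m0)
  next
    case (Suc n)
    have "norm (\<Phi> t (m n t)) \<le> norm (\<Phi> t (m n t) - \<Phi> t 0) + norm (\<Phi> t 0)"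
      using norm_triangle_sub by (metis add.commute)
    also have "\<dots> \<le> norm (m n t) / 2 + \<rho> / 2"
      using contr[of t "m n t" 0] \<Phi>0_le[of t] Suc B[OF that] \<rho> by auto
    finally show ?case using Suc by (simp add: mS)
  qed
  have m_step: "norm (m (Suc n) t - m n t) \<le> \<rho> * (1/2) ^ n" if "t \<in> B" for n t
  proof (induction n)
    case 0
    thus ?case using m_bound[OF that, of 1] by (simp add: m0)
  next
    case (Suc n)
    have "norm (\<Phi> t (m (Suc n) t) - \<Phi> t (m n t)) \<le> norm (m (Suc n) t - m n t) / 2"
      using contr m_bound[OF that] B[OF that] by blast
    thus ?case using Suc by (simp add: mS)
  qed
  have m_hol: "m n holomorphic_on B" for n
  proof (induction n)
    case 0
    thus ?case by (simp add: m_def)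
  next
    case (Suc n)
    have "d k holomorphic_on B" if "k \<le> N" for k
      using r0(2)[OF that] by (rule holomorphic_on_subset) (auto simp: B_def r_def)
    hence "(\<lambda>t. \<Phi> t (m n t)) holomorphic_on B"
      unfolding \<Phi>_def using Suc d1 by (intro holomorphic_intros) (auto simp: D_def)
    thus ?case by (simp add: mS[abs_def, symmetric])
  qed
  have "uniformly_convergent_on B (\<lambda>n t. \<Sum>i<n. m (Suc i) t - m i t)"
    by (rule Weierstrass_m_test'[of _ _ "\<lambda>n. \<rho> * (1/2) ^ n"])
      (use m_step in \<open>auto intro!: summable_mult summable_geometric\<close>)
  moreover have "(\<lambda>n t. \<Sum>i<n. m (Suc i) t - m i t) = m"
    by (simp add: fun_eq_iff m0 sum_lessThan_telescope[of "\<lambda>i. m i t" for t])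
  ultimately have "uniformly_convergent_on B m" by simp
  then obtain \<mu> where \<mu>: "uniform_limit B m \<mu> sequentially"
    by (auto simp: uniformly_convergent_on_def)
  have lim: "(\<lambda>n. m n t) \<longlonglongrightarrow> \<mu> t" if "t \<in> B" for t
    using tendsto_uniform_limitI[OF \<mu> that] .
  have hol: "\<mu> holomorphic_on B"
  proof (rule holomorphic_uniform_sequence[OF _ m_hol])
    fix x assume "x \<in> B"
    moreover have "open B" by (simp add: B_def)
    ultimately obtain e where "0 < e" "cball x e \<subseteq> B" using open_contains_cball by blast
    thus "\<exists>d>0. cball x d \<subseteq> B \<and> uniform_limit (cball x d) m \<mu> sequentially"
      using uniform_limit_on_subset[OF \<mu>] by blast
  qed (simp add: B_def)
  have fix_\<mu>: "\<Phi> t (\<mu> t) = \<mu> t" if t: "t \<in> B" for t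
  proof (rule LIMSEQ_unique)
    show "(\<lambda>n. \<Phi> t (m n t)) \<longlonglongrightarrow> \<Phi> t (\<mu> t)"
      unfolding \<Phi>_def using d1 by (intro tendsto_intros lim t) (simp add: D_def)
    show "(\<lambda>n. \<Phi> t (m n t)) \<longlonglongrightarrow> \<mu> t"
      using LIMSEQ_Suc[OF lim[OF t]] by (simp add: mS)
  qed
  show ?thesis
  proof (rule that)
    have D_real: "D \<in> \<real>" using germ[of 1] real_germ_real_at N by (simp add: D_def)
    show "real_germ \<mu> s"
    proof (rule real_germI[OF r])
      fix t :: real assume t: "\<bar>t - s\<bar> < r"
      hence tB: "of_real t \<in> B"
        unfolding B_def mem_ball dist_of_real by (simp add: dist_real_def abs_minus_commute)
      have "m n (of_real t) \<in> \<real>" for n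
      proof (induction n)
        case (Suc n)
        have "d k (of_real t) \<in> \<real>" if "k \<le> N" for k using r0(3)[OF that] t by (simp add: r_def)
        thus ?case unfolding mS \<Phi>_def using Suc D_real
          by (auto intro!: Reals_diff Reals_divide sum_in_Reals Reals_mult Reals_power)
      qed (simp add: m0)
      thus "\<mu> (of_real t) \<in> \<real>"
        using Lim_in_closed_set[OF closed_complex_Reals _ _ lim[OF tB]] by simp
    qed (use hol in \<open>simp add: B_def\<close>)
    have sB: "of_real s \<in> B" using r by (simp add: B_def)
    have "m n (of_real s) = 0" for n by (induction n) (simp_all add: m0 mS \<Phi>0 d0)
    thus "\<mu> (of_real s) = 0" using LIMSEQ_unique[OF lim[OF sB], of 0] by simp
    show "\<forall>\<^sub>F t in nhds (of_real s). (\<Sum>k\<le>N. d k t * \<mu> t ^ k) = 0"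
    proof (rule eventually_nhds_in_open[THEN eventually_mono, of B "of_real s"])
      fix t assume "t \<in> B"
      from fix_\<mu>[OF this] show "(\<Sum>k\<le>N. d k t * \<mu> t ^ k) = 0"
        using d1 by (simp add: \<Phi>_def D_def)
    qed (use sB in \<open>auto simp: B_def\<close>)
  qed
qed

text \<open>A germ that does not vanish identically has a finite order of vanishing.\<close>

lemma real_germ_factor:
  assumes f: "real_germ f s" and nz: "\<not> (\<forall>\<^sub>F t in nhds (of_real s). f t = 0)"
  obtains n g where "real_germ g s" "g (of_real s) \<noteq> 0"
    "\<forall>\<^sub>F t in nhds (of_real s). f t = (t - of_real s) ^ n * g t"
proof -
  obtain r where r: "0 < r" "f holomorphic_on ball (of_real s) r"
    "\<And>t. \<bar>t - s\<bar> < r \<Longrightarrow> f (of_real t) \<in> \<real>"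
    using real_germ_ball[OF f] by blast
  have "\<exists>w\<in>ball (of_real s) r. f w \<noteq> 0"
  proof (rule ccontr)
    assume "\<not> ?thesis"
    hence "\<forall>\<^sub>F t in nhds (of_real s). f t = 0"
      using r(1) by (intro eventually_nhds_in_open[THEN eventually_mono, of "ball (of_real s) r"]) auto
    thus False using nz by simp
  qed
  hence "\<exists>r'>0. cball (of_real s :: complex) r' \<subseteq> ball (of_real s) r \<and>
      zor_poly f (of_real s) holomorphic_on cball (of_real s) r' \<and>
      (\<forall>w\<in>cball (of_real s) r'. f w = zor_poly f (of_real s) w * (w - of_real s) ^ nat (zorder f (of_real s)) \<and>
        zor_poly f (of_real s) w \<noteq> 0)"
    using zorder_exist_zero[OF r(2)] r(1) by auto
  then obtain n g r' where r': "0 < r'" "cball (of_real s :: complex) r' \<subseteq> ball (of_real s) r"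
    "g holomorphic_on cball (of_real s) r'"
    "\<And>w. w \<in> cball (of_real s) r' \<Longrightarrow> f w = g w * (w - of_real s) ^ n \<and> g w \<noteq> 0"
    by blast
  have "r' < r" using r' r(1) by (auto simp: cball_subset_ball_iff)
  have holg: "g holomorphic_on ball (of_real s) r'"
    using r'(3) holomorphic_on_subset ball_subset_cball by blast
  have real: "g (of_real t) \<in> \<real>" if t: "\<bar>t - s\<bar> < r'" "t \<noteq> s" for t
  proof -
    have tc: "of_real t \<in> cball (of_real s :: complex) r'"
      using t by (simp add: dist_of_real dist_real_def abs_minus_commute)
    have "g (of_real t) = f (of_real t) / of_real ((t - s) ^ n)"
      using r'(4)[OF tc] t by (simp add: field_simps)
    moreover have "f (of_real t) \<in> \<real>" using r(3) t \<open>r' < r\<close> by simp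
    ultimately show ?thesis by (simp add: Reals_divide)
  qed
  have "g (of_real s) \<in> \<real>"
  proof (rule Lim_in_closed_set[OF closed_complex_Reals])
    have "isCont g (of_real s)"
      using holg r'(1) by (meson centre_in_ball continuous_on_eq_continuous_at holomorphic_on_imp_continuous_on open_ball)
    hence "(g \<longlongrightarrow> g (of_real s)) (nhds (of_real s))"
      by (simp add: continuous_within isCont_def tendsto_nhds_iff)
    from filterlim_compose[OF this tendsto_of_real[OF filterlim_ident]]
    have "((\<lambda>t. g (of_real t)) \<longlongrightarrow> g (of_real s)) (nhds s)" .
    thus "((\<lambda>t. g (of_real t)) \<longlongrightarrow> g (of_real s)) (at s)"
      by (rule tendsto_mono[rotated]) (simp add: at_within_def)
    show "\<forall>\<^sub>F t in at s. g (of_real t) \<in> \<real>"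
      unfolding eventually_at using r'(1) real by (auto simp: dist_real_def)
  qed auto
  hence "real_germ g s"
    using real by (intro real_germI[OF r'(1) holg]) (metis (full_types))
  moreover have "g (of_real s) \<noteq> 0" using r'(1,4) by auto
  moreover have "\<forall>\<^sub>F t in nhds (of_real s). f t = (t - of_real s) ^ n * g t"
    by (rule eventually_nhds_in_open[THEN eventually_mono, of "ball (of_real s) r'"])
      (use r' in \<open>auto simp: mult.commute\<close>)
  ultimately show ?thesis using that by blast
qed

lemma real_germ_nonzero_nhds:
  assumes "real_germ g s" "g (of_real s) \<noteq> 0"
  shows "\<forall>\<^sub>F t in nhds (of_real s). g t \<noteq> 0"
proof -
  have "(g \<longlongrightarrow> g (of_real s)) (nhds (of_real s))"
    using real_germ_isCont[OF assms(1)] by (simp add: isCont_def tendsto_nhds_iff)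
  thus ?thesis using assms(2) by (rule tendsto_imp_eventually_ne)
qed

section \<open>Polynomials with only real roots\<close>

text \<open>For real \<open>r\<close>, the modulus of \<open>z - r\<close> grows along vertical lines away from the real axis, and hence so does
  the modulus of every polynomial with only real roots. Conversely, a non-zero polynomial with this
  property has only real roots. Unlike real-rootedness, the property survives limits in which the leading
  coefficients tend to zero, and this is how limits of rescaled polynomials are seen to be real-rooted.\<close>

definition vert_mono :: "(complex \<Rightarrow> complex) \<Rightarrow> bool" where
  "vert_mono f \<longleftrightarrow>
     (\<forall>x y y'. \<bar>y\<bar> \<le> \<bar>y'\<bar> \<longrightarrow> cmod (f (Complex x y)) \<le> cmod (f (Complex x y')))"

lemma vert_mono_limit:
  assumes "F \<noteq> bot" "\<forall>\<^sub>F i in F. vert_mono (f i)" "\<And>z. ((\<lambda>i. f i z) \<longlongrightarrow> g z) F"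
  shows "vert_mono g"
  unfolding vert_mono_def
proof (intro allI impI)
  fix x y y' :: real assume y: "\<bar>y\<bar> \<le> \<bar>y'\<bar>"
  show "cmod (g (Complex x y)) \<le> cmod (g (Complex x y'))"
  proof (rule tendsto_le[OF assms(1)])
    show "\<forall>\<^sub>F i in F. cmod (f i (Complex x y)) \<le> cmod (f i (Complex x y'))"
      using assms(2) by eventually_elim (use y in \<open>auto simp: vert_mono_def\<close>)
  qed (intro tendsto_norm assms(3))+
qed

lemma vert_mono_shift:
  assumes "vert_mono f" "c \<in> \<real>" shows "vert_mono (\<lambda>z. f (z + c))"
proof -
  obtain r where "c = of_real r" using assms(2) by (auto elim: Reals_cases)
  hence "Complex x y + c = Complex (x + r) y" for x y by (simp add: complex_eq_iff)
  thus ?thesis using assms(1) by (simp add: vert_mono_def)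
qed

lemma vert_mono_scale:
  assumes "vert_mono f" "c \<in> \<real>" shows "vert_mono (\<lambda>z. f (c * z))"
proof -
  obtain r where "c = of_real r" using assms(2) by (auto elim: Reals_cases)
  hence "c * Complex x y = Complex (r * x) (r * y)" for x y by (simp add: complex_eq_iff)
  moreover have "\<bar>r * y\<bar> \<le> \<bar>r * y'\<bar>" if "\<bar>y\<bar> \<le> \<bar>y'\<bar>" for y y'
    using that by (simp add: abs_mult mult_left_mono)
  ultimately show ?thesis using assms(1) by (simp add: vert_mono_def)
qed

lemma vert_mono_cmult: "vert_mono f \<Longrightarrow> vert_mono (\<lambda>z. c * f z)"
  by (simp add: vert_mono_def norm_mult mult_left_mono)

text \<open>A root off the real axis would force the polynomial to vanish on a whole vertical segment.\<close>

lemma vert_mono_real_roots: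
  assumes vm: "vert_mono (\<lambda>z. \<Sum>k\<le>N. a k * z ^ k)" and nz: "\<exists>k\<le>N. a k \<noteq> 0"
    and root: "(\<Sum>k\<le>N. a k * z ^ k) = 0"
  shows "z \<in> \<real>"
proof (rule ccontr)
  assume "z \<notin> \<real>"
  hence y: "Im z \<noteq> 0" by (auto simp: complex_is_Real_iff)
  let ?Z = "{z. (\<Sum>k\<le>N. a k * z ^ k) = 0}"
  have "Complex (Re z) y' \<in> ?Z" if "y' \<in> {0..\<bar>Im z\<bar>}" for y'
  proof -
    have "\<bar>y'\<bar> \<le> \<bar>Im z\<bar>" using that by simp
    hence "cmod (\<Sum>k\<le>N. a k * Complex (Re z) y' ^ k) \<le> cmod (\<Sum>k\<le>N. a k * Complex (Re z) (Im z) ^ k)"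
      using vm unfolding vert_mono_def by blast
    thus ?thesis using root by simp
  qed
  hence "Complex (Re z) ` {0..\<bar>Im z\<bar>} \<subseteq> ?Z" by blast
  moreover have "finite ?Z" using nz by (simp add: polyfun_finite_roots)
  ultimately have "finite (Complex (Re z) ` {0..\<bar>Im z\<bar>})" by (rule finite_subset)
  hence "finite {0..\<bar>Im z\<bar>}" by (rule finite_imageD) (auto simp: inj_on_def)
  thus False using y infinite_Icc[of 0 "\<bar>Im z\<bar>"] by simp
qed

lemma vert_mono_prod_real_roots:
  "(\<And>x. x \<in># A \<Longrightarrow> x \<in> \<real>) \<Longrightarrow> vert_mono (\<lambda>z. \<Prod>x\<in>#A. z - x)"
proof (induction A)
  case empty
  show ?case by (simp add: vert_mono_def)
next
  case (add a A)
  have vm: "vert_mono (\<lambda>z. \<Prod>x\<in>#A. z - x)" using add by auto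
  have "a \<in> \<real>" using add by simp
  then obtain r where a: "a = of_real r" by (auto elim: Reals_cases)
  have "cmod (Complex x y - a) \<le> cmod (Complex x y' - a)" if "\<bar>y\<bar> \<le> \<bar>y'\<bar>" for x y y'
    using that unfolding a cmod_def by (simp add: abs_le_square_iff)
  thus ?case using vm by (simp add: vert_mono_def norm_mult mult_mono)
qed

lemma vert_mono_poly_real_rooted:
  assumes "\<And>z. poly p z = 0 \<Longrightarrow> z \<in> \<real>"
  shows "vert_mono (poly p)"
proof (cases "p = 0")
  case True
  thus ?thesis by (simp add: vert_mono_def)
next
  case False
  obtain A where A: "p = smult (lead_coeff p) (\<Prod>x\<in>#A. [:-x, 1:])"
    using alg_closed_imp_factorization[OF False] by blast
  have ev: "poly p z = lead_coeff p * (\<Prod>x\<in>#A. z - x)" for z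
    by (subst A) (simp add: poly_prod_mset image_mset.compositionality o_def)
  have "x \<in> \<real>" if "x \<in># A" for x
    by (rule assms) (use that in \<open>auto simp: ev image_iff\<close>)
  from vert_mono_cmult[OF vert_mono_prod_real_roots[OF this], where c = "lead_coeff p"]
  show ?thesis unfolding ev[abs_def] by simp
qed

text \<open>The power sum identity expressing the sum of the squares of the roots by the two coefficients below the
  leading one, \<open>s1\<close> and \<open>s2\<close>. It is stated for all sizes of \<open>A\<close>, with \<open>s1\<close> and \<open>s2\<close> read as zero where the coefficient
  does not exist, to make the induction go through.\<close>

lemma sum_squared_roots:
  fixes A :: "'a::idom multiset"
  defines "q \<equiv> \<Prod>x\<in>#A. [:-x, 1:]"
  shows "\<exists>s1 s2. coeff q (size A) = 1 \<and> degree q = size A \<and> (\<forall>k. Suc k = size A \<longrightarrow> coeff q k = s1) \<and>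
      (\<forall>k. Suc (Suc k) = size A \<longrightarrow> coeff q k = s2) \<and> (size A = 0 \<longrightarrow> s1 = 0) \<and>
      (size A \<le> 1 \<longrightarrow> s2 = 0) \<and> s1\<^sup>2 - 2 * s2 = (\<Sum>x\<in>#A. x\<^sup>2)"
  unfolding q_def
proof (induction A)
  case empty
  show ?case by (intro exI[of _ 0]) auto
next
  case (add x A)
  define q where "q = (\<Prod>x\<in>#A. [:-x, 1:])"
  obtain s1 s2 where IH: "coeff q (size A) = 1" "degree q = size A" "\<And>k. Suc k = size A \<Longrightarrow> coeff q k = s1"
    "\<And>k. Suc (Suc k) = size A \<Longrightarrow> coeff q k = s2" "size A = 0 \<Longrightarrow> s1 = 0"
    "size A \<le> 1 \<Longrightarrow> s2 = 0" "s1\<^sup>2 - 2 * s2 = (\<Sum>x\<in>#A. x\<^sup>2)"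
    using add.IH unfolding q_def[symmetric] by blast
  have qq: "(\<Prod>x\<in>#add_mset x A. [:-x, 1:]) = [:-x, 1:] * q" by (simp add: q_def)
  have c: "coeff ([:-x, 1:] * q) k = (case k of 0 \<Rightarrow> 0 | Suc j \<Rightarrow> coeff q j) - x * coeff q k" for k
    by (simp add: coeff_pCons split: nat.splits)
  have d: "degree ([:-x, 1:] * q) = Suc (size A)"
    using IH(1,2) by (subst degree_mult_eq) auto
  have deg: "coeff q (Suc (size A)) = 0" using IH(2) by (simp add: coeff_eq_0)
  show ?case
    unfolding qq
  proof (rule exI[of _ "s1 - x"], rule exI[of _ "s2 - x * s1"], intro conjI allI impI)
    show "coeff ([:-x, 1:] * q) (size (add_mset x A)) = 1" using IH(1) deg by (simp add: c)
    show "(s1 - x)\<^sup>2 - 2 * (s2 - x * s1) = (\<Sum>x\<in>#add_mset x A. x\<^sup>2)"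
      using IH(7) by (simp add: power2_eq_square algebra_simps)
    fix k
    show "coeff ([:-x, 1:] * q) k = s1 - x" if "Suc k = size (add_mset x A)"
      using that IH(1,3,5) by (cases "size A") (auto simp: c)
    show "coeff ([:-x, 1:] * q) k = s2 - x * s1" if "Suc (Suc k) = size (add_mset x A)"
      using that IH(3,4,6) by (cases k) (auto simp: c)
  qed (use d IH(5,6) in auto)
qed

text \<open>When the roots are real with sum zero, the sum of their squares is minus twice the normalized coefficient
  of \<open>z\<^sup>m\<^sup>-\<^sup>2\<close>. Hence this coefficient has the sign opposite to the leading one, unless all roots vanish.\<close>

lemma centred_real_rooted_coeff:
  fixes l :: "nat \<Rightarrow> complex"
  assumes m: "2 \<le> m" and lm: "l m \<noteq> 0" and lm1: "l (m - 1) = 0"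
    and nz: "\<exists>k<m. l k \<noteq> 0" and vm: "vert_mono (\<lambda>z. \<Sum>k\<le>m. l k * z ^ k)"
  shows "\<exists>c>0. l (m - 2) = - of_real c * l m"
proof -
  define p where "p = (\<Sum>k\<le>m. monom (l k) k)"
  have coeff_p: "coeff p k = (if k \<le> m then l k else 0)" for k
    by (simp add: p_def coeff_sum)
  have deg: "degree p = m"
    using lm by (intro antisym degree_le le_degree) (auto simp: coeff_p)
  have p0: "p \<noteq> 0" using lm coeff_p[of m] by auto
  have poly_p: "poly p z = (\<Sum>k\<le>m. l k * z ^ k)" for z
    by (simp add: p_def poly_sum poly_monom)
  obtain A where A: "size A = m" "p = smult (l m) (\<Prod>x\<in>#A. [:-x, 1:])"
    using alg_closed_imp_factorization[OF p0] deg coeff_p[of m] by auto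
  have real: "x \<in> \<real>" if "x \<in># A" for x
  proof (rule vert_mono_real_roots[OF vm])
    have "poly p x = 0" by (subst A) (use that in \<open>auto simp: poly_prod_mset image_iff\<close>)
    thus "(\<Sum>k\<le>m. l k * x ^ k) = 0" by (simp add: poly_p)
  qed (use lm in auto)
  obtain s1 s2 where s: "\<And>k. Suc k = m \<Longrightarrow> coeff (\<Prod>x\<in>#A. [:-x, 1:]) k = s1"
    "\<And>k. Suc (Suc k) = m \<Longrightarrow> coeff (\<Prod>x\<in>#A. [:-x, 1:]) k = s2"
    "s1\<^sup>2 - 2 * s2 = (\<Sum>x\<in>#A. x\<^sup>2)"
    using sum_squared_roots[of A] unfolding A(1) by blast
  have l1: "l (m - 1) = l m * s1"
    using s(1)[of "m - 1"] m coeff_p[of "m - 1"] arg_cong[OF A(2), of "\<lambda>p. coeff p (m - 1)"] by simp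
  have l2: "l (m - 2) = l m * s2"
    using s(2)[of "m - 2"] m coeff_p[of "m - 2"] arg_cong[OF A(2), of "\<lambda>p. coeff p (m - 2)"] by simp
  have "s1 = 0" using l1 lm lm1 by simp
  define R where "R = image_mset Re A"
  have AR: "A = image_mset of_real R"
    unfolding R_def image_mset.compositionality using real
    by (intro multiset.map_ident_strong[symmetric]) (auto simp: )
  define c where "c = (\<Sum>x\<in>#R. x\<^sup>2) / 2"
  have sq: "(\<Sum>x\<in>#A. x\<^sup>2) = of_real (\<Sum>x\<in>#R. x\<^sup>2)"
    unfolding AR by (simp add: image_mset.compositionality o_def) (induction R, auto)
  have "- (2 * s2) = of_real (\<Sum>x\<in>#R. x\<^sup>2)" using s(3) \<open>s1 = 0\<close> unfolding sq by simp
  moreover have "s2 = - (- (2 * s2) / 2)" by simp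
  ultimately have s2: "s2 = - of_real c" unfolding c_def by simp
  have nonneg: "0 \<le> (\<Sum>x\<in>#R'. x\<^sup>2)" for R' :: "real multiset"
    by (induction R') auto
  hence "0 \<le> c" unfolding c_def by simp
  moreover have "c \<noteq> 0"
  proof
    assume "c = 0"
    hence z: "(\<Sum>x\<in>#R. x\<^sup>2) = 0" by (simp add: c_def)
    have "\<forall>x\<in>#R. x = 0"
      using z
    proof (induction R)
      case (add x R)
      have "0 \<le> (\<Sum>x\<in>#R. x\<^sup>2)" by (rule nonneg)
      moreover have "0 \<le> x\<^sup>2" by simp
      ultimately have "x\<^sup>2 = 0" "(\<Sum>x\<in>#R. x\<^sup>2) = 0"
        using add.prems by (simp_all add: add_nonneg_eq_0_iff)
      thus ?case using add.IH by simp
    qed simp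
    hence "\<forall>x\<in>#A. x = 0" by (auto simp: AR)
    hence "A = replicate_mset m 0" using A(1) by (metis set_mset_subset_singletonD subsetI singletonI insertI1 insert_iff)
    hence "p = smult (l m) (monom 1 m)"
      using A(2) by (simp add: monom_altdef)
    hence "coeff p k = 0" if "k < m" for k using that by simp
    thus False using nz coeff_p by (metis less_imp_le)
  qed
  ultimately show ?thesis using l2 s2 by (intro exI[of _ c]) (auto simp: mult.commute)
qed

text \<open>The coefficients of \<open>p(z + c)\<close>, if \<open>a\<close> are those of \<open>p\<close>, a polynomial of degree at most \<open>N\<close>.\<close>

definition shift_coeff :: "nat \<Rightarrow> (nat \<Rightarrow> complex) \<Rightarrow> complex \<Rightarrow> nat \<Rightarrow> complex" where
  "shift_coeff N a c k = (\<Sum>n\<le>N. of_nat (n choose k) * a n * c ^ (n - k))"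

lemma shift_coeff_eval:
  "(\<Sum>k\<le>N. shift_coeff N a c k * z ^ k) = (\<Sum>n\<le>N. a n * (z + c) ^ n)"
proof -
  have "(\<Sum>n\<le>N. a n * (z + c) ^ n) = (\<Sum>n\<le>N. \<Sum>k\<le>N. of_nat (n choose k) * a n * c ^ (n - k) * z ^ k)"
  proof (rule sum.cong[OF refl])
    fix n assume "n \<in> {..N}"
    have "(z + c) ^ n = (\<Sum>k\<le>n. of_nat (n choose k) * z ^ k * c ^ (n - k))"
      by (rule binomial_ring)
    also have "\<dots> = (\<Sum>k\<le>N. of_nat (n choose k) * z ^ k * c ^ (n - k))"
      by (rule sum.mono_neutral_left) (use \<open>n \<in> {..N}\<close> in auto)
    finally show "a n * (z + c) ^ n = (\<Sum>k\<le>N. of_nat (n choose k) * a n * c ^ (n - k) * z ^ k)"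
      by (simp add: sum_distrib_left mult_ac)
  qed
  also have "\<dots> = (\<Sum>k\<le>N. \<Sum>n\<le>N. of_nat (n choose k) * a n * c ^ (n - k) * z ^ k)"
    by (rule sum.swap)
  finally show ?thesis by (simp add: shift_coeff_def sum_distrib_right)
qed

lemma real_germ_shift_coeff:
  "(\<And>k. k \<le> N \<Longrightarrow> real_germ (a k) s) \<Longrightarrow> real_germ \<mu> s \<Longrightarrow>
     real_germ (\<lambda>t. shift_coeff N (\<lambda>k. a k t) (\<mu> t) k) s"
  unfolding shift_coeff_def by (intro real_germ_intros) auto

lemma shift_coeff_0: "k \<le> N \<Longrightarrow> shift_coeff N a 0 k = a k"
proof -
  assume k: "k \<le> N"
  have "shift_coeff N a 0 k = (\<Sum>n\<le>N. if n = k then a k else 0)"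
    unfolding shift_coeff_def
    by (rule sum.cong) (auto simp: power_0_left binomial_eq_0 not_le)
  thus ?thesis using k by simp
qed

section \<open>Newton polygons of real-rooted families\<close>

lemma real_germ_tendsto:
  assumes "real_germ f s" "filterlim g (nhds s) F"
  shows "((\<lambda>x. f (of_real (g x))) \<longlongrightarrow> f (of_real s)) F"
  by (rule isCont_tendsto_compose[OF real_germ_isCont[OF assms(1)] tendsto_of_real[OF assms(2)]])

text \<open>Newton polygon of a centred real-rooted family at a root \<open>0\<close> of multiplicity \<open>m\<close>. Here \<open>od j\<close> is the order of
  vanishing at \<open>s\<close> of the coefficient of \<open>z\<^sup>m\<^sup>-\<^sup>j\<close>, and \<open>J\<close> collects the \<open>j\<close> for which it is finite. Let \<open>p/q\<close> be the least
  of the quotients \<open>od j / j\<close>. Substituting \<open>t = s + \<epsilon> \<tau>\<^sup>q\<close> and \<open>\<tau>\<^sup>p z\<close> for \<open>z\<close>, and letting \<open>\<tau>\<close> tend to zero, one gets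
  a centred real-rooted polynomial of degree \<open>m\<close> that is not a pure power. By
  \<open>centred_real_rooted_coeff\<close> its coefficient of \<open>z\<^sup>m\<^sup>-\<^sup>2\<close> is non-zero, so the minimum is attained at \<open>j = 2\<close>, and it
  has the same sign for \<open>\<epsilon> = 1\<close> and for \<open>\<epsilon> = -1\<close>, so \<open>od 2\<close> is even. Hence the slope is an integer \<open>r\<close>; this
  excludes fractional powers.\<close>

lemma newton_slope:
  fixes b :: "nat \<Rightarrow> complex \<Rightarrow> complex" and g :: "nat \<Rightarrow> complex \<Rightarrow> complex" and od :: "nat \<Rightarrow> nat"
  assumes germ: "\<And>k. k \<le> N \<Longrightarrow> real_germ (b k) s"
    and vm: "\<forall>\<^sub>F t in nhds s. vert_mono (\<lambda>z. \<Sum>k\<le>N. b k (of_real t) * z ^ k)"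
    and mN: "2 \<le> m" "m \<le> N"
    and bm: "b m (of_real s) \<noteq> 0" and low: "\<And>k. k < m \<Longrightarrow> b k (of_real s) = 0"
    and centred: "b (m - 1) = (\<lambda>_. 0)"
    and J: "J \<subseteq> {1..m}" "J \<noteq> {}"
    and zero: "\<And>j. j \<in> {1..m} - J \<Longrightarrow> \<forall>\<^sub>F t in nhds (of_real s). b (m - j) t = 0"
    and g: "\<And>j. j \<in> J \<Longrightarrow> real_germ (g j) s" "\<And>j. j \<in> J \<Longrightarrow> g j (of_real s) \<noteq> 0"
    and fact: "\<And>j. j \<in> J \<Longrightarrow> \<forall>\<^sub>F t in nhds (of_real s). b (m - j) t = (t - of_real s) ^ od j * g j t"
  obtains r l where "1 \<le> r" "\<And>j. j \<in> J \<Longrightarrow> r * j \<le> od j"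
    "\<And>k. l k = (if k = m then b m (of_real s)
       else if k < m \<and> m - k \<in> J \<and> od (m - k) = r * (m - k) then g (m - k) (of_real s) else 0)"
    "vert_mono (\<lambda>z. \<Sum>k\<le>m. l k * z ^ k)" "l (m - 1) = 0" "l (m - 2) \<noteq> 0"
proof -
  have finJ: "finite J" using J(1) finite_subset by blast
  have o_pos: "1 \<le> od j" if "j \<in> J" for j
  proof (rule ccontr)
    assume "\<not> 1 \<le> od j"
    hence "od j = 0" by simp
    hence "b (m - j) (of_real s) = g j (of_real s)"
      using eventually_nhds_x_imp_x[OF fact[OF that]] by simp
    moreover have "b (m - j) (of_real s) = 0" using low J(1) that by auto
    ultimately show False using g(2)[OF that] by simp
  qed
  have "1 \<notin> J"
  proof
    assume 1: "1 \<in> J"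
    have "\<forall>\<^sub>F t in nhds (of_real s :: complex). t \<noteq> of_real s \<longrightarrow> False"
      using fact[OF 1] real_germ_nonzero_nhds[OF g(1)[OF 1] g(2)[OF 1]]
      by eventually_elim (use centred in auto)
    hence "\<forall>\<^sub>F t in at (of_real s :: complex). False" by (simp add: eventually_at_filter)
    thus False by simp
  qed
  define ratio where "ratio = (\<lambda>j. real (od j) / real j)"
  define q where "q = arg_min_on ratio J"
  define p where "p = od q"
  have qJ: "q \<in> J" unfolding q_def using finJ J(2) by (rule arg_min_if_finite)
  have q: "1 \<le> q" "q \<le> m" using qJ J(1) by auto
  have p: "1 \<le> p" using o_pos[OF qJ] by (simp add: p_def)
  have slope: "p * j \<le> od j * q" if "j \<in> J" for j
  proof -
    have "ratio q \<le> ratio j" unfolding q_def by (rule arg_min_least[OF finJ J(2) that])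
    moreover have "1 \<le> j" using that J(1) by auto
    ultimately have "real (p * j) \<le> real (od j * q)"
      using q by (simp add: ratio_def p_def field_simps)
    thus ?thesis by (simp only: of_nat_le_iff)
  qed
  define l where "l = (\<lambda>\<epsilon>::real. \<lambda>k. if k = m then b m (of_real s)
       else if k < m \<and> m - k \<in> J \<and> od (m - k) * q = p * (m - k)
         then of_real (\<epsilon> ^ od (m - k)) * g (m - k) (of_real s) else 0)"
  have l_m: "l \<epsilon> m \<noteq> 0" for \<epsilon> using bm by (simp add: l_def)
  have l_m1: "l \<epsilon> (m - 1) = 0" for \<epsilon> using mN \<open>1 \<notin> J\<close> by (simp add: l_def)
  have l_high: "l \<epsilon> k = 0" if "m < k" for \<epsilon> k using that by (simp add: l_def)
  have l_vm: "vert_mono (\<lambda>z. \<Sum>k\<le>m. l \<epsilon> k * z ^ k)" if \<epsilon>: "\<bar>\<epsilon>\<bar> = 1" for \<epsilon>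
  proof -
    define path where "path = (\<lambda>\<tau>::real. s + \<epsilon> * \<tau> ^ q)"
    have "((\<lambda>\<tau>. s + \<epsilon> * \<tau> ^ q) \<longlongrightarrow> s + \<epsilon> * 0 ^ q) (at_right 0)"
      by (intro tendsto_intros)
    hence path: "filterlim path (nhds s) (at_right 0)"
      using q by (simp add: path_def power_0_left)
    have pathc: "filterlim (\<lambda>\<tau>. of_real (path \<tau>) :: complex) (nhds (of_real s)) (at_right 0)"
      by (rule tendsto_of_real[OF path])
    have pos: "\<forall>\<^sub>F \<tau>::real in at_right 0. 0 < \<tau>"
      by (simp add: eventually_at_right_less)
    \<comment> \<open>The coefficients after the substitution of \<open>\<tau>\<^sup>p z\<close> for \<open>z\<close> and division by \<open>\<tau>\<^sup>p\<^sup>m\<close>.\<close>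
    define \<beta> where "\<beta> = (\<lambda>\<tau> k. b k (of_real (path \<tau>)) * of_real \<tau> ^ (p * k) / of_real \<tau> ^ (p * m))"
    have \<beta>: "((\<lambda>\<tau>. \<beta> \<tau> k) \<longlongrightarrow> l \<epsilon> k) (at_right 0)" if k: "k \<le> N" for k
    proof -
      have pz: "((\<lambda>\<tau>. (of_real \<tau> :: complex) ^ n) \<longlongrightarrow> 0 ^ n) (at_right 0)" for n
        by (intro tendsto_intros tendsto_eq_intros | simp)+
      consider "k = m" | "m < k" | "k < m" "m - k \<notin> J" | "k < m" "m - k \<in> J" by linarith
      thus ?thesis
      proof cases
        case 1
        have "\<forall>\<^sub>F \<tau> in at_right 0. b k (of_real (path \<tau>)) = \<beta> \<tau> k"
          using pos by eventually_elim (simp add: \<beta>_def 1)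
        from tendsto_cong[OF this] real_germ_tendsto[OF germ[OF k] path] show ?thesis
          using 1 by (simp add: l_def)
      next
        case 2
        have "\<forall>\<^sub>F \<tau> in at_right 0. b k (of_real (path \<tau>)) * of_real \<tau> ^ (p * (k - m)) = \<beta> \<tau> k"
          using pos
        proof eventually_elim
          case (elim \<tau>)
          have "p * k = p * (k - m) + p * m" using 2 by (simp add: distrib_left[symmetric])
          thus ?case using elim by (simp add: \<beta>_def power_add)
        qed
        moreover have "((\<lambda>\<tau>. b k (of_real (path \<tau>)) * of_real \<tau> ^ (p * (k - m))) \<longlongrightarrow>
            b k (of_real s) * 0 ^ (p * (k - m))) (at_right 0)"
          by (intro tendsto_mult real_germ_tendsto[OF germ[OF k] path] pz)
        moreover have "0 < p * (k - m)" using 2 p by simp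
        ultimately show ?thesis
          using 2 p tendsto_cong by (fastforce simp: l_def power_0_left)
      next
        case 3
        have "\<forall>\<^sub>F t in nhds (of_real s). b k t = 0" using zero[of "m - k"] 3 by simp
        hence "\<forall>\<^sub>F \<tau> in at_right 0. b k (of_real (path \<tau>)) = 0"
          using pathc by (rule eventually_compose_filterlim)
        hence "\<forall>\<^sub>F \<tau> in at_right 0. \<beta> \<tau> k = 0" by eventually_elim (simp add: \<beta>_def)
        from tendsto_cong[OF this] show ?thesis using 3 by (simp add: l_def)
      next
        case 4
        define j where "j = m - k"
        define n where "n = od j * q - p * j"
        have jJ: "j \<in> J" using 4 by (simp add: j_def)
        have kj: "k = m - j" "k + j = m" using 4 by (auto simp: j_def)
        have nq: "q * od j = n + p * j" using slope[OF jJ] by (simp add: n_def mult.commute)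
        have pm: "p * m = p * k + p * j" using kj(2) by (simp add: distrib_left[symmetric])
        have "\<forall>\<^sub>F t in nhds (of_real s). b k t = (t - of_real s) ^ od j * g j t"
          using fact[OF jJ] kj by simp
        hence "\<forall>\<^sub>F \<tau> in at_right 0. b k (of_real (path \<tau>)) = (of_real (path \<tau>) - of_real s) ^ od j * g j (of_real (path \<tau>))"
          using pathc by (rule eventually_compose_filterlim)
        hence "\<forall>\<^sub>F \<tau> in at_right 0. of_real (\<epsilon> ^ od j) * of_real \<tau> ^ n * g j (of_real (path \<tau>)) = \<beta> \<tau> k"
          using pos
        proof eventually_elim
          case (elim \<tau>)
          have "(of_real (path \<tau>) - of_real s) ^ od j = (of_real (\<epsilon> ^ od j) * of_real \<tau> ^ (q * od j) :: complex)"
            by (simp add: path_def power_mult_distrib power_mult)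
          thus ?case using elim unfolding \<beta>_def nq pm by (simp add: power_add field_simps)
        qed
        moreover have "((\<lambda>\<tau>. of_real (\<epsilon> ^ od j) * of_real \<tau> ^ n * g j (of_real (path \<tau>))) \<longlongrightarrow>
            of_real (\<epsilon> ^ od j) * 0 ^ n * g j (of_real s)) (at_right 0)"
          by (intro tendsto_mult tendsto_const pz real_germ_tendsto[OF g(1)[OF jJ] path])
        moreover have "of_real (\<epsilon> ^ od j) * 0 ^ n * g j (of_real s) = l \<epsilon> k"
        proof (cases "od j * q = p * j")
          case True
          thus ?thesis using 4 by (simp add: l_def n_def j_def)
        next
          case False
          hence "0 < n" using slope[OF jJ] by (simp add: n_def)
          thus ?thesis using 4 False by (simp add: l_def j_def)
        qed
        ultimately show ?thesis using tendsto_cong by fastforce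
      qed
    qed
    have "vert_mono (\<lambda>z. \<Sum>k\<le>N. l \<epsilon> k * z ^ k)"
    proof (rule vert_mono_limit)
      show "((\<lambda>\<tau>. \<Sum>k\<le>N. \<beta> \<tau> k * z ^ k) \<longlongrightarrow> (\<Sum>k\<le>N. l \<epsilon> k * z ^ k)) (at_right 0)" for z
        by (intro tendsto_sum tendsto_mult \<beta> tendsto_const) simp
      have "\<forall>\<^sub>F \<tau> in at_right 0. vert_mono (\<lambda>z. \<Sum>k\<le>N. b k (of_real (path \<tau>)) * z ^ k)"
        using vm path by (rule eventually_compose_filterlim)
      thus "\<forall>\<^sub>F \<tau> in at_right 0. vert_mono (\<lambda>z. \<Sum>k\<le>N. \<beta> \<tau> k * z ^ k)"
      proof eventually_elim
        case (elim \<tau>)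
        have real: "of_real \<tau> ^ p \<in> (\<real> :: complex set)" by simp
        have pw: "of_real \<tau> ^ (p * k) = ((of_real \<tau> :: complex) ^ p) ^ k" for k by (rule power_mult)
        from vert_mono_cmult[OF vert_mono_scale[OF elim(1) real], of "1 / (of_real \<tau> ^ p) ^ m"]
        show ?case unfolding \<beta>_def pw by (simp add: sum_distrib_left power_mult_distrib mult_ac)
      qed
    qed simp
    moreover have "(\<lambda>z. \<Sum>k\<le>N. l \<epsilon> k * z ^ k) = (\<lambda>z. \<Sum>k\<le>m. l \<epsilon> k * z ^ k)"
      by (intro ext sum.mono_neutral_right) (use mN l_high in \<open>auto simp: not_le\<close>)
    ultimately show ?thesis by simp
  qed
  have neg: "\<exists>c>0. l \<epsilon> (m - 2) = - of_real c * l \<epsilon> m" if \<epsilon>: "\<bar>\<epsilon>\<bar> = 1" for \<epsilon>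
  proof (rule centred_real_rooted_coeff[OF mN(1) l_m l_m1 _ l_vm[OF \<epsilon>]])
    have "\<epsilon> \<noteq> 0" using \<epsilon> by auto
    hence "l \<epsilon> (m - q) \<noteq> 0" using q qJ g(2)[OF qJ] by (simp add: l_def p_def)
    thus "\<exists>k<m. l \<epsilon> k \<noteq> 0" using q by (intro exI[of _ "m - q"]) auto
  qed
  obtain c1 where c1: "0 < c1" "l 1 (m - 2) = - of_real c1 * b m (of_real s)"
    using neg[of 1] by (auto simp: l_def)
  obtain c2 where c2: "0 < c2" "l (-1) (m - 2) = - of_real c2 * b m (of_real s)"
    using neg[of "-1"] by (auto simp: l_def)
  have m2: "m - 2 < m" "m - (m - 2) = 2" "m - 2 \<noteq> m" using mN by auto
  have nz2: "l 1 (m - 2) \<noteq> 0" using c1 bm by simp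
  hence 2: "2 \<in> J" "od 2 * q = p * 2" using m2 by (auto simp: l_def split: if_splits)
  \<comment> \<open>For odd \<open>od 2\<close> the two choices of \<open>\<epsilon>\<close> would give coefficients of opposite signs.\<close>
  have "even (od 2)"
  proof (rule ccontr)
    assume "odd (od 2)"
    hence "l (-1) (m - 2) = - l 1 (m - 2)" using m2 by (simp add: l_def)
    hence "of_real (- c2) * b m (of_real s) = of_real c1 * b m (of_real s)"
      using c1(2) c2(2) by simp
    hence "of_real (- c2) = (of_real c1 :: complex)" using bm mult_right_cancel by blast
    hence "- c2 = c1" by (simp only: of_real_eq_iff)
    thus False using c1 c2 by simp
  qed
  then obtain r where r: "od 2 = 2 * r" by (auto elim: evenE)
  hence pr: "p = r * q" using 2(2) by simp
  have r1: "1 \<le> r" using o_pos[OF 2(1)] r by simp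
  have eq_iff: "od j * q = p * j \<longleftrightarrow> od j = r * j" for j
    unfolding pr using q by auto
  show ?thesis
  proof (rule that[OF r1])
    show "r * j \<le> od j" if "j \<in> J" for j
      using slope[OF that] q unfolding pr by (simp add: mult.assoc mult.left_commute mult.commute)
    show "l 1 k = (if k = m then b m (of_real s)
       else if k < m \<and> m - k \<in> J \<and> od (m - k) = r * (m - k) then g (m - k) (of_real s) else 0)" for k
      by (auto simp: l_def eq_iff)
  qed (use l_vm[of 1] l_m1 nz2 in auto)
qed

section \<open>An analytic root through every real root\<close>

text \<open>Since the slope \<open>r\<close> is an integer, the substitution of \<open>(t - s)\<^sup>r z\<close> for \<open>z\<close>, followed by division by \<open>(t - s)\<^sup>r\<^sup>m\<close>,
  yields analytic coefficients again. At \<open>t = s\<close> the new polynomial has degree \<open>m\<close> in \<open>z\<close>; the coefficients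
  of higher degree vanish there, which means that the other roots have moved to infinity.\<close>

lemma hyperbolic_blow_up:
  fixes b :: "nat \<Rightarrow> complex \<Rightarrow> complex"
  assumes germ: "\<And>k. k \<le> N \<Longrightarrow> real_germ (b k) s"
    and vm: "\<forall>\<^sub>F t in nhds s. vert_mono (\<lambda>z. \<Sum>k\<le>N. b k (of_real t) * z ^ k)"
    and mN: "2 \<le> m" "m \<le> N"
    and bm: "b m (of_real s) \<noteq> 0" and low: "\<And>k. k < m \<Longrightarrow> b k (of_real s) = 0"
    and centred: "b (m - 1) = (\<lambda>_. 0)"
    and nontriv: "\<not> (\<forall>k<m. \<forall>\<^sub>F t in nhds (of_real s). b k t = 0)"
  obtains r a' where "1 \<le> r" "\<And>k. k \<le> N \<Longrightarrow> real_germ (a' k) s"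
    "\<forall>\<^sub>F t in nhds s. vert_mono (\<lambda>z. \<Sum>k\<le>N. a' k (of_real t) * z ^ k)"
    "\<forall>\<^sub>F t in nhds (of_real s). \<forall>k\<le>N. b k t * ((t - of_real s) ^ r) ^ k = (t - of_real s) ^ (r * m) * a' k t"
    "a' m (of_real s) \<noteq> 0" "\<And>k. m < k \<Longrightarrow> a' k (of_real s) = 0"
    "a' (m - 1) (of_real s) = 0" "a' (m - 2) (of_real s) \<noteq> 0"
proof -
  define J where "J = {j \<in> {1..m}. \<not> (\<forall>\<^sub>F t in nhds (of_real s). b (m - j) t = 0)}"
  have "\<exists>n g. real_germ g s \<and> g (of_real s) \<noteq> 0 \<and>
      (\<forall>\<^sub>F t in nhds (of_real s). b (m - j) t = (t - of_real s) ^ n * g t)" if "j \<in> J" for j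
  proof -
    have "real_germ (b (m - j)) s" using germ mN by simp
    thus ?thesis using real_germ_factor[of "b (m - j)" s] that unfolding J_def by blast
  qed
  then obtain od g where g: "\<And>j. j \<in> J \<Longrightarrow> real_germ (g j) s" "\<And>j. j \<in> J \<Longrightarrow> g j (of_real s) \<noteq> 0"
    "\<And>j. j \<in> J \<Longrightarrow> \<forall>\<^sub>F t in nhds (of_real s). b (m - j) t = (t - of_real s) ^ od j * g j t"
    by metis
  have zero: "\<forall>\<^sub>F t in nhds (of_real s). b (m - j) t = 0" if "j \<in> {1..m} - J" for j
    using that by (auto simp: J_def)
  have "J \<noteq> {}"
  proof -
    obtain k where k: "k < m" "\<not> (\<forall>\<^sub>F t in nhds (of_real s). b k t = 0)" using nontriv by blast
    hence "m - k \<in> J" by (auto simp: J_def)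
    thus ?thesis by blast
  qed
  moreover have "J \<subseteq> {1..m}" by (auto simp: J_def)
  ultimately obtain r l where r: "1 \<le> r" "\<And>j. j \<in> J \<Longrightarrow> r * j \<le> od j"
    and l: "\<And>k. l k = (if k = m then b m (of_real s)
       else if k < m \<and> m - k \<in> J \<and> od (m - k) = r * (m - k) then g (m - k) (of_real s) else 0)"
    and lvm: "vert_mono (\<lambda>z. \<Sum>k\<le>m. l k * z ^ k)" "l (m - 1) = 0" "l (m - 2) \<noteq> 0"
    using newton_slope[OF germ vm mN bm low centred, of J g od] zero g by blast
  define a' where "a' = (\<lambda>k t. if m \<le> k then (t - of_real s) ^ (r * (k - m)) * b k t
      else if m - k \<in> J then (t - of_real s) ^ (od (m - k) - r * (m - k)) * g (m - k) t else 0)"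
  have germ': "real_germ (a' k) s" if "k \<le> N" for k
  proof -
    have lin: "real_germ (\<lambda>t. t - of_real s) s" by (intro real_germ_intros) simp
    consider "m \<le> k" | "k < m" "m - k \<in> J" | "k < m" "m - k \<notin> J" by linarith
    thus ?thesis
    proof cases
      case 1
      thus ?thesis unfolding a'_def using germ[OF that] lin by (simp add: real_germ_mult real_germ_power)
    next
      case 2
      thus ?thesis unfolding a'_def using g(1) lin by (simp add: real_germ_mult real_germ_power)
    next
      case 3
      thus ?thesis unfolding a'_def by (simp add: real_germ_const)
    qed
  qed
  have a'_s: "a' k (of_real s) = l k" if "k \<le> N" for k
  proof -
    have z: "(0::complex) ^ (od j - r * j) = (if od j = r * j then 1 else 0)" if "j \<in> J" for j
      using r(2)[OF that] by (auto simp: power_0_left)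
    show ?thesis using r(1) by (auto simp: a'_def l z)
  qed
  have ident1: "\<forall>\<^sub>F t in nhds (of_real s). b k t * ((t - of_real s) ^ r) ^ k = (t - of_real s) ^ (r * m) * a' k t"
    if "k \<le> N" for k
  proof -
    consider "m \<le> k" | "k < m" "m - k \<in> J" | "k < m" "m - k \<notin> J" by linarith
    thus ?thesis
    proof cases
      case 1
      have "r * k = r * m + r * (k - m)" using 1 by (simp add: distrib_left[symmetric])
      hence "((t - of_real s) ^ r) ^ k = (t - of_real s) ^ (r * m) * (t - of_real s) ^ (r * (k - m))"
        for t :: complex
        by (metis power_add power_mult)
      thus ?thesis using 1 by (intro always_eventually) (simp add: a'_def mult_ac)
    next
      case 2
      define j where "j = m - k"
      have j: "j \<in> J" "m - j = k" using 2 by (auto simp: j_def)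
      have "\<forall>\<^sub>F t in nhds (of_real s). b k t = (t - of_real s) ^ od j * g j t" using g(3)[OF j(1)] j(2) by simp
      thus ?thesis
      proof eventually_elim
        case (elim t)
        have "r * m = r * k + r * j" using 2 by (simp add: j_def distrib_left[symmetric])
        hence "od j + r * k = r * m + (od j - r * j)" using r(2)[OF j(1)] by simp
        hence "(t - of_real s) ^ od j * ((t - of_real s) ^ r) ^ k =
            (t - of_real s) ^ (r * m) * (t - of_real s) ^ (od j - r * j)"
          by (metis power_add power_mult)
        moreover have "a' k t = (t - of_real s) ^ (od j - r * j) * g j t"
          using 2 by (simp add: a'_def j_def)
        ultimately show ?case using elim by (simp add: mult_ac)
      qed
    next
      case 3
      have "\<forall>\<^sub>F t in nhds (of_real s). b k t = 0" using zero[of "m - k"] 3 by simp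
      thus ?thesis by eventually_elim (use 3 in \<open>simp add: a'_def\<close>)
    qed
  qed
  have ident: "\<forall>\<^sub>F t in nhds (of_real s). \<forall>k\<in>{..N}. b k t * ((t - of_real s) ^ r) ^ k = (t - of_real s) ^ (r * m) * a' k t"
    by (rule eventually_ball_finite) (use ident1 in auto)
  show ?thesis
  proof (rule that[OF r(1) germ'])
    show "\<forall>\<^sub>F t in nhds (of_real s). \<forall>k\<le>N. b k t * ((t - of_real s) ^ r) ^ k = (t - of_real s) ^ (r * m) * a' k t"
      using ident by (simp only: Ball_def atMost_iff)
    show "\<forall>\<^sub>F t in nhds s. vert_mono (\<lambda>z. \<Sum>k\<le>N. a' k (of_real t) * z ^ k)"
      using eventually_nhds_of_real[OF ident] vm
    proof eventually_elim
      case (elim t)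
      show ?case
      proof (cases "t = s")
        case True
        have "(\<lambda>z. \<Sum>k\<le>N. a' k (of_real t) * z ^ k) = (\<lambda>z. \<Sum>k\<le>N. l k * z ^ k)"
          using a'_s True by simp
        also have "\<dots> = (\<lambda>z. \<Sum>k\<le>m. l k * z ^ k)"
          by (intro ext sum.mono_neutral_right) (use mN l in \<open>auto simp: not_le\<close>)
        finally show ?thesis using lvm by simp
      next
        case False
        define w where "w = (of_real t - of_real s :: complex)"
        have w: "w \<noteq> 0" "w ^ r \<in> \<real>" using False by (auto simp: w_def)
        have eq: "1 / w ^ (r * m) * (b k (of_real t) * (w ^ r * z) ^ k) = a' k (of_real t) * z ^ k"
          if "k \<le> N" for k z
        proof -
          have "b k (of_real t) * (w ^ r) ^ k = w ^ (r * m) * a' k (of_real t)"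
            using elim(1) that by (simp add: w_def)
          hence "b k (of_real t) * (w ^ r * z) ^ k = w ^ (r * m) * a' k (of_real t) * z ^ k"
            by (simp add: power_mult_distrib mult_ac)
          thus ?thesis using w by simp
        qed
        have "(\<lambda>z. 1 / w ^ (r * m) * (\<Sum>k\<le>N. b k (of_real t) * (w ^ r * z) ^ k)) =
            (\<lambda>z. \<Sum>k\<le>N. a' k (of_real t) * z ^ k)"
          unfolding sum_distrib_left by (intro ext sum.cong refl eq) simp
        thus ?thesis
          using vert_mono_cmult[OF vert_mono_scale[OF elim(2) w(2)], of "1 / w ^ (r * m)"] by simp
      qed
    qed
    show "a' m (of_real s) \<noteq> 0" using bm mN by (simp add: a'_s l)
    show "a' k (of_real s) = 0" if "m < k" for k using that r(1) by (simp add: a'_def)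
    show "a' (m - 1) (of_real s) = 0" "a' (m - 2) (of_real s) \<noteq> 0"
      using lvm mN by (simp_all add: a'_s)
  qed
qed

text \<open>A centred polynomial of degree \<open>m\<close> that is not a pure power cannot have a root of multiplicity \<open>m\<close>.\<close>

lemma hyperbolic_root_split:
  fixes l :: "nat \<Rightarrow> complex"
  assumes vm: "vert_mono (\<lambda>z. \<Sum>k\<le>N. l k * z ^ k)" and mN: "2 \<le> m" "m \<le> N"
    and l: "l m \<noteq> 0" "\<And>k. m < k \<Longrightarrow> l k = 0" "l (m - 1) = 0" "l (m - 2) \<noteq> 0"
  obtains c m' where "c \<in> \<real>" "1 \<le> m'" "m' < m" "shift_coeff N l c m' \<noteq> 0"
    "\<And>k. k < m' \<Longrightarrow> shift_coeff N l c k = 0"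
proof -
  define p where "p = (\<Sum>k\<le>N. monom (l k) k)"
  have coeff_p: "coeff p k = (if k \<le> N then l k else 0)" for k by (simp add: p_def coeff_sum)
  have poly_p: "poly p z = (\<Sum>k\<le>N. l k * z ^ k)" for z by (simp add: p_def poly_sum poly_monom)
  have "degree p \<noteq> 0"
  proof
    assume "degree p = 0"
    hence "coeff p m = 0" using mN by (simp add: coeff_eq_0)
    thus False using l mN coeff_p by simp
  qed
  hence "\<not> constant (poly p)" by (simp add: constant_degree)
  then obtain c where c: "poly p c = 0" using fundamental_theorem_of_algebra by blast
  have cr: "c \<in> \<real>"
    by (rule vert_mono_real_roots[OF vm]) (use c l mN in \<open>auto simp: poly_p\<close>)
  have sm: "shift_coeff N l c m = l m"
  proof -
    have "shift_coeff N l c m = (\<Sum>n\<le>N. if n = m then l m else 0)"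
      unfolding shift_coeff_def
    proof (rule sum.cong[OF refl])
      fix n
      consider "n < m" | "n = m" | "m < n" by linarith
      thus "of_nat (n choose m) * l n * c ^ (n - m) = (if n = m then l m else 0)"
        using l(2) by cases auto
    qed
    thus ?thesis using mN by simp
  qed
  have s0: "shift_coeff N l c 0 = 0" using c by (simp add: shift_coeff_def poly_p)
  define m' where "m' = (LEAST k. shift_coeff N l c k \<noteq> 0)"
  have m': "shift_coeff N l c m' \<noteq> 0" unfolding m'_def by (rule LeastI[of _ m]) (use sm l in simp)
  have low: "shift_coeff N l c k = 0" if "k < m'" for k using that not_less_Least unfolding m'_def by blast
  have "m' \<le> m" using low[of m] sm l(1) by (metis not_less)
  moreover have "m' \<noteq> m"
  proof
    assume "m' = m"
    hence "shift_coeff N l c (m - 1) = 0" using low mN by simp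
    moreover have "shift_coeff N l c (m - 1) = (\<Sum>n\<le>N. if n = m then of_nat m * l m * c else 0)"
      unfolding shift_coeff_def
    proof (rule sum.cong[OF refl])
      fix n
      consider "n < m - 1" | "n = m - 1" | "n = m" | "m < n" by linarith
      thus "of_nat (n choose (m - 1)) * l n * c ^ (n - (m - 1)) = (if n = m then of_nat m * l m * c else 0)"
      proof cases
        case 3
        have "m choose (m - 1) = m" using mN by (cases m) auto
        thus ?thesis using 3 mN by simp
      qed (use l mN in \<open>auto simp: binomial_eq_0\<close>)
    qed
    ultimately have "c = 0" using mN l(1) by simp
    hence "shift_coeff N l c (m - 2) = l (m - 2)" using mN by (simp add: shift_coeff_0)
    thus False using low[of "m - 2"] \<open>m' = m\<close> mN l(4) by simp
  qed
  moreover have "1 \<le> m'" using m' s0 by (cases m') auto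
  ultimately show ?thesis using that[OF cr _ _ m' low] by linarith
qed

text \<open>Through a root of multiplicity \<open>m\<close> of a real-rooted family passes at least one analytic root, by induction
  on \<open>m\<close>. The family is recentred by the analytic simple root \<open>\<mu>\<close> of the \<open>(m-1)\<close>-st derivative (for \<open>m = 1\<close>
  this is the root sought). Either \<open>\<mu>\<close> is a root of multiplicity \<open>m\<close> for all \<open>t\<close>, or the blow-up has only roots of smaller
  multiplicity. Leading coefficients may vanish at \<open>t = s\<close>; this generality is needed for the blow-up.\<close>

lemma hyperbolic_root:
  fixes a :: "nat \<Rightarrow> complex \<Rightarrow> complex"
  assumes "\<And>k. k \<le> N \<Longrightarrow> real_germ (a k) s"
    and "\<forall>\<^sub>F t in nhds s. vert_mono (\<lambda>z. \<Sum>k\<le>N. a k (of_real t) * z ^ k)"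
    and "1 \<le> m" "m \<le> N" and "a m (of_real s) \<noteq> 0" and "\<And>k. k < m \<Longrightarrow> a k (of_real s) = 0"
  shows "\<exists>\<rho>. real_germ \<rho> s \<and> \<rho> (of_real s) = 0 \<and>
           (\<forall>\<^sub>F t in nhds (of_real s). (\<Sum>k\<le>N. a k t * \<rho> t ^ k) = 0)"
  using assms
proof (induction m arbitrary: a rule: less_induct)
  case (less m)
  note germ = less.prems(1) and vm = less.prems(2) and m1 = less.prems(3) and mN = less.prems(4)
    and am = less.prems(5) and low = less.prems(6)
  \<comment> \<open>Up to a factorial, these are the coefficients of the \<open>(m-1)\<close>-st derivative in \<open>z\<close>; at \<open>t = s\<close> it has a
    simple root at \<open>0\<close>.\<close>
  define d where "d = (\<lambda>j t. of_nat ((j + (m - 1)) choose (m - 1)) * a (j + (m - 1)) t)"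
  have dgerm: "real_germ (d j) s" if "j \<le> N - (m - 1)" for j
    unfolding d_def using that mN m1 by (intro real_germ_intros germ) auto
  have d0: "d 0 (of_real s) = 0" using low m1 by (simp add: d_def)
  have d1: "d 1 (of_real s) \<noteq> 0" using am m1 by (simp add: d_def)
  have N1: "1 \<le> N - (m - 1)" using m1 mN by simp
  obtain \<mu> where \<mu>: "real_germ \<mu> s" "\<mu> (of_real s) = 0"
    "\<forall>\<^sub>F t in nhds (of_real s). (\<Sum>k\<le>N - (m - 1). d k t * \<mu> t ^ k) = 0"
    using real_germ_implicit_root[where d = d, OF dgerm d0 d1 N1] by blast
  have sum_eq: "(\<Sum>k\<le>N - (m - 1). d k t * \<mu> t ^ k) = shift_coeff N (\<lambda>k. a k t) (\<mu> t) (m - 1)" for t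
  proof -
    have "shift_coeff N (\<lambda>k. a k t) (\<mu> t) (m - 1) =
        (\<Sum>n\<in>{m - 1..N}. of_nat (n choose (m - 1)) * a n t * \<mu> t ^ (n - (m - 1)))"
      unfolding shift_coeff_def by (rule sum.mono_neutral_right) (auto simp: binomial_eq_0 not_le)
    also have "\<dots> = (\<Sum>k\<le>N - (m - 1). d k t * \<mu> t ^ k)"
      by (rule sum.reindex_bij_witness[of _ "\<lambda>k. k + (m - 1)" "\<lambda>n. n - (m - 1)"])
        (use m1 mN in \<open>auto simp: d_def\<close>)
    finally show ?thesis by simp
  qed
  \<comment> \<open>The coefficient of \<open>z\<^sup>m\<^sup>-\<^sup>1\<close> vanishes near \<open>s\<close> by the choice of \<open>\<mu>\<close>; here it is set to zero for all \<open>t\<close>.\<close>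
  define b where "b = (\<lambda>k t. if k = m - 1 then 0 else shift_coeff N (\<lambda>k. a k t) (\<mu> t) k)"
  have b_eq: "\<forall>\<^sub>F t in nhds (of_real s). \<forall>k. b k t = shift_coeff N (\<lambda>k. a k t) (\<mu> t) k"
    using \<mu>(3) unfolding sum_eq by eventually_elim (simp add: b_def)
  have bgerm: "real_germ (b k) s" if "k \<le> N" for k
    by (cases "k = m - 1") (auto simp: b_def intro: real_germ_const real_germ_shift_coeff germ \<mu>(1))
  have b_s: "b k (of_real s) = a k (of_real s)" if "k \<le> N" for k
    using that low m1 by (simp add: b_def \<mu>(2) shift_coeff_0)
  have b_ev: "\<forall>\<^sub>F t in nhds (of_real s). \<forall>z. (\<Sum>k\<le>N. b k t * z ^ k) = (\<Sum>k\<le>N. a k t * (z + \<mu> t) ^ k)"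
    using b_eq by eventually_elim (simp add: shift_coeff_eval)
  have real_\<mu>: "\<forall>\<^sub>F t in nhds s. \<mu> (of_real t) \<in> \<real>" using \<mu>(1) by (simp add: real_germ_def)
  show ?case
  proof (cases "\<forall>k<m. \<forall>\<^sub>F t in nhds (of_real s). b k t = 0")
    case True
    hence "\<forall>\<^sub>F t in nhds (of_real s). b 0 t = 0" using m1 by simp
    hence "\<forall>\<^sub>F t in nhds (of_real s). (\<Sum>k\<le>N. a k t * \<mu> t ^ k) = 0"
      using b_ev
    proof eventually_elim
      case (elim t)
      have "(\<Sum>k\<le>N. b k t * 0 ^ k) = b 0 t" by (simp add: power_0_left if_distrib[of "\<lambda>a. _ * a"] cong: if_cong)
      thus ?case using elim(1) elim(2)[rule_format, of 0] by simp
    qed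
    thus ?thesis using \<mu> by blast
  next
    case False
    have m2: "2 \<le> m"
    proof (rule ccontr)
      assume "\<not> 2 \<le> m"
      hence "m = 1" using m1 by simp
      thus False using False by (simp add: b_def)
    qed
    have bvm: "\<forall>\<^sub>F t in nhds s. vert_mono (\<lambda>z. \<Sum>k\<le>N. b k (of_real t) * z ^ k)"
      using vm eventually_nhds_of_real[OF b_ev] real_\<mu>
      by eventually_elim (use vert_mono_shift in fastforce)
    have bm: "b m (of_real s) \<noteq> 0" using am mN by (simp add: b_s)
    have blow: "b k (of_real s) = 0" if "k < m" for k using low[OF that] that mN by (simp add: b_s)
    have bcent: "b (m - 1) = (\<lambda>_. 0)" by (simp add: b_def)
    obtain r a' where r: "1 \<le> r" and a': "\<And>k. k \<le> N \<Longrightarrow> real_germ (a' k) s"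
      "\<forall>\<^sub>F t in nhds s. vert_mono (\<lambda>z. \<Sum>k\<le>N. a' k (of_real t) * z ^ k)"
      "\<forall>\<^sub>F t in nhds (of_real s). \<forall>k\<le>N. b k t * ((t - of_real s) ^ r) ^ k = (t - of_real s) ^ (r * m) * a' k t"
      "a' m (of_real s) \<noteq> 0" "\<And>k. m < k \<Longrightarrow> a' k (of_real s) = 0"
      "a' (m - 1) (of_real s) = 0" "a' (m - 2) (of_real s) \<noteq> 0"
      using hyperbolic_blow_up[OF bgerm bvm m2 mN bm blow bcent False] by blast
    obtain c m' where c: "c \<in> \<real>" "1 \<le> m'" "m' < m" "shift_coeff N (\<lambda>k. a' k (of_real s)) c m' \<noteq> 0"
      "\<And>k. k < m' \<Longrightarrow> shift_coeff N (\<lambda>k. a' k (of_real s)) c k = 0"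
      using hyperbolic_root_split[OF eventually_nhds_x_imp_x[OF a'(2)] m2 mN a'(4,5,6,7)] by blast
    define a'' where "a'' = (\<lambda>k t. shift_coeff N (\<lambda>k. a' k t) c k)"
    have germ'': "real_germ (a'' k) s" if "k \<le> N" for k
      unfolding a''_def by (intro real_germ_shift_coeff a'(1) real_germ_const c(1))
    have vm'': "\<forall>\<^sub>F t in nhds s. vert_mono (\<lambda>z. \<Sum>k\<le>N. a'' k (of_real t) * z ^ k)"
      using a'(2) unfolding a''_def shift_coeff_eval by eventually_elim (rule vert_mono_shift[OF _ c(1)])
    obtain \<rho> where \<rho>: "real_germ \<rho> s" "\<rho> (of_real s) = 0"
      "\<forall>\<^sub>F t in nhds (of_real s). (\<Sum>k\<le>N. a'' k t * \<rho> t ^ k) = 0"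
      using less.IH[OF c(3) germ'' vm'' c(2)] c(3,4,5) mN unfolding a''_def by auto
    \<comment> \<open>Undo the shift by the root \<open>c\<close>, the blow-up, and the centring.\<close>
    define L where "L = (\<lambda>t. (t - of_real s) ^ r * (\<rho> t + c) + \<mu> t)"
    have "real_germ L s" unfolding L_def by (intro real_germ_intros \<rho> \<mu> c) auto
    moreover have "L (of_real s) = 0" using r \<mu>(2) by (simp add: L_def)
    moreover have "\<forall>\<^sub>F t in nhds (of_real s). (\<Sum>k\<le>N. a k t * L t ^ k) = 0"
      using \<rho>(3) a'(3) b_ev
    proof eventually_elim
      case (elim t)
      define x where "x = \<rho> t + c"
      have "(\<Sum>k\<le>N. a' k t * x ^ k) = 0" using elim(1) by (simp add: a''_def shift_coeff_eval x_def)
      have "(\<Sum>k\<le>N. a k t * L t ^ k) = (\<Sum>k\<le>N. b k t * ((t - of_real s) ^ r * x) ^ k)"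
        using elim(3) by (simp add: L_def x_def)
      also have "\<dots> = (\<Sum>k\<le>N. (t - of_real s) ^ (r * m) * (a' k t * x ^ k))"
      proof (rule sum.cong[OF refl])
        fix k assume "k \<in> {..N}"
        hence "b k t * ((t - of_real s) ^ r) ^ k = (t - of_real s) ^ (r * m) * a' k t" using elim(2) by simp
        thus "b k t * ((t - of_real s) ^ r * x) ^ k = (t - of_real s) ^ (r * m) * (a' k t * x ^ k)"
          by (simp add: power_mult_distrib mult_ac)
      qed
      also have "\<dots> = 0" using \<open>(\<Sum>k\<le>N. a' k t * x ^ k) = 0\<close> by (simp add: sum_distrib_left[symmetric])
      finally show ?case .
    qed
    ultimately show ?thesis by blast
  qed
qed

text \<open>Divide by the linear factor of one analytic root and repeat.\<close>

lemma local_analytic_factorization: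
  fixes a :: "nat \<Rightarrow> complex \<Rightarrow> complex"
  assumes "\<And>k. k \<le> n \<Longrightarrow> real_germ (a k) s" and "a n = (\<lambda>_. 1)"
    and "\<forall>\<^sub>F t in nhds s. \<forall>z. (\<Sum>k\<le>n. a k (of_real t) * z ^ k) = 0 \<longrightarrow> z \<in> \<real>"
  shows "\<exists>\<rho>. (\<forall>i<n. real_germ (\<rho> i) s) \<and>
           (\<forall>\<^sub>F t in nhds (of_real s). \<forall>z. (\<Sum>k\<le>n. a k t * z ^ k) = (\<Prod>i<n. z - \<rho> i t))"
  using assms
proof (induction n arbitrary: a)
  case 0
  thus ?case by simp
next
  case (Suc n)
  let ?N = "Suc n"
  note germ = Suc.prems(1) and monic = Suc.prems(2) and roots = Suc.prems(3)
  have vm: "\<forall>\<^sub>F t in nhds s. vert_mono (\<lambda>z. \<Sum>k\<le>?N. a k (of_real t) * z ^ k)"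
    using roots
  proof eventually_elim
    case (elim t)
    define p where "p = (\<Sum>k\<le>?N. monom (a k (of_real t)) k)"
    have p: "poly p z = (\<Sum>k\<le>?N. a k (of_real t) * z ^ k)" for z
      unfolding p_def by (simp only: poly_sum poly_monom)
    have "z \<in> \<real>" if "poly p z = 0" for z using elim that[unfolded p] by blast
    hence "vert_mono (poly p)" by (rule vert_mono_poly_real_rooted)
    thus ?case by (simp only: p[abs_def])
  qed
  have "\<exists>c. (\<Sum>k\<le>?N. a k (of_real s) * c ^ k) = 0"
  proof -
    define p where "p = (\<Sum>k\<le>?N. monom (a k (of_real s)) k)"
    have p: "poly p z = (\<Sum>k\<le>?N. a k (of_real s) * z ^ k)" for z
      unfolding p_def by (simp only: poly_sum poly_monom)
    have "coeff p ?N = 1" unfolding p_def using monic by (simp add: coeff_sum del: sum.atMost_Suc)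
    hence "degree p \<noteq> 0" using coeff_eq_0[of p ?N] by fastforce
    hence "\<not> constant (poly p)" by (simp add: constant_degree)
    thus ?thesis using fundamental_theorem_of_algebra p by metis
  qed
  then obtain c where c: "(\<Sum>k\<le>?N. a k (of_real s) * c ^ k) = 0" by blast
  hence cr: "c \<in> \<real>" using eventually_nhds_x_imp_x[OF roots] by blast
  define a1 where "a1 = (\<lambda>k t. shift_coeff ?N (\<lambda>k. a k t) c k)"
  have germ1: "real_germ (a1 k) s" if "k \<le> ?N" for k
    unfolding a1_def by (intro real_germ_shift_coeff germ real_germ_const cr)
  have vm1: "\<forall>\<^sub>F t in nhds s. vert_mono (\<lambda>z. \<Sum>k\<le>?N. a1 k (of_real t) * z ^ k)"
    using vm unfolding a1_def shift_coeff_eval by eventually_elim (rule vert_mono_shift[OF _ cr])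
  have top: "a1 ?N (of_real s) \<noteq> 0"
  proof -
    have "a1 ?N (of_real s) = (\<Sum>k\<le>?N. if k = ?N then 1 else 0)"
      unfolding a1_def shift_coeff_def by (rule sum.cong) (auto simp: monic binomial_eq_0)
    thus ?thesis by simp
  qed
  have bot: "a1 0 (of_real s) = 0" using c by (simp add: a1_def shift_coeff_def)
  define m where "m = (LEAST k. a1 k (of_real s) \<noteq> 0)"
  have am: "a1 m (of_real s) \<noteq> 0" unfolding m_def by (rule LeastI[where P = "\<lambda>k. a1 k (of_real s) \<noteq> 0", OF top])
  have low: "a1 k (of_real s) = 0" if "k < m" for k using that not_less_Least unfolding m_def by blast
  have mN: "m \<le> ?N" unfolding m_def by (rule Least_le[where P = "\<lambda>k. a1 k (of_real s) \<noteq> 0", OF top])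
  have m1: "1 \<le> m" using am bot by (cases m) auto
  obtain \<mu> where \<mu>: "real_germ \<mu> s"
    "\<forall>\<^sub>F t in nhds (of_real s). (\<Sum>k\<le>?N. a1 k t * \<mu> t ^ k) = 0"
    using hyperbolic_root[of ?N a1 s m, OF germ1 vm1 m1 mN am low] by blast
  define r where "r = (\<lambda>t. \<mu> t + c)"
  have r: "real_germ r s" unfolding r_def by (intro real_germ_intros \<mu>(1) cr)
  have root: "\<forall>\<^sub>F t in nhds (of_real s). (\<Sum>k\<le>?N. a k t * r t ^ k) = 0"
    using \<mu>(2) unfolding a1_def shift_coeff_eval r_def .
  \<comment> \<open>The coefficients of the quotient by \<open>z - r t\<close>.\<close>
  define b where "b = (\<lambda>i t. \<Sum>j\<in>{Suc i..?N}. a j t * r t ^ (j - Suc i))"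
  have bgerm: "real_germ (b i) s" if "i \<le> n" for i
    unfolding b_def by (intro real_germ_intros germ r) auto
  have bmonic: "b n = (\<lambda>_. 1)" by (simp add: b_def monic)
  have fact: "(\<Sum>k\<le>?N. a k t * z ^ k) = (z - r t) * (\<Sum>i\<le>n. b i t * z ^ i)"
    if "(\<Sum>k\<le>?N. a k t * r t ^ k) = 0" for t z
  proof -
    have "(\<Sum>k\<le>?N. a k t * z ^ k) = (\<Sum>k\<le>?N. a k t * z ^ k) - (\<Sum>k\<le>?N. a k t * r t ^ k)"
      using that by simp
    also have "\<dots> = (\<Sum>k\<le>?N. a k t * (z ^ k - r t ^ k))"
      by (simp only: sum_subtractf[symmetric] right_diff_distrib)
    also have "\<dots> = (z - r t) * (\<Sum>k\<le>?N. \<Sum>i<k. a k t * (r t ^ (k - Suc i) * z ^ i))"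
      by (simp only: power_diff_sumr2 sum_distrib_left mult_ac)
    also have "(\<Sum>k\<le>?N. \<Sum>i<k. a k t * (r t ^ (k - Suc i) * z ^ i)) =
        (\<Sum>i\<le>n. \<Sum>k\<in>{Suc i..?N}. a k t * (r t ^ (k - Suc i) * z ^ i))"
      unfolding sum.Sigma[OF finite_atMost ballI[OF finite_lessThan]]
        sum.Sigma[OF finite_atMost ballI[OF finite_atLeastAtMost]]
      by (rule sum.reindex_bij_witness[of _ "\<lambda>(i, k). (k, i)" "\<lambda>(k, i). (i, k)"]) auto
    also have "\<dots> = (\<Sum>i\<le>n. b i t * z ^ i)"
      by (simp only: b_def sum_distrib_right mult.assoc)
    finally show ?thesis .
  qed
  have broots: "\<forall>\<^sub>F t in nhds s. \<forall>z. (\<Sum>k\<le>n. b k (of_real t) * z ^ k) = 0 \<longrightarrow> z \<in> \<real>"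
    using roots eventually_nhds_of_real[OF root]
    by eventually_elim (use fact in auto)
  obtain \<rho> where \<rho>: "\<forall>i<n. real_germ (\<rho> i) s"
    "\<forall>\<^sub>F t in nhds (of_real s). \<forall>z. (\<Sum>k\<le>n. b k t * z ^ k) = (\<Prod>i<n. z - \<rho> i t)"
    using Suc.IH[OF bgerm bmonic broots] by blast
  define \<rho>' where "\<rho>' = (\<lambda>i. if i = n then r else \<rho> i)"
  have "\<forall>\<^sub>F t in nhds (of_real s). \<forall>z. (\<Sum>k\<le>?N. a k t * z ^ k) = (\<Prod>i<?N. z - \<rho>' i t)"
    using \<rho>(2) root
  proof eventually_elim
    case (elim t)
    have "(\<Prod>i<n. z - \<rho> i t) = (\<Prod>i<n. z - \<rho>' i t)" for z
      by (rule prod.cong) (auto simp: \<rho>'_def)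
    thus ?case using fact[OF elim(2)] elim(1) by (simp add: \<rho>'_def mult.commute del: sum.atMost_Suc)
  qed
  moreover have "\<forall>i<?N. real_germ (\<rho>' i) s" using \<rho>(1) r by (auto simp: \<rho>'_def less_Suc_eq)
  ultimately show ?case by blast
qed

section \<open>Real-analytic functions on the line\<close>

lemma real_analytic_on_subset: "real_analytic_on f S \<Longrightarrow> T \<subseteq> S \<Longrightarrow> real_analytic_on f T"
  unfolding real_analytic_on_def by (meson subsetD)

lemma real_analytic_on_local:
  assumes "\<And>x. x \<in> S \<Longrightarrow> \<exists>e>0. \<exists>g. real_analytic_on g (S \<inter> ball x e) \<and> (\<forall>t\<in>S \<inter> ball x e. f t = g t)"
  shows "real_analytic_on f S"
  unfolding real_analytic_on_def
proof
  fix x assume x: "x \<in> S"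
  obtain e g where e: "0 < e" "real_analytic_on g (S \<inter> ball x e)" "\<And>t. t \<in> S \<inter> ball x e \<Longrightarrow> f t = g t"
    using assms[OF x] by blast
  obtain c r where r: "0 < r" "\<And>t. t \<in> S \<inter> ball x e \<Longrightarrow> \<bar>t - x\<bar> < r \<Longrightarrow> (\<lambda>n. c n * (t - x) ^ n) sums g t"
    using e(1,2) x unfolding real_analytic_on_def by (metis IntI centre_in_ball)
  show "\<exists>c r. 0 < r \<and> (\<forall>t\<in>S. \<bar>t - x\<bar> < r \<longrightarrow> (\<lambda>n. c n * (t - x) ^ n) sums f t)"
    using r e by (intro exI[of _ c] exI[of _ "min r e"]) (auto simp: dist_real_def abs_minus_commute)
qed

lemma real_analytic_on_diff:
  assumes "real_analytic_on f S" "real_analytic_on g S"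
  shows "real_analytic_on (\<lambda>t. f t - g t) S"
  unfolding real_analytic_on_def
proof
  fix x assume x: "x \<in> S"
  obtain c r where r: "0 < r" "\<And>t. t \<in> S \<Longrightarrow> \<bar>t - x\<bar> < r \<Longrightarrow> (\<lambda>n. c n * (t - x) ^ n) sums f t"
    using assms(1) x unfolding real_analytic_on_def by metis
  obtain c' r' where r': "0 < r'" "\<And>t. t \<in> S \<Longrightarrow> \<bar>t - x\<bar> < r' \<Longrightarrow> (\<lambda>n. c' n * (t - x) ^ n) sums g t"
    using assms(2) x unfolding real_analytic_on_def by metis
  show "\<exists>c r. 0 < r \<and> (\<forall>t\<in>S. \<bar>t - x\<bar> < r \<longrightarrow> (\<lambda>n. c n * (t - x) ^ n) sums (f t - g t))"
    using r r' sums_diff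
    by (intro exI[of _ "\<lambda>n. c n - c' n"] exI[of _ "min r r'"]) (fastforce simp: left_diff_distrib)
qed

lemma real_analytic_on_const: "real_analytic_on (\<lambda>_. c) S"
  unfolding real_analytic_on_def
proof
  fix x
  have "(\<lambda>n. (if n = 0 then c else 0) * (t - x) ^ n) sums c" for t
    using sums_If_finite_set[of "{0}" "\<lambda>n. c * (t - x) ^ n"] by (simp add: if_distrib[of "\<lambda>a. a * _"] cong: if_cong)
  thus "\<exists>c' r. 0 < r \<and> (\<forall>t\<in>S. \<bar>t - x\<bar> < r \<longrightarrow> (\<lambda>n. c' n * (t - x) ^ n) sums c)"
    by (intro exI[of _ "\<lambda>n. if n = 0 then c else 0"] exI[of _ 1]) auto
qed

text \<open>At a point that is not isolated in \<open>S\<close> the expansion converges on a full interval, also when \<open>S\<close> lies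
  only on one side.\<close>

lemma real_analytic_on_powser:
  assumes f: "real_analytic_on f S" and x: "x \<in> S" "x islimpt S"
  shows "\<exists>c d. 0 < d \<and> (\<forall>t. \<bar>t - x\<bar> < d \<longrightarrow> summable (\<lambda>n. c n * (t - x) ^ n)) \<and>
    (\<forall>t\<in>S. \<bar>t - x\<bar> < d \<longrightarrow> (\<lambda>n. c n * (t - x) ^ n) sums f t)"
proof -
  obtain c r where r: "0 < r" "\<And>t. t \<in> S \<Longrightarrow> \<bar>t - x\<bar> < r \<Longrightarrow> (\<lambda>n. c n * (t - x) ^ n) sums f t"
    using f x unfolding real_analytic_on_def by metis
  obtain w where w: "w \<in> S" "w \<noteq> x" "dist w x < r" using x(2) r(1) by (auto simp: islimpt_approachable)
  have sm: "summable (\<lambda>n. c n * (w - x) ^ n)"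
    using r(2)[OF w(1)] w(3) by (auto simp: dist_real_def sums_iff)
  have "summable (\<lambda>n. c n * (t - x) ^ n)" if "\<bar>t - x\<bar> < \<bar>w - x\<bar>" for t
    by (rule powser_inside[OF sm]) (use that in auto)
  moreover have "(\<lambda>n. c n * (t - x) ^ n) sums f t" if "t \<in> S" "\<bar>t - x\<bar> < \<bar>w - x\<bar>" for t
    using r(2)[OF that(1)] that(2) w(3) by (auto simp: dist_real_def)
  ultimately show ?thesis using w(2) by (intro exI[of _ c] exI[of _ "\<bar>w - x\<bar>"]) auto
qed

lemma real_analytic_on_zero_near:
  assumes h: "real_analytic_on h S" and x: "x \<in> S" "x islimpt {t \<in> S. h t = 0}"
  shows "\<exists>e>0. \<forall>t\<in>S. \<bar>t - x\<bar> < e \<longrightarrow> h t = 0"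
proof -
  have xS: "x islimpt S" using x(2) by (rule islimpt_subset) auto
  obtain c d where d: "0 < d" "\<forall>t. \<bar>t - x\<bar> < d \<longrightarrow> summable (\<lambda>n. c n * (t - x) ^ n)"
    "\<forall>t\<in>S. \<bar>t - x\<bar> < d \<longrightarrow> (\<lambda>n. c n * (t - x) ^ n) sums h t"
    using real_analytic_on_powser[OF h x(1) xS] by (elim exE conjE)
  define F where "F = (\<lambda>t. \<Sum>n. c n * (t - x) ^ n)"
  have F: "(\<lambda>n. c n * (t - x) ^ n) sums F t" if "norm (t - x) < d" for t
    using d(2) that by (simp add: F_def summable_sums)
  have hF: "h t = F t" if "t \<in> S" "\<bar>t - x\<bar> < d" for t
    using bspec[OF d(3) that(1)] F[of t] that(2) sums_unique2 by auto
  have Fx: "F x = c 0" by (simp add: F_def powser_zero)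
  show ?thesis
  proof (cases "\<forall>n. c n = 0")
    case True
    hence "F t = 0" for t by (simp add: F_def)
    thus ?thesis using hF d(1) by auto
  next
    case False
    have "\<exists>e>0. \<forall>t. 0 < \<bar>t - x\<bar> \<and> \<bar>t - x\<bar> < e \<longrightarrow> F t \<noteq> 0"
    proof (cases "c 0 = 0")
      case True
      then obtain m where m: "c m \<noteq> 0" "0 < m" using False by (metis gr0I)
      obtain e where "0 < e" "\<And>z. z \<in> cball x e - {x} \<Longrightarrow> F z \<noteq> 0"
        using powser_0_nonzero[of d x c F m, OF d(1) F] True Fx m by auto
      thus ?thesis by (intro exI[of _ e]) (auto simp: dist_real_def abs_minus_commute)
    next
      case c0: False
      have G: "isCont (\<lambda>y. \<Sum>n. c n * y ^ n) 0"
      proof (rule isCont_powser[of c "d / 2"])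
        show "summable (\<lambda>n. c n * (d / 2) ^ n)" using d(2)[rule_format, of "x + d / 2"] d(1) by simp
      qed (use d(1) in auto)
      have "isCont (\<lambda>t. t - x) x" by (intro continuous_intros)
      hence "isCont F x" unfolding F_def by (rule isCont_o2) (use G in simp)
      moreover have "F x \<noteq> 0" using Fx c0 by simp
      ultimately obtain e where "0 < e" "\<forall>y. dist x y < e \<longrightarrow> F y \<noteq> 0"
        using continuous_at_avoid by blast
      thus ?thesis by (intro exI[of _ e]) (auto simp: dist_real_def abs_minus_commute)
    qed
    then obtain e where e: "0 < e" "\<And>t. 0 < \<bar>t - x\<bar> \<Longrightarrow> \<bar>t - x\<bar> < e \<Longrightarrow> F t \<noteq> 0" by blast
    obtain t where t: "t \<in> S" "h t = 0" "t \<noteq> x" "dist t x < min d e"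
      using x(2) d(1) e(1) unfolding islimpt_approachable by (metis (mono_tags, lifting) mem_Collect_eq min_less_iff_conj)
    thus ?thesis using hF[of t] e(2)[of t] by (auto simp: dist_real_def)
  qed
qed

text \<open>The set of limit points of the coincidence set is closed and, by the expansion at each of its points,
  open in \<open>S\<close>.\<close>

lemma real_analytic_identity:
  assumes f: "real_analytic_on f S" "real_analytic_on g S" and S: "connected S"
    and x: "x \<in> S" "x islimpt {t \<in> S. f t = g t}" and y: "y \<in> S"
  shows "f y = g y"
proof -
  define h where "h = (\<lambda>t. f t - g t)"
  have h: "real_analytic_on h S" unfolding h_def using f by (rule real_analytic_on_diff)
  have hz: "{t \<in> S. h t = 0} = {t \<in> S. f t = g t}" by (auto simp: h_def)
  define Z where "Z = S \<inter> {x. x islimpt {t \<in> S. h t = 0}}"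
  have xZ: "x \<in> Z" using x hz by (simp add: Z_def)
  have xlim: "x islimpt S" using x(2) by (rule islimpt_subset) auto
  hence "S \<noteq> {u}" for u by (auto simp: islimpt_finite)
  hence perfect: "v islimpt S" if "v \<in> S" for v
    using connected_imp_perfect[OF S that] by blast
  have "closedin (top_of_set S) Z" unfolding Z_def by (intro closedin_closed_Int closed_limpts)
  moreover have "openin (top_of_set S) Z"
  proof (subst openin_euclidean_subtopology_iff, intro conjI ballI)
    fix u assume "u \<in> Z"
    hence u: "u \<in> S" "u islimpt {t \<in> S. h t = 0}" by (auto simp: Z_def)
    obtain e where e: "0 < e" "\<And>t. t \<in> S \<Longrightarrow> \<bar>t - u\<bar> < e \<Longrightarrow> h t = 0"
      using real_analytic_on_zero_near[OF h u] by blast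
    have "v \<in> Z" if v: "v \<in> S" "dist v u < e" for v
    proof -
      have "v islimpt (S \<inter> ball u e)"
        by (intro islimpt_Int_eventually perfect v(1) eventually_at_in_open')
          (use v(2) in \<open>auto simp: dist_commute\<close>)
      hence "v islimpt {t \<in> S. h t = 0}"
        by (rule islimpt_subset) (use e in \<open>auto simp: dist_real_def abs_minus_commute\<close>)
      thus ?thesis using v by (simp add: Z_def)
    qed
    thus "\<exists>e>0. \<forall>v\<in>S. dist v u < e \<longrightarrow> v \<in> Z" using e(1) by blast
  qed (auto simp: Z_def)
  ultimately have "Z = S" using S xZ unfolding connected_clopen by blast
  hence "y islimpt {t \<in> S. h t = 0}" using y by (auto simp: Z_def)
  then obtain e where "0 < e" "\<And>t. t \<in> S \<Longrightarrow> \<bar>t - y\<bar> < e \<Longrightarrow> h t = 0"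
    using real_analytic_on_zero_near[OF h y] by blast
  from this(2)[OF y] this(1) show ?thesis by (simp add: h_def)
qed

lemma real_germ_real_analytic:
  assumes "real_germ f s"
  shows "\<exists>r>0. real_analytic_on (\<lambda>t. Re (f (of_real t))) {s - r<..<s + r} \<and>
           (\<forall>t. \<bar>t - s\<bar> < r \<longrightarrow> f (of_real t) = of_real (Re (f (of_real t))))"
proof -
  obtain r where r: "0 < r" "f holomorphic_on ball (of_real s) r" "\<And>t. \<bar>t - s\<bar> < r \<Longrightarrow> f (of_real t) \<in> \<real>"
    using real_germ_ball[OF assms] by blast
  have "real_analytic_on (\<lambda>t. Re (f (of_real t))) {s - r<..<s + r}"
    unfolding real_analytic_on_def
  proof
    fix x assume x: "x \<in> {s - r<..<s + r}"
    define d where "d = r - \<bar>x - s\<bar>"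
    have d: "0 < d" using x by (auto simp: d_def)
    have "ball (of_real x) d \<subseteq> ball (of_real s :: complex) r"
      by (simp add: ball_subset_ball_iff dist_of_real dist_real_def d_def)
    hence hol: "f holomorphic_on ball (of_real x) d" using r(2) holomorphic_on_subset by blast
    define c where "c = (\<lambda>n. Re ((deriv ^^ n) f (of_real x) / fact n))"
    have "(\<lambda>n. c n * (t - x) ^ n) sums Re (f (of_real t))" if t: "\<bar>t - x\<bar> < d" for t
    proof -
      have "of_real t \<in> ball (of_real x :: complex) d"
        using t by (simp add: dist_of_real dist_real_def abs_minus_commute)
      from holomorphic_power_series[OF hol this]
      have ps: "(\<lambda>n. (deriv ^^ n) f (of_real x) / fact n * of_real ((t - x) ^ n)) sums f (of_real t)" by simp
      have re: "Re (z * of_real v) = Re z * v" for z v by simp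
      show ?thesis using sums_Re[OF ps] unfolding c_def re .
    qed
    thus "\<exists>c r'. 0 < r' \<and> (\<forall>t\<in>{s - r<..<s + r}. \<bar>t - x\<bar> < r' \<longrightarrow> (\<lambda>n. c n * (t - x) ^ n) sums Re (f (of_real t)))"
      using d by blast
  qed
  thus ?thesis using r by (intro exI[of _ r]) (auto simp: of_real_Re)
qed

section \<open>Monotone branches and gluing\<close>

lemma real_analytic_on_has_derivative:
  assumes f: "real_analytic_on f S" and x: "x \<in> S" "x islimpt S"
  shows "\<exists>D. (f has_real_derivative D) (at x within S)"
proof -
  obtain c d where d: "0 < d" "\<forall>t. \<bar>t - x\<bar> < d \<longrightarrow> summable (\<lambda>n. c n * (t - x) ^ n)"
    "\<forall>t\<in>S. \<bar>t - x\<bar> < d \<longrightarrow> (\<lambda>n. c n * (t - x) ^ n) sums f t"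
    using real_analytic_on_powser[OF f x] by (elim exE conjE)
  define G where "G = (\<lambda>y. \<Sum>n. c n * y ^ n)"
  have "(G has_field_derivative (\<Sum>n. diffs c n * 0 ^ n)) (at 0)"
    unfolding G_def
  proof (rule termdiffs_strong'[of d])
    fix z :: real assume "norm z < d"
    thus "summable (\<lambda>n. c n * z ^ n)" using d(2)[rule_format, of "x + z"] by simp
  qed (use d(1) in simp)
  then obtain D where "(G has_field_derivative D) (at (x + - x))" by auto
  hence "((\<lambda>t. G (t - x)) has_field_derivative D) (at x)"
    by (subst (asm) DERIV_shift) simp
  hence der: "((\<lambda>t. G (t - x)) has_field_derivative D) (at x within S)"
    by (rule has_field_derivative_at_within)
  have eq: "G (t - x) = f t" if "t \<in> S" "dist t x < d" for t
    using d(3) that unfolding G_def by (auto simp: dist_real_def intro: sums_unique[symmetric])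
  show ?thesis
    using has_field_derivative_transform_within[OF der d(1) x(1) eq] by blast
qed

lemma connected_interval_islimpt:
  fixes S :: "real set"
  assumes "connected S" "a \<in> S" "b \<in> S" "a \<noteq> b" "x \<in> S"
  shows "x islimpt S"
  using connected_imp_perfect[of S x] assms by blast

text \<open>An analytic branch whose values are always among those of finitely many increasing functions is
  increasing, although it may switch between these functions. If its derivative were negative at \<open>x\<close>, one
  of the increasing functions would agree with it at points accumulating at \<open>x\<close> from the right, and along
  these points the branch decreases.\<close>

lemma real_analytic_mono_of_mono_cover:
  fixes f :: "real \<Rightarrow> real"
  assumes f: "real_analytic_on f {0..}" and J: "finite J"
    and e: "\<And>j s t. j \<in> J \<Longrightarrow> 0 \<le> s \<Longrightarrow> s \<le> t \<Longrightarrow> e j s \<le> e j t"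
    and cover: "\<And>t. 0 \<le> t \<Longrightarrow> \<exists>j\<in>J. f t = e j t"
    and st: "0 \<le> s" "s \<le> t"
  shows "f s \<le> f t"
proof (rule ccontr)
  assume "\<not> f s \<le> f t"
  hence less: "f t < f s" and "s < t" using st by (auto simp: order_le_less)
  have der: "\<exists>D. (f has_real_derivative D) (at x within {0..})" if "0 \<le> x" for x
    by (rule real_analytic_on_has_derivative[OF f])
      (use that connected_interval_islimpt[of "{0..}" 0 1 x] in auto)
  have diff: "f differentiable (at x)" if x: "0 < x" for x
  proof -
    obtain D where "(f has_real_derivative D) (at x within {0..})" using der[of x] x by auto
    moreover have "at x within {0..} = at x" using x by (intro at_within_interior) simp
    ultimately show ?thesis by (auto simp: real_differentiable_def)
  qed
  have "continuous_on {s..t} f"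
  proof (rule continuous_on_subset)
    show "continuous_on {0..} f"
      using der DERIV_continuous unfolding continuous_on_eq_continuous_within by (metis atLeast_iff)
  qed (use st in auto)
  from MVT[OF \<open>s < t\<close> this] diff st obtain D x where x: "s < x" "x < t"
    and D: "DERIV f x :> D" and eq: "f t - f s = (t - s) * D"
    by force
  have "D < 0" using eq less \<open>s < t\<close> by (metis diff_less_0_iff_less mult_less_0_iff not_less_iff_gr_or_eq)
  then obtain d where d: "0 < d" "\<And>h. 0 < h \<Longrightarrow> h < d \<Longrightarrow> f (x + h) < f x"
    using DERIV_neg_dec_right[OF D] by (metis)
  define A where "A = (\<lambda>j. {u \<in> {x<..<x + d}. f u = e j u})"
  have "(\<Union>j\<in>J. A j) = {x<..<x + d}" using cover st x by (fastforce simp: A_def)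
  moreover have "x islimpt {x<..<x + d}" using d(1) by (simp add: islimpt_greaterThanLessThan1)
  ultimately have "\<exists>j\<in>J. x islimpt A j" using islimpt_finite_union_iff[OF J, of x A] by simp
  then obtain j where j: "j \<in> J" "x islimpt A j" by blast
  obtain u where u: "u \<in> A j" using j(2) by (auto simp: islimpt_approachable dest: spec[of _ 1])
  have fu: "f u < f x" "x < u" using u d(2)[of "u - x"] by (auto simp: A_def)
  have "isCont f x" using D by (rule DERIV_isCont)
  then obtain \<delta> where \<delta>: "0 < \<delta>" "\<And>y. dist y x < \<delta> \<Longrightarrow> dist (f y) (f x) < f x - f u"
    unfolding continuous_at_eps_delta using fu by (metis diff_gt_0_iff_gt)
  obtain y where y: "y \<in> A j" "y \<noteq> x" "dist y x < min \<delta> (u - x)"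
    using j(2) \<delta>(1) fu(2) unfolding islimpt_approachable by (metis diff_gt_0_iff_gt min_less_iff_conj)
  have "f u < f y" using \<delta>(2)[of y] y(3) by (auto simp: dist_real_def abs_if split: if_splits)
  moreover have "y \<le> u" "0 \<le> y" using y x st by (auto simp: dist_real_def A_def)
  hence "e j y \<le> e j u" using e[OF j(1)] by simp
  ultimately show False using y(1) u by (simp add: A_def)
qed

text \<open>At each \<open>t\<close> some permutation matches the two families. There are finitely many permutations, so one of them
  works at points accumulating inside the interval and hence, by the identity theorem, everywhere.\<close>

lemma analytic_families_match:
  fixes b \<beta> :: "nat \<Rightarrow> real \<Rightarrow> real"
  assumes b: "\<And>i. i < n \<Longrightarrow> real_analytic_on (b i) {u<..<v}"
    and \<beta>: "\<And>i. i < n \<Longrightarrow> real_analytic_on (\<beta> i) {u<..<v}" and uv: "u < v"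
    and eq: "\<And>t. u < t \<Longrightarrow> t < v \<Longrightarrow>
      image_mset (\<lambda>i. b i t) (mset_set {..<n}) = image_mset (\<lambda>i. \<beta> i t) (mset_set {..<n})"
  shows "\<exists>p. p permutes {..<n} \<and> (\<forall>i<n. \<forall>t\<in>{u<..<v}. b i t = \<beta> (p i) t)"
proof -
  define P where "P = {p. p permutes {..<n}}"
  define A where "A = (\<lambda>p. {t \<in> {u<..<v}. \<forall>i<n. b i t = \<beta> (p i) t})"
  have finP: "finite P" unfolding P_def by (rule finite_permutations) simp
  have "\<exists>p\<in>P. t \<in> A p" if t: "t \<in> {u<..<v}" for t
  proof -
    obtain p where "p permutes {..<n}" "\<forall>x\<in>{..<n}. b x t = \<beta> (p x) t"
      using image_mset_eq_implies_permutes[OF finite_lessThan eq] t by (metis greaterThanLessThan_iff)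
    thus ?thesis using t by (auto simp: P_def A_def)
  qed
  hence "(\<Union>p\<in>P. A p) = {u<..<v}" by (auto simp: A_def)
  moreover define x where "x = (u + v) / 2"
  have x: "x \<in> {u<..<v}" using uv by (auto simp: x_def field_simps)
  have "x islimpt {u<..<v}"
    using connected_interval_islimpt[of "{u<..<v}" x "(u + x) / 2" x] x by (auto simp: field_simps)
  ultimately have "\<exists>p\<in>P. x islimpt A p" using islimpt_finite_union_iff[OF finP, of x A] by simp
  then obtain p where p: "p permutes {..<n}" "x islimpt A p" by (auto simp: P_def)
  have "b i t = \<beta> (p i) t" if i: "i < n" and t: "t \<in> {u<..<v}" for i t
  proof (rule real_analytic_identity[OF b[OF i] \<beta>])
    show "p i < n" using permutes_in_image[OF p(1), of i] i by simp
    show "x islimpt {t \<in> {u<..<v}. b i t = \<beta> (p i) t}"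
      using p(2) by (rule islimpt_subset) (use i in \<open>auto simp: A_def\<close>)
  qed (use x t in auto)
  thus ?thesis using p(1) by blast
qed

definition represents :: "nat \<Rightarrow> (real \<Rightarrow> real multiset) \<Rightarrow> (nat \<Rightarrow> real \<Rightarrow> real) \<Rightarrow> real set \<Rightarrow> bool" where
  "represents n M b I \<longleftrightarrow> (\<forall>i<n. real_analytic_on (b i) I) \<and>
     (\<forall>t\<in>I. image_mset (\<lambda>i. b i t) (mset_set {..<n}) = M t)"

lemma represents_extend:
  assumes b: "represents n M b {0..<R}" and R: "0 < R" and r: "0 < r"
    and \<beta>: "\<And>i. i < n \<Longrightarrow> real_analytic_on (\<beta> i) {R - r<..<R + r}"
      "\<And>t. 0 \<le> t \<Longrightarrow> \<bar>t - R\<bar> < r \<Longrightarrow> image_mset (\<lambda>i. \<beta> i t) (mset_set {..<n}) = M t"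
  shows "\<exists>b'. represents n M b' {0..<R + r} \<and> (\<forall>i<n. \<forall>t\<in>{0..<R}. b' i t = b i t)"
proof -
  \<comment> \<open>The two families are compared on the overlap \<open>(u,R)\<close>.\<close>
  define u where "u = max 0 (R - r)"
  have u: "0 \<le> u" "u < R" "R - r \<le> u" using R r by (auto simp: u_def)
  have "\<exists>p. p permutes {..<n} \<and> (\<forall>i<n. \<forall>t\<in>{u<..<R}. b i t = \<beta> (p i) t)"
  proof (rule analytic_families_match[OF _ _ u(2)])
    fix i assume i: "i < n"
    show "real_analytic_on (b i) {u<..<R}"
      using b i u by (auto simp: represents_def intro: real_analytic_on_subset)
    show "real_analytic_on (\<beta> i) {u<..<R}"
      using \<beta>(1)[OF i] by (rule real_analytic_on_subset) (use u r in auto)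
  next
    fix t assume t: "u < t" "t < R"
    thus "image_mset (\<lambda>i. b i t) (mset_set {..<n}) = image_mset (\<lambda>i. \<beta> i t) (mset_set {..<n})"
      using b \<beta>(2)[of t] u by (auto simp: represents_def)
  qed
  then obtain p where p: "p permutes {..<n}" "\<And>i t. i < n \<Longrightarrow> t \<in> {u<..<R} \<Longrightarrow> b i t = \<beta> (p i) t"
    by blast
  define b' where "b' = (\<lambda>i t. if t < R then b i t else \<beta> (p i) t)"
  have pn: "p i < n" if "i < n" for i using permutes_in_image[OF p(1), of i] that by simp
  have b'_eq: "b' i t = \<beta> (p i) t" if "i < n" "u < t" for i t
    using that p(2)[of i t] by (auto simp: b'_def)
  have "real_analytic_on (b' i) {0..<R + r}" if i: "i < n" for i
  proof (rule real_analytic_on_local)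
    fix x assume x: "x \<in> {0..<R + r}"
    show "\<exists>e>0. \<exists>g. real_analytic_on g ({0..<R + r} \<inter> ball x e) \<and> (\<forall>t\<in>{0..<R + r} \<inter> ball x e. b' i t = g t)"
    proof (cases "x < R")
      case True
      have "{0..<R + r} \<inter> ball x (R - x) \<subseteq> {0..<R}" by (auto simp: dist_real_def)
      moreover have "real_analytic_on (b i) {0..<R}" using b i by (simp add: represents_def)
      moreover have "\<forall>t\<in>{0..<R + r} \<inter> ball x (R - x). b' i t = b i t"
        by (auto simp: b'_def dist_real_def)
      ultimately show ?thesis using True real_analytic_on_subset
        by (intro exI[of _ "R - x"] conjI exI[of _ "b i"]) auto
    next
      case False
      have "{0..<R + r} \<inter> ball x (x - u) \<subseteq> {R - r<..<R + r}" using u by (auto simp: dist_real_def)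
      moreover have "\<forall>t\<in>{0..<R + r} \<inter> ball x (x - u). b' i t = \<beta> (p i) t"
        using b'_eq[OF i] by (auto simp: dist_real_def)
      ultimately show ?thesis using False u(2) real_analytic_on_subset[OF \<beta>(1)[OF pn[OF i]]]
        by (intro exI[of _ "x - u"] conjI exI[of _ "\<beta> (p i)"]) auto
    qed
  qed
  moreover have "image_mset (\<lambda>i. b' i t) (mset_set {..<n}) = M t" if t: "t \<in> {0..<R + r}" for t
  proof (cases "t < R")
    case True
    thus ?thesis using b t by (auto simp: represents_def b'_def)
  next
    case False
    have "image_mset (\<lambda>i. b' i t) (mset_set {..<n}) = image_mset (\<lambda>i. \<beta> i t) (image_mset p (mset_set {..<n}))"
      using False by (simp add: b'_def image_mset.compositionality o_def)
    also have "image_mset p (mset_set {..<n}) = mset_set {..<n}" using p(1) by (rule permutes_image_mset)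
    finally show ?thesis using \<beta>(2)[of t] t False by simp
  qed
  ultimately show ?thesis
    by (intro exI[of _ b']) (auto simp: represents_def b'_def)
qed

text \<open>The family chosen near \<open>0\<close> has at most one analytic continuation to any interval \<open>[0,R)\<close>. So
  the continuations for different \<open>R\<close> are compatible, and by \<open>represents_extend\<close> the supremum of the possible
  \<open>R\<close> cannot be finite.\<close>

theorem local_analytic_branches_glue:
  fixes M :: "real \<Rightarrow> real multiset"
  assumes H: "\<And>s. 0 \<le> s \<Longrightarrow> \<exists>r>0. \<exists>\<beta>. (\<forall>i<n. real_analytic_on (\<beta> i) {s - r<..<s + r}) \<and>
     (\<forall>t. 0 \<le> t \<and> \<bar>t - s\<bar> < r \<longrightarrow> image_mset (\<lambda>i. \<beta> i t) (mset_set {..<n}) = M t)"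
  shows "\<exists>b. represents n M b {0..}"
proof -
  obtain r0 \<beta>0 where r0: "0 < r0" and \<beta>0': "\<forall>i<n. real_analytic_on (\<beta>0 i) {0 - r0<..<0 + r0}"
    "\<forall>t. 0 \<le> t \<and> \<bar>t - 0\<bar> < r0 \<longrightarrow> image_mset (\<lambda>i. \<beta>0 i t) (mset_set {..<n}) = M t"
    using H[OF order_refl] by blast
  have \<beta>0: "\<And>i. i < n \<Longrightarrow> real_analytic_on (\<beta>0 i) {- r0<..<r0}"
    "\<And>t. 0 \<le> t \<Longrightarrow> \<bar>t\<bar> < r0 \<Longrightarrow> image_mset (\<lambda>i. \<beta>0 i t) (mset_set {..<n}) = M t"
    using \<beta>0' by auto
  define ok where "ok = (\<lambda>R b. represents n M b {0..<R} \<and> (\<forall>i<n. \<forall>t\<in>{0..<r0}. b i t = \<beta>0 i t))"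
  define T where "T = {R. r0 \<le> R \<and> (\<exists>b. ok R b)}"
  define c where "c = (\<lambda>R. SOME b. ok R b)"
  have c: "ok R (c R)" if "R \<in> T" for R
  proof -
    have "\<exists>b. ok R b" using that by (simp add: T_def)
    thus ?thesis unfolding c_def by (rule someI_ex)
  qed
  have "real_analytic_on (\<beta>0 i) {0..<r0}" if "i < n" for i
    using \<beta>0(1)[OF that] by (rule real_analytic_on_subset) (use r0 in auto)
  hence "ok r0 \<beta>0"
    using \<beta>0(2) by (auto simp: ok_def represents_def)
  hence r0T: "r0 \<in> T" by (auto simp: T_def)
  \<comment> \<open>Any two continuations agree with \<open>\<beta>0\<close> on \<open>[0,r0)\<close>, so the identity theorem applies.\<close>
  have unique: "c R i t = c R' i t" if "R \<in> T" "R' \<in> T" "i < n" "0 \<le> t" "t < R" "t < R'" for R R' i t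
  proof (rule real_analytic_identity[of "c R i" "{0..<min R R'}" "c R' i" 0 t])
    have "r0 \<le> R" "r0 \<le> R'" using that by (auto simp: T_def)
    show "real_analytic_on (c R i) {0..<min R R'}" "real_analytic_on (c R' i) {0..<min R R'}"
      using c[OF that(1)] c[OF that(2)] that(3)
      by (auto simp: ok_def represents_def intro: real_analytic_on_subset)
    show "0 \<in> {0..<min R R'}" using \<open>r0 \<le> R\<close> \<open>r0 \<le> R'\<close> r0 by auto
    have "0 islimpt {0..<r0}"
      using connected_interval_islimpt[of "{0..<r0}" 0 "r0/2" 0] r0 by auto
    thus "0 islimpt {t \<in> {0..<min R R'}. c R i t = c R' i t}"
      by (rule islimpt_subset)
        (use c[OF that(1)] c[OF that(2)] that(3) \<open>r0 \<le> R\<close> \<open>r0 \<le> R'\<close> in \<open>auto simp: ok_def\<close>)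
  qed (use that in auto)
  define B where "B = (\<lambda>i t. c (SOME R. R \<in> T \<and> t < R) i t)"
  have B_eq: "B i t = c R i t" if "R \<in> T" "i < n" "0 \<le> t" "t < R" for R i t
  proof -
    have "(SOME R. R \<in> T \<and> t < R) \<in> T \<and> t < (SOME R. R \<in> T \<and> t < R)"
      by (rule someI[of _ R]) (use that in simp)
    thus ?thesis unfolding B_def using unique that by blast
  qed
  have B_rep: "represents n M B I" if I: "\<And>t. t \<in> I \<Longrightarrow> 0 \<le> t \<and> (\<exists>R\<in>T. t < R)" for I
    unfolding represents_def
  proof (intro conjI allI ballI impI)
    fix i assume i: "i < n"
    show "real_analytic_on (B i) I"
    proof (rule real_analytic_on_local)
      fix x assume x: "x \<in> I"
      then obtain R where R: "R \<in> T" "x < R" "0 \<le> x" using I by blast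
      have sub: "I \<inter> ball x (R - x) \<subseteq> {0..<R}" using I by (auto simp: dist_real_def)
      moreover have "real_analytic_on (c R i) {0..<R}" using c[OF R(1)] i by (auto simp: ok_def represents_def)
      moreover have "\<forall>t\<in>I \<inter> ball x (R - x). B i t = c R i t"
        using sub B_eq[OF R(1) i] by (auto simp: subset_iff)
      ultimately show "\<exists>e>0. \<exists>g. real_analytic_on g (I \<inter> ball x e) \<and> (\<forall>t\<in>I \<inter> ball x e. B i t = g t)"
        using R(2) real_analytic_on_subset by (intro exI[of _ "R - x"] conjI exI[of _ "c R i"]) auto
    qed
  next
    fix t assume t: "t \<in> I"
    then obtain R where R: "R \<in> T" "t < R" "0 \<le> t" using I by blast
    have "image_mset (\<lambda>i. B i t) (mset_set {..<n}) = image_mset (\<lambda>i. c R i t) (mset_set {..<n})"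
      by (rule image_mset_cong) (use B_eq[OF R(1) _ R(3,2)] in auto)
    thus "image_mset (\<lambda>i. B i t) (mset_set {..<n}) = M t"
      using c[OF R(1)] R by (auto simp: ok_def represents_def)
  qed
  have "\<exists>R\<in>T. t < R" for t
  proof (rule ccontr)
    assume "\<not> ?thesis"
    hence bdd: "bdd_above T" by (intro bdd_aboveI[of _ t]) (auto simp: not_less)
    define R where "R = Sup T"
    have R: "r0 \<le> R" unfolding R_def using r0T bdd by (rule cSup_upper)
    have lt: "\<exists>R'\<in>T. t < R'" if "t < R" for t
      using that less_cSup_iff[OF _ bdd, of t] r0T unfolding R_def by blast
    have rep: "represents n M B {0..<R}" using lt by (intro B_rep) auto
    have R0: "0 < R" using R r0 by simp
    obtain r \<beta> where r: "0 < r" "\<forall>i<n. real_analytic_on (\<beta> i) {R - r<..<R + r}"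
      "\<forall>t. 0 \<le> t \<and> \<bar>t - R\<bar> < r \<longrightarrow> image_mset (\<lambda>i. \<beta> i t) (mset_set {..<n}) = M t"
      using H[OF less_imp_le[OF R0]] by blast
    have "\<exists>b'. represents n M b' {0..<R + r} \<and> (\<forall>i<n. \<forall>t\<in>{0..<R}. b' i t = B i t)"
      by (rule represents_extend[OF rep R0 r(1), of \<beta>]) (use r(2,3) in auto)
    then obtain b' where b': "represents n M b' {0..<R + r}" "\<And>i t. i < n \<Longrightarrow> t \<in> {0..<R} \<Longrightarrow> b' i t = B i t"
      by blast
    have "b' i t = \<beta>0 i t" if "i < n" "t \<in> {0..<r0}" for i t
      using b'(2)[of i t] that R B_eq[OF r0T, of i t] c[OF r0T] by (auto simp: ok_def)
    hence "R + r \<in> T" using b'(1) R r(1) by (auto simp: T_def ok_def)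
    hence "R + r \<le> R" unfolding R_def using bdd by (rule cSup_upper)
    thus False using r(1) by simp
  qed
  thus ?thesis using B_rep[of "{0..}"] by auto
qed

section \<open>Rellich's theorem for symmetric matrices\<close>

text \<open>A multiset of reals is determined by the monic polynomial with these roots.\<close>

lemma mset_eq_if_root_products_eq:
  fixes X Y :: "real multiset"
  assumes "\<And>z::real. (\<Prod>x\<in>#X. z - x) = (\<Prod>x\<in>#Y. z - x)"
  shows "X = Y"
proof -
  define p where "p = (\<lambda>X. \<Prod>x\<in>#X. [:-x, 1::real:])"
  have nz: "p X \<noteq> 0" for X by (auto simp: p_def prod_mset_zero_iff)
  have roots: "proots (p X) = X" for X
  proof (induction X)
    case (add x X)
    have "p (add_mset x X) = [:-x, 1:] * p X" by (simp add: p_def)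
    moreover have "proots ([:-x, 1:] * p X) = proots [:-x, 1:] + proots (p X)"
      by (rule proots_mult) (use nz[of X] in simp_all)
    ultimately show ?case using add by (simp only: proots_linear_factor) simp
  qed (simp add: p_def)
  have "poly (p X) z = (\<Prod>x\<in>#X. z - x)" for X z
    unfolding p_def by (induction X) (auto simp: left_diff_distrib)
  hence "poly (p X) z = poly (p Y) z" for z using assms by simp
  hence "p X = p Y" by (simp add: poly_eq_poly_eq_iff[symmetric] fun_eq_iff)
  thus ?thesis using roots by metis
qed

definition char_poly_on :: "'n::finite set \<Rightarrow> ('n \<Rightarrow> 'n \<Rightarrow> complex) \<Rightarrow> complex poly" where
  "char_poly_on A m = det (\<chi> i j. if i \<in> A \<and> j \<in> A then [:- m i j, if i = j then 1 else 0:]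
                                  else if i = j then 1 else 0)"

text \<open>Both sides agree at all real numbers by \<open>eigenbasis_det\<close>, hence as polynomials.\<close>

lemma poly_char_poly_on:
  fixes M :: "real^'n::finite^'n"
  assumes eb: "eigenbasis A M f d"
  shows "char_poly_on A (\<lambda>i j. of_real (M $ i $ j)) = (\<Prod>i\<in>A. [:- of_real (d i), 1:])"
proof -
  have "poly (char_poly_on A (\<lambda>i j. of_real (M $ i $ j))) (of_real z) =
      of_real (\<Prod>i\<in>A. z - d i)" for z :: real
    unfolding eigenbasis_det[OF eb, symmetric] char_poly_on_def det_def
    by (auto simp: poly_sum poly_prod intro!: sum.cong prod.cong)
  hence "poly (char_poly_on A (\<lambda>i j. of_real (M $ i $ j)) - (\<Prod>i\<in>A. [:- of_real (d i), 1:])) (of_real z) = 0"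
    for z :: real by (simp add: poly_prod)
  hence "range of_real \<subseteq> {z. poly (char_poly_on A (\<lambda>i j. of_real (M $ i $ j)) - (\<Prod>i\<in>A. [:- of_real (d i), 1:])) z = 0}"
    by blast
  moreover have "infinite (range (of_real :: real \<Rightarrow> complex))"
    using finite_imageD[OF _ inj_of_real] infinite_UNIV_char_0 by blast
  ultimately have "infinite {z. poly (char_poly_on A (\<lambda>i j. of_real (M $ i $ j)) - (\<Prod>i\<in>A. [:- of_real (d i), 1:])) z = 0}"
    using finite_subset by blast
  hence "char_poly_on A (\<lambda>i j. of_real (M $ i $ j)) - (\<Prod>i\<in>A. [:- of_real (d i), 1:]) = 0"
    using poly_roots_finite by blast
  thus ?thesis by simp
qed

lemma real_germ_coeff_sum:
  "(\<And>i. i \<in> I \<Longrightarrow> real_germ (\<lambda>t. coeff (P i t) k) s) \<Longrightarrow> real_germ (\<lambda>t. coeff (\<Sum>i\<in>I. P i t) k) s"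
  by (simp add: coeff_sum real_germ_sum)

lemma real_germ_coeff_prod:
  "(\<And>i k. i \<in> I \<Longrightarrow> real_germ (\<lambda>t. coeff (P i t) k) s) \<Longrightarrow> real_germ (\<lambda>t. coeff (\<Prod>i\<in>I. P i t) k) s"
proof (induction I arbitrary: k rule: infinite_finite_induct)
  case (insert x F)
  thus ?case by (auto simp: coeff_mult intro!: real_germ_sum real_germ_mult)
qed (simp_all add: real_germ_const)

lemma real_germ_char_poly_on:
  assumes "\<And>i j. real_germ (m i j) s"
  shows "real_germ (\<lambda>t. coeff (char_poly_on A (\<lambda>i j. m i j t)) k) s"
  unfolding char_poly_on_def det_def
proof (rule real_germ_coeff_sum)
  fix p :: "'a \<Rightarrow> 'a"
  have entry: "real_germ (\<lambda>t. coeff (if i \<in> A \<and> j \<in> A then [:- m i j t, if i = j then 1 else 0:]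
                                  else if i = j then 1 else 0) k) s" for i j k
  proof (cases "i \<in> A \<and> j \<in> A \<and> k = 0")
    case True
    have "real_germ (\<lambda>t. 0 - m i j t) s" by (intro real_germ_intros assms) simp
    thus ?thesis using True by simp
  next
    case False
    hence "(\<lambda>t. coeff (if i \<in> A \<and> j \<in> A then [:- m i j t, if i = j then 1 else 0:]
                                  else if i = j then 1 else 0) k) =
        (\<lambda>t. coeff (if i \<in> A \<and> j \<in> A then [:0, if i = j then 1 else 0:]
                                  else if i = j then 1 else 0) k)"
      by (cases k) auto
    moreover have "coeff (if i \<in> A \<and> j \<in> A then [:0, if i = j then 1 else 0:]
                                  else if i = j then 1 else (0 :: complex poly)) k \<in> \<real>"
      by (cases k) (auto simp: coeff_pCons split: nat.splits)
    ultimately show ?thesis by (simp only: real_germ_const)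
  qed
  have "real_germ (\<lambda>t. coeff (\<Prod>i\<in>UNIV. if i \<in> A \<and> p i \<in> A then [:- m i (p i) t, if i = p i then 1 else 0:]
                                  else if i = p i then 1 else 0) k) s" for k
    by (rule real_germ_coeff_prod) (rule entry)
  hence "real_germ (\<lambda>t. of_int (sign p) * coeff (\<Prod>i\<in>UNIV. if i \<in> A \<and> p i \<in> A then [:- m i (p i) t, if i = p i then 1 else 0:]
                                  else if i = p i then 1 else 0) k) s"
    by (intro real_germ_mult real_germ_const) auto
  thus "real_germ (\<lambda>t. coeff (of_int (sign p) * (\<Prod>i\<in>UNIV. (\<chi> i j. if i \<in> A \<and> j \<in> A
            then [:- m i j t, if i = j then 1 else 0:] else if i = j then 1 else 0) $ i $ p i)) k) s"
    by (simp add: of_int_poly)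
qed

text \<open>Rellich's theorem for the eigenvalues. The characteristic polynomials have analytic coefficients and
  only real roots, so \<open>local_analytic_factorization\<close> applies at every point. The holomorphic functions \<open>m i j\<close>
  extend the matrix entries to complex arguments.\<close>

theorem analytic_symmetric_family_branches:
  fixes M :: "real \<Rightarrow> real^'n::finite^'n"
  assumes germ: "\<And>s i j. 0 \<le> s \<Longrightarrow> real_germ (m i j) s"
    and M: "\<And>s. 0 \<le> s \<Longrightarrow> \<forall>\<^sub>F t in nhds s. symmetric_matrix (M t) \<and> (\<forall>i j. m i j (of_real t) = of_real (M t $ i $ j))"
  shows "\<exists>b. represents (card A) (\<lambda>t. eigenvalue_mset A (M t)) b {0..}"
proof (rule local_analytic_branches_glue)
  fix s :: real assume s: "0 \<le> s"
  define n where "n = card A"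
  define P where "P = (\<lambda>t. char_poly_on A (\<lambda>i j. m i j t))"
  \<comment> \<open>The leading coefficient of \<open>P t\<close> is known to be one only for real \<open>t\<close>, so it is put in by hand.\<close>
  define a where "a = (\<lambda>k t. if k = n then 1 else coeff (P t) k)"
  have agerm: "real_germ (a k) s" if "k \<le> n" for k
    by (cases "k = n") (simp_all add: a_def P_def real_germ_const real_germ_char_poly_on germ s)
  have a_ev: "\<exists>D. size D = n \<and> eigenvalue_mset A (M t) = D \<and>
      (\<forall>z. (\<Sum>k\<le>n. a k (of_real t) * z ^ k) = (\<Prod>x\<in>#D. z - of_real x))"
    if t: "symmetric_matrix (M t) \<and> (\<forall>i j. m i j (of_real t) = of_real (M t $ i $ j))" for t
  proof -
    obtain f d where eb: "eigenbasis A (M t) f d" using eigenbasis_exists t by blast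
    have Pt: "P (of_real t) = (\<Prod>i\<in>A. [:- of_real (d i), 1:])"
      unfolding P_def poly_char_poly_on[OF eb, symmetric] using t by simp
    have deg: "degree (P (of_real t)) = n"
      unfolding Pt n_def by (subst degree_prod_sum_eq) auto
    have "lead_coeff (P (of_real t)) = 1" unfolding Pt by (simp add: lead_coeff_prod)
    hence "a k (of_real t) = coeff (P (of_real t)) k" for k using deg by (auto simp: a_def)
    hence ev: "(\<Sum>k\<le>n. a k (of_real t) * z ^ k) = poly (P (of_real t)) z" for z
      by (simp add: poly_altdef deg)
    have "(\<Sum>k\<le>n. a k (of_real t) * z ^ k) = (\<Prod>x\<in>#image_mset d (mset_set A). z - of_real x)" for z
    proof -
      have "poly (P (of_real t)) z = (\<Prod>i\<in>A. z - of_real (d i))" unfolding Pt by (simp add: poly_prod)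
      also have "\<dots> = (\<Prod>x\<in>#image_mset d (mset_set A). z - of_real x)"
        by (simp add: prod_unfold_prod_mset image_mset.compositionality o_def)
      finally show ?thesis using ev[of z] by simp
    qed
    thus ?thesis using eigenbasis_eigenvalue_mset[OF eb] t by (intro exI[of _ "image_mset d (mset_set A)"]) (simp add: n_def)
  qed
  have real_rooted: "\<forall>\<^sub>F t in nhds s. \<forall>z. (\<Sum>k\<le>n. a k (of_real t) * z ^ k) = 0 \<longrightarrow> z \<in> \<real>"
    using M[OF s]
  proof eventually_elim
    case (elim t)
    from a_ev[OF this] obtain D where
      "\<And>z. (\<Sum>k\<le>n. a k (of_real t) * z ^ k) = (\<Prod>x\<in>#D. z - of_real x)" by blast
    thus ?case by (auto simp: prod_mset_zero_iff)
  qed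
  have "a n = (\<lambda>_. 1)" by (simp add: a_def)
  from local_analytic_factorization[OF agerm this real_rooted]
  obtain \<rho> where \<rho>: "\<And>i. i < n \<Longrightarrow> real_germ (\<rho> i) s"
    "\<forall>\<^sub>F t in nhds (of_real s). \<forall>z. (\<Sum>k\<le>n. a k t * z ^ k) = (\<Prod>i<n. z - \<rho> i t)" by blast
  define \<beta> where "\<beta> = (\<lambda>i t. Re (\<rho> i (of_real t)))"
  have "\<exists>r>0. real_analytic_on (\<beta> i) {s - r<..<s + r} \<and>
           (\<forall>t. \<bar>t - s\<bar> < r \<longrightarrow> \<rho> i (of_real t) = of_real (\<beta> i t))" if "i < n" for i
    unfolding \<beta>_def by (rule real_germ_real_analytic[OF \<rho>(1)[OF that]])
  then obtain r where r: "\<And>i. i < n \<Longrightarrow> 0 < r i" "\<And>i. i < n \<Longrightarrow> real_analytic_on (\<beta> i) {s - r i<..<s + r i}"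
    "\<And>i t. i < n \<Longrightarrow> \<bar>t - s\<bar> < r i \<Longrightarrow> \<rho> i (of_real t) = of_real (\<beta> i t)"
    by metis
  have "\<forall>\<^sub>F t in nhds s. symmetric_matrix (M t) \<and> (\<forall>i j. m i j (of_real t) = of_real (M t $ i $ j)) \<and>
      (\<forall>z. (\<Sum>k\<le>n. a k (of_real t) * z ^ k) = (\<Prod>i<n. z - \<rho> i (of_real t)))"
    using M[OF s] eventually_nhds_of_real[OF \<rho>(2)] by eventually_elim auto
  then obtain e where e: "0 < e" "\<And>t. dist t s < e \<Longrightarrow> symmetric_matrix (M t) \<and> (\<forall>i j. m i j (of_real t) = of_real (M t $ i $ j)) \<and>
      (\<forall>z. (\<Sum>k\<le>n. a k (of_real t) * z ^ k) = (\<Prod>i<n. z - \<rho> i (of_real t)))"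
    unfolding eventually_nhds_metric by blast
  define R where "R = Min (insert e (r ` {..<n}))"
  have R: "0 < R" "R \<le> e" "\<And>i. i < n \<Longrightarrow> R \<le> r i"
    using e(1) r(1) by (auto simp: R_def)
  have "image_mset (\<lambda>i. \<beta> i t) (mset_set {..<n}) = eigenvalue_mset A (M t)" if t: "\<bar>t - s\<bar> < R" for t
  proof -
    have et: "symmetric_matrix (M t) \<and> (\<forall>i j. m i j (of_real t) = of_real (M t $ i $ j))"
      "\<And>z. (\<Sum>k\<le>n. a k (of_real t) * z ^ k) = (\<Prod>i<n. z - \<rho> i (of_real t))"
      using e(2)[of t] t R(2) by (auto simp: dist_real_def)
    from a_ev[OF et(1)] obtain D where D: "eigenvalue_mset A (M t) = D"
      "\<And>z. (\<Sum>k\<le>n. a k (of_real t) * z ^ k) = (\<Prod>x\<in>#D. z - of_real x)" by blast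
    have "image_mset (\<lambda>i. \<beta> i t) (mset_set {..<n}) = D"
    proof (rule mset_eq_if_root_products_eq)
      fix z :: real
      have "(of_real (\<Prod>x\<in>#image_mset (\<lambda>i. \<beta> i t) (mset_set {..<n}). z - x) :: complex) =
          (\<Prod>i<n. of_real z - of_real (\<beta> i t))"
        by (simp add: image_mset.compositionality o_def prod_unfold_prod_mset[symmetric])
      also have "\<dots> = (\<Prod>i<n. of_real z - \<rho> i (of_real t))"
        by (rule prod.cong) (use r(3) R(3) t in \<open>force+\<close>)
      also have "\<dots> = (\<Prod>x\<in>#D. of_real z - of_real x)" using et(2) D(2) by metis
      also have "\<dots> = of_real (\<Prod>x\<in>#D. z - x)" by (induction D) auto
      finally show "(\<Prod>x\<in>#image_mset (\<lambda>i. \<beta> i t) (mset_set {..<n}). z - x) = (\<Prod>x\<in>#D. z - x)"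
        by (simp only: of_real_eq_iff)
    qed
    thus ?thesis using D(1) by simp
  qed
  moreover have "real_analytic_on (\<beta> i) {s - R<..<s + R}" if "i < n" for i
    using r(2)[OF that] by (rule real_analytic_on_subset) (use R(3)[OF that] in auto)
  ultimately show "\<exists>r>0. \<exists>\<beta>. (\<forall>i<card A. real_analytic_on (\<beta> i) {s - r<..<s + r}) \<and>
     (\<forall>t. 0 \<le> t \<and> \<bar>t - s\<bar> < r \<longrightarrow> image_mset (\<lambda>i. \<beta> i t) (mset_set {..<card A}) = eigenvalue_mset A (M t))"
    using R(1) unfolding n_def by blast
qed

section \<open>Quadratic forms on the subdivision graph\<close>

lemma sum_UNIV_sum_type:
  fixes f :: "'a::finite + 'b::finite \<Rightarrow> 'c::comm_monoid_add"
  shows "(\<Sum>x\<in>UNIV. f x) = (\<Sum>i\<in>UNIV. f (Inl i)) + (\<Sum>e\<in>UNIV. f (Inr e))"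
  by (subst UNIV_Plus_UNIV[symmetric], subst sum.Plus) simp_all

lemma laplacian_mult_vector:
  "(laplacian W *v u) $ x = (\<Sum>y\<in>UNIV. W x y * (u $ x - u $ y))"
proof -
  have "(laplacian W *v u) $ x = (\<Sum>y\<in>UNIV. (if x = y then (\<Sum>l\<in>UNIV. W x l) * u $ x else 0) - W x y * u $ y)"
    unfolding matrix_vector_mult_def laplacian_def
    by (simp add: left_diff_distrib) (rule sum.cong, auto)
  thus ?thesis by (simp add: sum_subtractf sum_distrib_right right_diff_distrib)
qed

lemma symmetric_sum_swap:
  fixes h :: "'a::finite \<Rightarrow> 'a \<Rightarrow> real"
  shows "(\<Sum>i\<in>UNIV. \<Sum>j\<in>UNIV. h i j) = (\<Sum>i\<in>UNIV. \<Sum>j\<in>UNIV. (h i j + h j i) / 2)"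
proof -
  have "(\<Sum>i\<in>UNIV. \<Sum>j\<in>UNIV. h j i) = (\<Sum>i\<in>UNIV. \<Sum>j\<in>UNIV. h i j)" by (rule sum.swap)
  thus ?thesis by (simp add: sum.distrib add_divide_distrib sum_divide_distrib[symmetric])
qed

lemma laplacian_form:
  assumes "\<And>x y. W x y = W y x"
  shows "u \<bullet> (laplacian W *v u) = (\<Sum>x\<in>UNIV. \<Sum>y\<in>UNIV. W x y * (u $ x - u $ y)\<^sup>2) / 2"
proof -
  have "u \<bullet> (laplacian W *v u) = (\<Sum>x\<in>UNIV. \<Sum>y\<in>UNIV. u $ x * (W x y * (u $ x - u $ y)))"
    by (simp add: inner_vec_def laplacian_mult_vector sum_distrib_left)
  also have "\<dots> = (\<Sum>x\<in>UNIV. \<Sum>y\<in>UNIV. W x y * (u $ x - u $ y)\<^sup>2 / 2)"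
    by (subst symmetric_sum_swap, intro sum.cong refl, subst (2) assms)
      (simp add: power2_eq_square algebra_simps)
  finally show ?thesis by (simp add: sum_divide_distrib)
qed

lemma symmetric_laplacian: "(\<And>x y. W x y = W y x) \<Longrightarrow> symmetric_matrix (laplacian W)"
  by (auto simp: symmetric_matrix_def laplacian_def)

locale signed_eigenvector =
  fixes w :: "'v::finite \<Rightarrow> 'v \<Rightarrow> real" and \<psi> :: "real^'v" and ev :: real
  assumes graph: "weighted_graph w" "connected_graph w"
    and nonzero: "\<And>i. \<psi> $ i \<noteq> 0"
    and eigenvector: "laplacian w *v \<psi> = ev *\<^sub>R \<psi>"
begin

abbreviation "sgn_edge i j \<equiv> (i, j) \<in> sign_edges w \<psi>"
abbreviation "q \<equiv> q_ratio \<psi>"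

lemma w_sym: "w i j = w j i" and w_nonneg: "0 \<le> w i j"
  using graph(1) by (auto simp: weighted_graph_def)

lemma sgn_edge_iff: "sgn_edge i j \<longleftrightarrow> 0 < w i j \<and> \<psi> $ i * \<psi> $ j < 0"
  by (auto simp: sign_edges_def edges_def)

lemma sgn_edge_sym: "sgn_edge i j = sgn_edge j i"
  by (simp add: sgn_edge_iff w_sym[of i j] mult.commute)

lemma q_pos: "sgn_edge i j \<Longrightarrow> 0 < q i j"
  by (auto simp: sgn_edge_iff q_ratio_def mult_less_0_iff divide_less_0_iff)

lemma q_inverse: "q j i = 1 / q i j"
  using nonzero[of i] nonzero[of j] by (simp add: q_ratio_def)

text \<open>The quadratic form of the Laplacian of the original graph, which ignores the values on ghosts.\<close>

definition dirichlet_energy :: "real^('v + 'v set) \<Rightarrow> real" where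
  "dirichlet_energy u = (\<Sum>i\<in>UNIV. \<Sum>j\<in>UNIV. w i j * (u $ Inl i - u $ Inl j)\<^sup>2) / 2"

text \<open>The factor of \<open>\<sigma> / (1 + \<sigma>)\<close> in the form of the subdivision graph: each sign-change edge is weakened and
  replaced by two edges through its ghost. An edge is counted once for each of its two orientations,
  so the weakened edge contributes one half to each.\<close>

definition ghost_energy :: "real^('v + 'v set) \<Rightarrow> real" where
  "ghost_energy u = (\<Sum>i\<in>UNIV. \<Sum>j\<in>UNIV. if sgn_edge i j then
     w i j * ((1 + q j i) * (u $ Inl i - u $ Inr {i, j})\<^sup>2 - (u $ Inl i - u $ Inl j)\<^sup>2 / 2) else 0)"

text \<open>With \<open>a\<close> and \<open>b\<close> the differences of the two end points to the ghost and \<open>q = q\<^sub>i\<^sub>j\<close>, the two half-edges and the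
  removed edge contribute \<open>(1 + 1/q) a\<^sup>2 + (1 + q) b\<^sup>2 - (a - b)\<^sup>2 = (a + q b)\<^sup>2 / q\<close>. This non-negativity makes
  the family increase with \<open>\<sigma>\<close>.\<close>

lemma ghost_energy_squares:
  "ghost_energy u = (\<Sum>i\<in>UNIV. \<Sum>j\<in>UNIV. if sgn_edge i j then
     w i j / q i j * ((u $ Inl i - u $ Inr {i, j}) + q i j * (u $ Inl j - u $ Inr {i, j}))\<^sup>2 else 0) / 2"
proof -
  \<comment> \<open>The two orientations of an edge add up to the square.\<close>
  have e: "(if sgn_edge i j then w i j * ((1 + q j i) * (u $ Inl i - u $ Inr {i, j})\<^sup>2 - (u $ Inl i - u $ Inl j)\<^sup>2 / 2) else 0)
     + (if sgn_edge j i then w j i * ((1 + q i j) * (u $ Inl j - u $ Inr {j, i})\<^sup>2 - (u $ Inl j - u $ Inl i)\<^sup>2 / 2) else 0)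
     = (if sgn_edge i j then
     w i j / q i j * ((u $ Inl i - u $ Inr {i, j}) + q i j * (u $ Inl j - u $ Inr {i, j}))\<^sup>2 else 0)" for i j
  proof (cases "sgn_edge i j")
    case True
    define a where "a = u $ Inl i - u $ Inr {i, j}"
    define b where "b = u $ Inl j - u $ Inr {i, j}"
    have ab: "u $ Inl i - u $ Inl j = a - b" "u $ Inl j - u $ Inl i = b - a" by (auto simp: a_def b_def)
    have qn: "q i j \<noteq> 0" using q_pos[OF True] by simp
    have ins: "{j, i} = {i, j}" by auto
    have "w i j * ((1 + 1 / q i j) * a\<^sup>2 - (a - b)\<^sup>2 / 2) + w i j * ((1 + q i j) * b\<^sup>2 - (b - a)\<^sup>2 / 2)
        = w i j / q i j * (a + q i j * b)\<^sup>2"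
      using qn by (simp add: field_simps power2_eq_square)
    thus ?thesis using True sgn_edge_sym[of i j]
      by (simp only: if_True ab ins q_inverse[of j i] w_sym[of j i] a_def[symmetric] b_def[symmetric])
  qed (simp add: sgn_edge_sym[of j i])
  show ?thesis unfolding ghost_energy_def
    by (subst symmetric_sum_swap) (simp only: e sum_divide_distrib)
qed

lemma dirichlet_energy_nonneg: "0 \<le> dirichlet_energy u"
  unfolding dirichlet_energy_def by (intro divide_nonneg_nonneg sum_nonneg mult_nonneg_nonneg w_nonneg) auto

lemma ghost_energy_nonneg: "0 \<le> ghost_energy u"
  unfolding ghost_energy_squares
  by (intro divide_nonneg_nonneg sum_nonneg) (auto intro!: divide_nonneg_pos mult_nonneg_nonneg w_nonneg q_pos)

lemma sub_weight_aux_sym: "sub_weight_aux w \<psi> a b x y = sub_weight_aux w \<psi> a b y x"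
  by (cases x; cases y) (auto simp: sgn_edge_sym w_sym)

text \<open>A sum over ghosts is turned into a sum over the other end points of the sign-change edges.\<close>

lemma sum_ghost_weight:
  "(\<Sum>e\<in>UNIV. ghost_weight w \<psi> i e * h e) =
     (\<Sum>j\<in>UNIV. if sgn_edge i j then w i j * (1 + q j i) * h {i, j} else 0)"
proof -
  have "(\<Sum>e\<in>UNIV. ghost_weight w \<psi> i e * h e) =
     (\<Sum>e\<in>UNIV. \<Sum>j\<in>UNIV. if sgn_edge i j \<and> e = {i, j} then w i j * (1 + q j i) * h {i, j} else 0)"
    unfolding ghost_weight_def sum_distrib_right
    by (rule sum.cong[OF refl], rule sum.mono_neutral_cong_left) auto
  also have "\<dots> = (\<Sum>j\<in>UNIV. \<Sum>e\<in>UNIV. if sgn_edge i j \<and> e = {i, j} then w i j * (1 + q j i) * h {i, j} else 0)"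
    by (rule sum.swap)
  also have "\<dots> = (\<Sum>j\<in>UNIV. if sgn_edge i j then w i j * (1 + q j i) * h {i, j} else 0)"
    by (intro sum.cong refl) (auto simp: sum.delta)
  finally show ?thesis .
qed

lemma sub_laplacian_form:
  "u \<bullet> (laplacian (sub_weight_aux w \<psi> (1 - t) t) *v u) = dirichlet_energy u + t * ghost_energy u"
proof -
  let ?W = "sub_weight_aux w \<psi> (1 - t) t"
  define G where "G = (\<Sum>i\<in>UNIV. \<Sum>j\<in>UNIV. if sgn_edge i j then w i j * (1 + q j i) * (u $ Inl i - u $ Inr {i, j})\<^sup>2 else 0)"
  define H where "H = (\<Sum>i\<in>UNIV. \<Sum>j\<in>UNIV. ?W (Inl i) (Inl j) * (u $ Inl i - u $ Inl j)\<^sup>2)"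
  have lr: "(\<Sum>i\<in>UNIV. \<Sum>e\<in>UNIV. ?W (Inl i) (Inr e) * (u $ Inl i - u $ Inr e)\<^sup>2) = t * G"
  proof -
    have "(\<Sum>e\<in>UNIV. ?W (Inl i) (Inr e) * (u $ Inl i - u $ Inr e)\<^sup>2) =
       t * (\<Sum>e\<in>UNIV. ghost_weight w \<psi> i e * (u $ Inl i - u $ Inr e)\<^sup>2)" for i
      by (simp add: sum_distrib_left mult.assoc)
    thus ?thesis unfolding sum_ghost_weight G_def by (simp add: sum_distrib_left)
  qed
  have rl: "(\<Sum>e\<in>UNIV. \<Sum>i\<in>UNIV. ?W (Inr e) (Inl i) * (u $ Inr e - u $ Inl i)\<^sup>2) = t * G"
    unfolding lr[symmetric] by (subst sum.swap) (simp add: power2_commute)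
  have "u \<bullet> (laplacian ?W *v u) = (H + t * G + t * G) / 2"
    by (subst laplacian_form[OF sub_weight_aux_sym], simp only: sum_UNIV_sum_type sum.distrib lr rl H_def)
      simp
  also have "\<dots> = H / 2 + t * G" by (simp add: field_simps)
  also have "H / 2 = dirichlet_energy u - t * (\<Sum>i\<in>UNIV. \<Sum>j\<in>UNIV. if sgn_edge i j then w i j * ((u $ Inl i - u $ Inl j)\<^sup>2 / 2) else 0)"
    unfolding H_def dirichlet_energy_def sum_divide_distrib sum_distrib_left sum_subtractf[symmetric]
    by (intro sum.cong refl) (auto simp: algebra_simps diff_divide_distrib)
  also have "\<dots> + t * G = dirichlet_energy u + t * (G - (\<Sum>i\<in>UNIV. \<Sum>j\<in>UNIV. if sgn_edge i j then w i j * ((u $ Inl i - u $ Inl j)\<^sup>2 / 2) else 0))"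
    by (simp add: algebra_simps)
  also have "G - (\<Sum>i\<in>UNIV. \<Sum>j\<in>UNIV. if sgn_edge i j then w i j * ((u $ Inl i - u $ Inl j)\<^sup>2 / 2) else 0) = ghost_energy u"
    unfolding G_def ghost_energy_def sum_subtractf[symmetric]
    by (intro sum.cong refl) (simp add: algebra_simps)
  finally show ?thesis .
qed

lemma B_matrix_component:
  "B_matrix w \<psi> \<sigma> $ x $ y = laplacian (sub_weight w \<psi> \<sigma>) $ x $ y + \<sigma> * (if x = y \<and> x \<in> ghosts w \<psi> then 1 else 0)"
proof -
  have "(\<Sum>z\<in>ghosts w \<psi>. axis x (1::real) $ z * axis y 1 $ z) = (\<Sum>z\<in>ghosts w \<psi>. if z = x then (if x = y then 1 else 0) else 0)"
    by (intro sum.cong) (auto simp: axis_def)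
  thus ?thesis
    by (simp add: B_matrix_def B_form_def matrix_vector_mult_basis inner_axis' column_def)
qed

lemma B_matrix_mult_vector:
  "(B_matrix w \<psi> \<sigma> *v u) $ x = (laplacian (sub_weight w \<psi> \<sigma>) *v u) $ x + \<sigma> * (if x \<in> ghosts w \<psi> then u $ x else 0)"
proof -
  have "(B_matrix w \<psi> \<sigma> *v u) $ x = (\<Sum>y\<in>UNIV. laplacian (sub_weight w \<psi> \<sigma>) $ x $ y * u $ y + (if x = y then \<sigma> * (if x \<in> ghosts w \<psi> then u $ x else 0) else 0))"
    unfolding matrix_vector_mult_def vec_lambda_beta
    by (intro sum.cong refl) (auto simp: B_matrix_component algebra_simps)
  thus ?thesis by (simp add: sum.distrib matrix_vector_mult_def)
qed

lemma symmetric_B_matrix: "symmetric_matrix (B_matrix w \<psi> \<sigma>)"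
proof -
  have "symmetric_matrix (laplacian (sub_weight w \<psi> \<sigma>))"
    unfolding sub_weight_def by (rule symmetric_laplacian) (rule sub_weight_aux_sym)
  thus ?thesis by (auto simp: symmetric_matrix_def B_matrix_component)
qed

definition penalty :: "real^('v + 'v set) \<Rightarrow> real" where
  "penalty u = (\<Sum>x\<in>ghosts w \<psi>. (u $ x)\<^sup>2)"

lemma penalty_nonneg: "0 \<le> penalty u"
  by (simp add: penalty_def sum_nonneg)

lemma B_matrix_form:
  assumes "0 \<le> \<sigma>"
  shows "u \<bullet> (B_matrix w \<psi> \<sigma> *v u) = dirichlet_energy u + \<sigma> / (1 + \<sigma>) * ghost_energy u + \<sigma> * penalty u"
proof -
  have s: "sub_weight w \<psi> \<sigma> = sub_weight_aux w \<psi> (1 - \<sigma> / (1 + \<sigma>)) (\<sigma> / (1 + \<sigma>))"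
    using assms by (simp add: sub_weight_def field_simps)
  have "(\<Sum>x\<in>UNIV. u $ x * (\<sigma> * (if x \<in> ghosts w \<psi> then u $ x else 0))) = \<sigma> * penalty u"
    unfolding penalty_def sum_distrib_left
    by (rule sum.mono_neutral_cong_right) (auto simp: power2_eq_square)
  hence "u \<bullet> (B_matrix w \<psi> \<sigma> *v u) = u \<bullet> (laplacian (sub_weight w \<psi> \<sigma>) *v u) + \<sigma> * penalty u"
    by (simp add: inner_vec_def B_matrix_mult_vector distrib_left sum.distrib)
  thus ?thesis unfolding s sub_laplacian_form by simp
qed

abbreviation "Linf \<equiv> laplacian (sub_weight_inf w \<psi>)"

lemma Linf_form: "u \<bullet> (Linf *v u) = dirichlet_energy u + ghost_energy u"
  using sub_laplacian_form[of u 1] by (simp add: sub_weight_inf_def)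

lemma symmetric_Linf: "symmetric_matrix Linf"
  unfolding sub_weight_inf_def by (rule symmetric_laplacian) (rule sub_weight_aux_sym)

lemma eigenvector_component: "(\<Sum>j\<in>UNIV. w i j * (\<psi> $ i - \<psi> $ j)) = ev * \<psi> $ i"
  using eigenvector by (simp add: laplacian_mult_vector[symmetric])

text \<open>Ground state substitution \<open>x = f \<psi>\<close>: in \<open>ev * x\<^sub>i\<^sup>2 = f\<^sub>i\<^sup>2 \<psi>\<^sub>i (ev * \<psi>\<^sub>i)\<close> the eigenvalue equation replaces
  \<open>ev * \<psi>\<^sub>i\<close>, and the result is symmetrized. The coefficients \<open>w\<^sub>i\<^sub>j \<psi>\<^sub>i \<psi>\<^sub>j\<close> are negative exactly on the sign-change
  edges.\<close>

lemma ground_state_representation: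
  "dirichlet_energy u - ev * (\<Sum>i\<in>UNIV. (u $ Inl i)\<^sup>2) =
     (\<Sum>i\<in>UNIV. \<Sum>j\<in>UNIV. w i j * (\<psi> $ i * \<psi> $ j) * (u $ Inl i / \<psi> $ i - u $ Inl j / \<psi> $ j)\<^sup>2) / 2"
proof -
  define f where "f = (\<lambda>i. u $ Inl i / \<psi> $ i)"
  have u: "u $ Inl i = f i * \<psi> $ i" for i using nonzero by (simp add: f_def)
  have "ev * (\<Sum>i\<in>UNIV. (u $ Inl i)\<^sup>2) = (\<Sum>i\<in>UNIV. (f i)\<^sup>2 * \<psi> $ i * (ev * \<psi> $ i))"
    unfolding sum_distrib_left by (intro sum.cong refl) (simp add: u power2_eq_square)
  also have "\<dots> = (\<Sum>i\<in>UNIV. \<Sum>j\<in>UNIV. (f i)\<^sup>2 * \<psi> $ i * (w i j * (\<psi> $ i - \<psi> $ j)))"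
    unfolding eigenvector_component[symmetric] by (simp add: sum_distrib_left)
  also have "\<dots> = (\<Sum>i\<in>UNIV. \<Sum>j\<in>UNIV. ((f i)\<^sup>2 * \<psi> $ i * (w i j * (\<psi> $ i - \<psi> $ j))
      + (f j)\<^sup>2 * \<psi> $ j * (w i j * (\<psi> $ j - \<psi> $ i))) / 2)"
    by (subst symmetric_sum_swap, intro sum.cong refl) (simp add: w_sym)
  finally have *: "ev * (\<Sum>i\<in>UNIV. (u $ Inl i)\<^sup>2) = \<dots>" .
  show ?thesis
    unfolding * dirichlet_energy_def sum_divide_distrib sum_subtractf[symmetric] f_def[symmetric]
    by (intro sum.cong refl) (simp add: u power2_eq_square algebra_simps diff_divide_distrib add_divide_distrib)
qed

lemma ghost_energy_Dirichlet:
  assumes "\<And>x. x \<in> ghosts w \<psi> \<Longrightarrow> u $ x = 0"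
  shows "ghost_energy u = - (\<Sum>i\<in>UNIV. \<Sum>j\<in>UNIV. if sgn_edge i j then
     w i j * (\<psi> $ i * \<psi> $ j) * (u $ Inl i / \<psi> $ i - u $ Inl j / \<psi> $ j)\<^sup>2 else 0) / 2"
proof -
  have "(if sgn_edge i j then
     w i j / q i j * ((u $ Inl i - u $ Inr {i, j}) + q i j * (u $ Inl j - u $ Inr {i, j}))\<^sup>2 else 0) =
     (if sgn_edge i j then
     - (w i j * (\<psi> $ i * \<psi> $ j) * (u $ Inl i / \<psi> $ i - u $ Inl j / \<psi> $ j)\<^sup>2) else 0)" for i j
  proof (cases "sgn_edge i j")
    case True
    hence z: "u $ Inr {i, j} = 0" using assms by (auto simp: ghosts_def)
    show ?thesis using True nonzero[of i] nonzero[of j]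
      by (simp add: z q_ratio_def field_simps power2_eq_square)
  qed simp
  thus ?thesis unfolding ghost_energy_squares
    by (simp add: sum_negf[symmetric] if_distrib[of uminus] cong: if_cong)
qed

text \<open>For functions vanishing on the ghosts, the ghost energy cancels precisely the negative terms of the ground
  state representation.\<close>

lemma Linf_ground_state:
  assumes "\<And>x. x \<in> ghosts w \<psi> \<Longrightarrow> u $ x = 0"
  shows "u \<bullet> (Linf *v u) - ev * (\<Sum>i\<in>UNIV. (u $ Inl i)\<^sup>2) =
     (\<Sum>i\<in>UNIV. \<Sum>j\<in>UNIV. if sgn_edge i j then 0 else
        w i j * (\<psi> $ i * \<psi> $ j) * (u $ Inl i / \<psi> $ i - u $ Inl j / \<psi> $ j)\<^sup>2) / 2"
proof -
  let ?h = "\<lambda>i j. w i j * (\<psi> $ i * \<psi> $ j) * (u $ Inl i / \<psi> $ i - u $ Inl j / \<psi> $ j)\<^sup>2"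
  have split: "(\<Sum>i\<in>UNIV. \<Sum>j\<in>UNIV. ?h i j) =
      (\<Sum>i\<in>UNIV. \<Sum>j\<in>UNIV. if sgn_edge i j then ?h i j else 0) +
      (\<Sum>i\<in>UNIV. \<Sum>j\<in>UNIV. if sgn_edge i j then 0 else ?h i j)"
    by (simp only: sum.distrib[symmetric]) (intro sum.cong refl, simp)
  have "u \<bullet> (Linf *v u) - ev * (\<Sum>i\<in>UNIV. (u $ Inl i)\<^sup>2) =
      (dirichlet_energy u - ev * (\<Sum>i\<in>UNIV. (u $ Inl i)\<^sup>2)) + ghost_energy u"
    by (simp add: Linf_form)
  also have "ghost_energy u = - (\<Sum>i\<in>UNIV. \<Sum>j\<in>UNIV. if sgn_edge i j then ?h i j else 0) / 2"
    by (rule ghost_energy_Dirichlet) (rule assms)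
  finally show ?thesis unfolding ground_state_representation split by (simp add: add_divide_distrib)
qed

end

section \<open>Convergence to the Dirichlet eigenvalues\<close>

context signed_eigenvector
begin

abbreviation "V \<equiv> range Inl :: ('v + 'v set) set"
abbreviation "VG \<equiv> sub_vertices w \<psi>"
abbreviation "Vgh \<equiv> ghosts w \<psi>"
abbreviation "B \<equiv> B_matrix w \<psi>"

lemma pos_neg_set_eq: "pos_neg_set \<psi> = V"
  using nonzero by (auto simp: pos_neg_set_def) (metis linorder_neqE_linordered_idom)

lemma V_Vgh_disjoint: "V \<inter> Vgh = {}" by (auto simp: ghosts_def)

lemma card_V: "card V = CARD('v)" by (rule card_image) simp

lemma card_VG: "card VG = CARD('v) + card Vgh"
  unfolding sub_vertices_def using V_Vgh_disjoint by (simp add: card_Un_disjoint card_V)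

lemma V_subset_VG: "V \<subseteq> VG" by (auto simp: sub_vertices_def)

lemma inner_self_VG:
  assumes "u \<in> supported VG"
  shows "u \<bullet> u = (\<Sum>i\<in>UNIV. (u $ Inl i)\<^sup>2) + penalty u"
proof -
  have "u \<bullet> u = (\<Sum>x\<in>VG. (u $ x)\<^sup>2)"
    unfolding inner_vec_def
    by (rule sum.mono_neutral_cong_right) (use assms in \<open>auto simp: supported_def power2_eq_square\<close>)
  also have "\<dots> = (\<Sum>x\<in>V. (u $ x)\<^sup>2) + (\<Sum>x\<in>Vgh. (u $ x)\<^sup>2)"
    unfolding sub_vertices_def using V_Vgh_disjoint by (intro sum.union_disjoint) auto
  also have "(\<Sum>x\<in>V. (u $ x)\<^sup>2) = (\<Sum>i\<in>UNIV. (u $ Inl i)\<^sup>2)" by (simp add: sum.reindex)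
  finally show ?thesis by (simp add: penalty_def)
qed

lemma penalty_eq_0_iff: "penalty u = 0 \<longleftrightarrow> (\<forall>x\<in>Vgh. u $ x = 0)"
  by (simp add: penalty_def sum_nonneg_eq_0_iff)

lemma supported_V_ghost: "u \<in> supported V \<Longrightarrow> x \<in> Vgh \<Longrightarrow> u $ x = 0"
  using V_Vgh_disjoint by (auto simp: supported_def)

lemma supported_V_penalty: "u \<in> supported V \<Longrightarrow> penalty u = 0"
  using supported_V_ghost by (simp add: penalty_eq_0_iff)

lemma supported_V_iff: "u \<in> supported VG \<Longrightarrow> penalty u = 0 \<Longrightarrow> u \<in> supported V"
  by (auto simp: penalty_eq_0_iff supported_def sub_vertices_def)

lemma fraction_mono: "0 \<le> \<sigma> \<Longrightarrow> \<sigma> \<le> \<sigma>' \<Longrightarrow> \<sigma> / (1 + \<sigma>) \<le> \<sigma>' / (1 + \<sigma>' :: real)"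
  by (simp add: field_simps)

lemma B_form_mono:
  assumes "0 \<le> \<sigma>" "\<sigma> \<le> \<sigma>'"
  shows "u \<bullet> (B \<sigma> *v u) \<le> u \<bullet> (B \<sigma>' *v u)"
proof -
  have "\<sigma> / (1 + \<sigma>) * ghost_energy u \<le> \<sigma>' / (1 + \<sigma>') * ghost_energy u"
    by (intro mult_right_mono fraction_mono assms ghost_energy_nonneg)
  moreover have "\<sigma> * penalty u \<le> \<sigma>' * penalty u"
    by (intro mult_right_mono assms penalty_nonneg)
  moreover have "0 \<le> \<sigma>'" using assms by simp
  ultimately show ?thesis
    unfolding B_matrix_form[OF assms(1)] B_matrix_form[OF \<open>0 \<le> \<sigma>'\<close>] by linarith
qed

text \<open>The limiting form bounds the family from above on functions vanishing on the ghosts; such functions are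
  therefore good trial functions for every \<open>\<sigma>\<close>.\<close>

lemma B_form_le_Linf:
  assumes "0 \<le> \<sigma>" "u \<in> supported V"
  shows "u \<bullet> (B \<sigma> *v u) \<le> u \<bullet> (Linf *v u)"
proof -
  have "\<sigma> / (1 + \<sigma>) * ghost_energy u \<le> 1 * ghost_energy u"
    by (rule mult_right_mono) (use assms(1) ghost_energy_nonneg in auto)
  thus ?thesis using assms by (simp add: B_matrix_form Linf_form supported_V_penalty)
qed

lemma count_le_B_mono:
  assumes "0 \<le> \<sigma>" "\<sigma> \<le> \<sigma>'"
  shows "count_le VG (B \<sigma>') c \<le> count_le VG (B \<sigma>) c"
proof -
  obtain F where F: "subspace F" "F \<subseteq> supported VG" "dim F = count_le VG (B \<sigma>') c"
    "\<And>u. u \<in> F \<Longrightarrow> u \<bullet> (B \<sigma>' *v u) \<le> c * (u \<bullet> u)"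
    using count_le_subspace[OF symmetric_B_matrix, of VG \<sigma>' c] by blast
  have "dim F \<le> count_le VG (B \<sigma>) c"
    using F(1,2) B_form_mono[OF assms] F(4)
    by (intro dim_le_count_le[OF symmetric_B_matrix]) (auto intro: order_trans)
  thus ?thesis using F(3) by simp
qed

lemma count_le_Linf_le_B:
  assumes "0 \<le> \<sigma>"
  shows "count_le V Linf c \<le> count_le VG (B \<sigma>) c"
proof -
  obtain F where F: "subspace F" "F \<subseteq> supported V" "dim F = count_le V Linf c"
    "\<And>u. u \<in> F \<Longrightarrow> u \<bullet> (Linf *v u) \<le> c * (u \<bullet> u)"
    using count_le_subspace[OF symmetric_Linf, of V c] by blast
  have "dim F \<le> count_le VG (B \<sigma>) c"
  proof (rule dim_le_count_le[OF symmetric_B_matrix F(1)])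
    show "F \<subseteq> supported VG" using F(2) supported_mono[OF V_subset_VG] by blast
    show "u \<bullet> (B \<sigma> *v u) \<le> c * (u \<bullet> u)" if "u \<in> F" for u
      using B_form_le_Linf[OF assms, of u] F(2,4) that by fastforce
  qed
  thus ?thesis using F(3) by simp
qed

text \<open>For the upper bound on the count, let \<open>F\<close> be a subspace on which the Dirichlet form exceeds \<open>c\<close>, and add all
  vectors supported on the ghosts to get \<open>H\<close>. The unit vectors in \<open>H\<close> at which the form is at most \<open>c\<close> shrink as \<open>\<sigma>\<close> grows.
  If these compact sets never became empty, they would share a vector: bounded penalty puts it into
  \<open>F\<close>, and in the limit its Dirichlet form is at most \<open>c\<close>, a contradiction.\<close>

lemma count_le_B_eventually:
  "\<forall>\<^sub>F \<sigma> in at_top. count_le VG (B \<sigma>) c = count_le V Linf c"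
proof -
  obtain F where F: "subspace F" "F \<subseteq> supported V" "dim F + count_le V Linf c = card V"
    "\<And>u. u \<in> F \<Longrightarrow> u \<noteq> 0 \<Longrightarrow> c * (u \<bullet> u) < u \<bullet> (Linf *v u)"
    using count_le_cosubspace[OF symmetric_Linf, of V c] by blast
  define H where "H = {x + y |x y. x \<in> F \<and> y \<in> supported Vgh}"
  have H: "subspace H" "H \<subseteq> supported VG" "dim H = dim F + card Vgh"
    using direct_sum_supported[OF F(1,2) subspace_supported order_refl V_Vgh_disjoint]
    unfolding H_def sub_vertices_def by (auto simp: dim_supported)
  define K where "K = (\<lambda>n. {u \<in> H \<inter> sphere 0 1. u \<bullet> (B (real n) *v u) \<le> c})"
  have "\<exists>n. K n = {}"
  proof (rule ccontr)
    assume "\<nexists>n. K n = {}"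
    hence ne: "K n \<noteq> {}" for n by blast
    have comp: "compact (H \<inter> sphere 0 1)"
      by (intro closed_Int_compact closed_subspace H(1) compact_sphere)
    have "closed {u. u \<bullet> (B (real n) *v u) \<le> c}" for n
      by (intro closed_Collect_le continuous_on_inner continuous_on_id continuous_on_const
          matrix_vector_mult_linear_continuous_on)
    hence "compact (H \<inter> sphere 0 1 \<inter> {u. u \<bullet> (B (real n) *v u) \<le> c})" for n
      by (intro compact_Int_closed comp)
    moreover have "K n = H \<inter> sphere 0 1 \<inter> {u. u \<bullet> (B (real n) *v u) \<le> c}" for n
      by (auto simp: K_def)
    ultimately have "compact (K n)" for n by simp
    moreover have "K n \<subseteq> K m" if "m \<le> n" for m n
      using order_trans[OF B_form_mono[of "real m" "real n"]] that by (auto simp: K_def)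
    ultimately have "\<Inter>(range K) \<noteq> {}" by (intro compact_nest ne)
    then obtain u where "u \<in> \<Inter>(range K)" by (meson ex_in_conv)
    hence u: "u \<in> K n" for n by simp
    have uH: "u \<in> H" "norm u = 1" using u[of 0] by (auto simp: K_def)
    have le: "dirichlet_energy u + real n / (1 + real n) * ghost_energy u + real n * penalty u \<le> c" for n
      using u[of n] by (simp add: K_def B_matrix_form)
    have n_le: "real n * penalty u \<le> c" for n
    proof -
      have "0 \<le> real n / (1 + real n) * ghost_energy u"
        by (intro mult_nonneg_nonneg ghost_energy_nonneg) simp
      thus ?thesis using le[of n] dirichlet_energy_nonneg[of u] by linarith
    qed
    have "penalty u = 0"
    proof (rule ccontr)
      assume "penalty u \<noteq> 0"
      hence "0 < penalty u" using penalty_nonneg[of u] by simp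
      then obtain n where "c < real n * penalty u" using reals_Archimedean3 by blast
      thus False using n_le[of n] by simp
    qed
    hence uV: "u \<in> supported V" using supported_V_iff H(2) uH(1) by blast
    have uF: "u \<in> F"
    proof -
      obtain x y where xy: "u = x + y" "x \<in> F" "y \<in> supported Vgh" using uH(1) by (auto simp: H_def)
      have "y = u - x" using xy(1) by simp
      hence "y \<in> supported V" using uV F(2) xy(2) subspace_diff[OF subspace_supported] by blast
      hence "y $ i = 0" for i
        using xy(3) V_Vgh_disjoint by (cases "i \<in> Vgh") (auto simp: supported_def)
      hence "y = 0" by (simp add: vec_eq_iff)
      thus ?thesis using xy by simp
    qed
    have "(\<lambda>n. dirichlet_energy u + real n / (1 + real n) * ghost_energy u) \<longlonglongrightarrow> dirichlet_energy u + 1 * ghost_energy u"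
    proof (intro tendsto_intros)
      show "(\<lambda>n. real n / (1 + real n)) \<longlonglongrightarrow> 1"
        using LIMSEQ_n_over_Suc_n by (simp add: add.commute)
    qed
    hence "dirichlet_energy u + 1 * ghost_energy u \<le> c"
      by (rule LIMSEQ_le_const2) (use le \<open>penalty u = 0\<close> in auto)
    hence "u \<bullet> (Linf *v u) \<le> c * (u \<bullet> u)"
      using norm_eq_1[THEN iffD1, OF uH(2)] by (simp add: Linf_form)
    moreover have "u \<noteq> 0" using uH(2) by auto
    ultimately show False using F(4)[OF uF] by simp
  qed
  then obtain n where n: "K n = {}" by blast
  have "count_le VG (B \<sigma>) c = count_le V Linf c" if \<sigma>: "real n \<le> \<sigma>" for \<sigma>
  proof (rule antisym)
    have "dim H + count_le VG (B \<sigma>) c \<le> card VG"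
    proof (rule count_le_upper[OF symmetric_B_matrix H(1,2)])
      fix u assume u: "u \<in> H" "u \<noteq> 0"
      define v where "v = (1 / norm u) *\<^sub>R u"
      have "v \<in> H \<inter> sphere 0 1" using u subspace_scale[OF H(1)] by (simp add: v_def)
      hence "c < v \<bullet> (B (real n) *v v)" using n by (force simp: K_def)
      also have "\<dots> \<le> v \<bullet> (B \<sigma> *v v)" by (rule B_form_mono) (use \<sigma> in auto)
      also have "\<dots> = u \<bullet> (B \<sigma> *v u) / (norm u)\<^sup>2"
        unfolding v_def inner_matrix_scale by (simp add: power_divide)
      finally have "c * (norm u)\<^sup>2 < u \<bullet> (B \<sigma> *v u)" using u(2) by (simp add: pos_less_divide_eq)
      thus "c * (u \<bullet> u) < u \<bullet> (B \<sigma> *v u)" by (simp add: power2_norm_eq_inner)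
    qed
    thus "count_le VG (B \<sigma>) c \<le> count_le V Linf c" using F(3) H(3) by (simp add: card_VG card_V)
    show "count_le V Linf c \<le> count_le VG (B \<sigma>) c"
      by (rule count_le_Linf_le_B) (use \<sigma> order_trans[of 0 "real n" \<sigma>] in simp)
  qed
  thus ?thesis using eventually_ge_at_top by (rule eventually_mono[rotated])
qed

theorem eigenvalue_B_converges:
  assumes m: "m \<in> {1..card V}"
  shows "((\<lambda>\<sigma>. eigenvalue VG (B \<sigma>) m) \<longlongrightarrow> eigenvalue V Linf m) at_top"
proof (rule order_tendstoI)
  have mVG: "1 \<le> m" "m \<le> card VG" "m \<le> card V" using m by (auto simp: card_VG card_V)
  note iff = eigenvalue_le_iff_count[OF symmetric_B_matrix mVG(1,2)]
  note iff' = eigenvalue_le_iff_count[OF symmetric_Linf mVG(1,3)]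
  fix c
  show "\<forall>\<^sub>F \<sigma> in at_top. c < eigenvalue VG (B \<sigma>) m" if "c < eigenvalue V Linf m"
    using count_le_B_eventually[of c]
  proof eventually_elim
    case (elim \<sigma>)
    have "\<not> m \<le> count_le V Linf c" using that iff'[of c] by simp
    thus ?case using elim iff[of \<sigma> c] by simp
  qed
  show "\<forall>\<^sub>F \<sigma> in at_top. eigenvalue VG (B \<sigma>) m < c" if "eigenvalue V Linf m < c"
    using eventually_ge_at_top[of 0]
  proof eventually_elim
    case (elim \<sigma>)
    have "m \<le> count_le V Linf (eigenvalue V Linf m)" using iff'[of "eigenvalue V Linf m"] by simp
    hence "eigenvalue VG (B \<sigma>) m \<le> eigenvalue V Linf m"
      using count_le_Linf_le_B[OF elim] iff order_trans by blast
    thus ?case using that by simp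
  qed
qed

text \<open>At most \<open>card V\<close> eigenvalues stay below a given \<open>c\<close>, because the Dirichlet problem has no more.\<close>

theorem eigenvalue_B_diverges:
  assumes m: "m \<in> {card V + 1..card VG}"
  shows "filterlim (\<lambda>\<sigma>. eigenvalue VG (B \<sigma>) m) at_top at_top"
  unfolding filterlim_at_top_dense
proof
  fix c
  show "\<forall>\<^sub>F \<sigma> in at_top. c < eigenvalue VG (B \<sigma>) m"
    using count_le_B_eventually[of c]
  proof eventually_elim
    case (elim \<sigma>)
    have "count_le VG (B \<sigma>) c < m" using elim count_le_le_card[OF symmetric_Linf, of V c] m by simp
    thus ?case using eigenvalue_le_iff_count[OF symmetric_B_matrix, of m VG \<sigma> c] m by auto
  qed
qed

end

section \<open>Nodal domains and the lowest Dirichlet eigenvalue\<close>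

text \<open>Paths starting in the image of an embedded relation never leave the image.\<close>

lemma rtrancl_map_inj:
  assumes h: "inj h"
  shows "(h i, y) \<in> (map_prod h h ` r)\<^sup>* \<longleftrightarrow> (\<exists>j. y = h j \<and> (i, j) \<in> r\<^sup>*)"
proof
  assume "(h i, y) \<in> (map_prod h h ` r)\<^sup>*"
  thus "\<exists>j. y = h j \<and> (i, j) \<in> r\<^sup>*"
  proof (induction rule: rtrancl_induct)
    case (step y z)
    then obtain j a b where "y = h j" "(i, j) \<in> r\<^sup>*" "y = h a" "z = h b" "(a, b) \<in> r" by auto
    moreover have "a = j" using calculation h by (auto dest: injD)
    ultimately show ?case by (metis rtrancl.rtrancl_into_rtrancl)
  qed auto
next
  assume "\<exists>j. y = h j \<and> (i, j) \<in> r\<^sup>*"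
  then obtain j where j: "y = h j" "(i, j) \<in> r\<^sup>*" by blast
  from j(2) have "(h i, h j) \<in> (map_prod h h ` r)\<^sup>*"
  proof (induction rule: rtrancl_induct)
    case (step y z)
    have "(h y, h z) \<in> map_prod h h ` r" using step(2) by force
    thus ?case using step(3) by (rule rtrancl_into_rtrancl[rotated])
  qed simp
  thus "(h i, y) \<in> (map_prod h h ` r)\<^sup>*" using j(1) by simp
qed

lemma card_graph_components_map:
  assumes h: "inj h" and R: "Restr R (range h) = map_prod h h ` r"
  shows "card (graph_components (range h) R) = card (UNIV // r\<^sup>*)"
proof -
  have cls: "Restr ((map_prod h h ` r)\<^sup>*) (range h) `` {h i} = h ` (r\<^sup>* `` {i})" for i
    using rtrancl_map_inj[OF h, of i _ r] by auto
  have "graph_components (range h) R = (\<lambda>X. h ` X) ` (UNIV // r\<^sup>*)"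
    unfolding graph_components_def R quotient_def by (auto simp: cls)
  thus ?thesis using h by (simp add: card_image inj_image_eq_iff inj_on_def)
qed

context signed_eigenvector
begin

definition same_sign_edges :: "('v \<times> 'v) set" where
  "same_sign_edges = edges w - {(i, j). \<psi> $ i * \<psi> $ j < 0}"

lemma same_sign_edges_iff: "(i, j) \<in> same_sign_edges \<longleftrightarrow> 0 < w i j \<and> \<not> sgn_edge i j"
  by (auto simp: same_sign_edges_def edges_def sgn_edge_iff)

lemma same_sign_pos: "(i, j) \<in> same_sign_edges \<Longrightarrow> 0 < \<psi> $ i * \<psi> $ j"
  using nonzero[of i] nonzero[of j] by (auto simp: same_sign_edges_def not_less order_le_less)

lemma same_sign_edges_equiv: "equiv UNIV (same_sign_edges\<^sup>*)"
proof (rule equivI)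
  have "sym same_sign_edges"
    by (auto simp: sym_def same_sign_edges_iff sgn_edge_sym w_sym)
  thus "sym (same_sign_edges\<^sup>*)" by (rule sym_rtrancl)
qed (auto simp: refl_rtrancl trans_rtrancl)

lemma nodal_count_eq: "nodal_count w \<psi> = card (UNIV // same_sign_edges\<^sup>*)"
  using nonzero by (simp add: nodal_count_def nodal_domains_def graph_components_def same_sign_edges_def)

lemma Restr_winf_edges:
  "Restr (edges (sub_weight_inf w \<psi>)) V = map_prod Inl Inl ` same_sign_edges"
  by (auto simp: edges_def sub_weight_inf_def same_sign_edges_iff sgn_edge_iff image_iff split: if_splits)

lemma card_D_components: "card (D_components (sub_weight_inf w \<psi>) V) = nodal_count w \<psi>"
proof -
  have D: "D_vertices (sub_weight_inf w \<psi>) V - vertex_boundary (sub_weight_inf w \<psi>) V = V"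
    by (auto simp: D_vertices_def vertex_boundary_def)
  have "Restr (D_edges (sub_weight_inf w \<psi>) V) V = Restr (edges (sub_weight_inf w \<psi>)) V"
    by (auto simp: D_edges_def D_vertices_def)
  hence "Restr (D_edges (sub_weight_inf w \<psi>) V) V = map_prod Inl Inl ` same_sign_edges"
    by (simp only: Restr_winf_edges)
  from card_graph_components_map[OF _ this] show ?thesis
    unfolding D_components_def D nodal_count_eq by simp
qed

lemma nodal_count_extend_zero: "nodal_count (sub_weight_inf w \<psi>) (extend_zero \<psi>) = nodal_count w \<psi>"
proof -
  have supp: "{x. extend_zero \<psi> $ x \<noteq> 0} = V"
    using nonzero by (auto simp: extend_zero_def split: sum.splits) (metis rangeI sum.exhaust)
  have "Restr (edges (sub_weight_inf w \<psi>) - {(x, y). extend_zero \<psi> $ x * extend_zero \<psi> $ y < 0}) V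
      = map_prod Inl Inl ` same_sign_edges"
    by (auto simp: edges_def sub_weight_inf_def same_sign_edges_iff sgn_edge_iff image_iff
        extend_zero_def split: if_splits)
  from card_graph_components_map[OF _ this] show ?thesis
    unfolding nodal_count_def[of "sub_weight_inf w \<psi>"] nodal_domains_def supp nodal_count_eq by simp
qed

lemma Linf_ground_terms_nonneg:
  "0 \<le> (if sgn_edge i j then 0 else w i j * (\<psi> $ i * \<psi> $ j) * (u $ Inl i / \<psi> $ i - u $ Inl j / \<psi> $ j)\<^sup>2)"
proof (cases "(i, j) \<in> same_sign_edges")
  case True
  thus ?thesis using same_sign_pos[OF True] w_nonneg[of i j] by simp
next
  case False
  hence "sgn_edge i j \<or> w i j = 0" using w_nonneg[of i j] by (auto simp: same_sign_edges_iff)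
  thus ?thesis by auto
qed

lemma inner_self_V: "u \<in> supported V \<Longrightarrow> u \<bullet> u = (\<Sum>i\<in>UNIV. (u $ Inl i)\<^sup>2)"
  using inner_self_VG[of u] supported_mono[OF V_subset_VG] supported_V_penalty by auto

lemma Linf_ground_nonneg: "u \<in> supported V \<Longrightarrow> ev * (u \<bullet> u) \<le> u \<bullet> (Linf *v u)"
proof -
  assume u: "u \<in> supported V"
  have "0 \<le> u \<bullet> (Linf *v u) - ev * (u \<bullet> u)"
    unfolding inner_self_V[OF u]
    by (subst Linf_ground_state, erule supported_V_ghost[OF u])
      (intro divide_nonneg_nonneg sum_nonneg Linf_ground_terms_nonneg, simp)
  thus ?thesis by simp
qed

text \<open>The vectors \<open>f \<psi>\<close> with \<open>f\<close> constant on each nodal domain.\<close>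

definition nodal_space :: "(real^('v + 'v set)) set" where
  "nodal_space = {u \<in> supported V. \<forall>i j. (i, j) \<in> same_sign_edges \<longrightarrow> u $ Inl i / \<psi> $ i = u $ Inl j / \<psi> $ j}"

lemma subspace_nodal_space: "subspace nodal_space"
  using subspace_supported[of V]
  by (auto simp: nodal_space_def subspace_def add_divide_distrib) (metis times_divide_eq_right)

text \<open>Equality in \<open>Linf_ground_nonneg\<close> forces every term of the ground state representation to vanish.\<close>

lemma nodal_space_iff:
  assumes u: "u \<in> supported V"
  shows "u \<in> nodal_space \<longleftrightarrow> u \<bullet> (Linf *v u) = ev * (u \<bullet> u)"
proof -
  let ?g = "\<lambda>i j. if sgn_edge i j then 0 else w i j * (\<psi> $ i * \<psi> $ j) * (u $ Inl i / \<psi> $ i - u $ Inl j / \<psi> $ j)\<^sup>2"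
  have "u \<bullet> (Linf *v u) - ev * (u \<bullet> u) = (\<Sum>i\<in>UNIV. \<Sum>j\<in>UNIV. ?g i j) / 2"
    unfolding inner_self_V[OF u] by (rule Linf_ground_state) (rule supported_V_ghost[OF u])
  hence "u \<bullet> (Linf *v u) = ev * (u \<bullet> u) \<longleftrightarrow> (\<Sum>i\<in>UNIV. \<Sum>j\<in>UNIV. ?g i j) = 0" by auto
  also have "\<dots> \<longleftrightarrow> (\<forall>i j. ?g i j = 0)"
    by (subst sum_nonneg_eq_0_iff) (auto simp: sum_nonneg_eq_0_iff Linf_ground_terms_nonneg intro!: sum_nonneg
        simp del: mult_eq_0_iff)
  also have "\<dots> \<longleftrightarrow> (\<forall>i j. (i, j) \<in> same_sign_edges \<longrightarrow> u $ Inl i / \<psi> $ i = u $ Inl j / \<psi> $ j)"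
  proof -
    have "?g i j = 0 \<longleftrightarrow> ((i, j) \<in> same_sign_edges \<longrightarrow> u $ Inl i / \<psi> $ i = u $ Inl j / \<psi> $ j)" for i j
      using nonzero[of i] nonzero[of j] w_nonneg[of i j] by (auto simp: same_sign_edges_iff)
    thus ?thesis by simp
  qed
  finally show ?thesis using u by (simp add: nodal_space_def)
qed

text \<open>A basis is given by the restrictions of \<open>\<psi>\<close> to the nodal domains, which have disjoint supports.\<close>

lemma dim_nodal_space: "dim nodal_space = nodal_count w \<psi>"
proof -
  define C where "C = UNIV // same_sign_edges\<^sup>*"
  define v where "v = (\<lambda>X. (\<chi> x. case x of Inl i \<Rightarrow> if i \<in> X then \<psi> $ i else 0 | Inr e \<Rightarrow> 0) :: real^('v + 'v set))"
  have vI: "v X $ Inl i = (if i \<in> X then \<psi> $ i else 0)" and vR: "v X $ Inr e = 0" for X i e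
    by (simp_all add: v_def)
  have v_nz: "v X \<noteq> 0" if X: "X \<in> C" for X
  proof -
    obtain i where "i \<in> X" using in_quotient_imp_non_empty[OF same_sign_edges_equiv] X by (auto simp: C_def)
    hence "v X $ Inl i \<noteq> 0" using nonzero by (simp add: vI)
    thus ?thesis by auto
  qed
  have orth: "orthogonal (v X) (v Y)" if "X \<in> C" "Y \<in> C" "X \<noteq> Y" for X Y
  proof -
    have "X \<inter> Y = {}" using quotient_disj[OF same_sign_edges_equiv] that by (auto simp: C_def)
    hence "v X $ x * v Y $ x = 0" for x by (cases x) (auto simp: vI vR)
    thus ?thesis unfolding orthogonal_def inner_vec_def inner_real_def by (intro sum.neutral) simp
  qed
  have inj: "inj_on v C"
  proof (rule inj_onI)
    fix X Y assume XY: "X \<in> C" "Y \<in> C" "v X = v Y"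
    show "X = Y"
    proof (rule ccontr)
      assume "X \<noteq> Y"
      hence "v X \<bullet> v X = 0" using orth[OF XY(1,2)] XY(3) by (simp add: orthogonal_def)
      thus False using v_nz[OF XY(1)] by simp
    qed
  qed
  have indep: "independent (v ` C)"
    by (rule pairwise_orthogonal_independent) (use orth v_nz in \<open>auto simp: pairwise_def\<close>)
  have "span (v ` C) = nodal_space"
  proof (rule subset_antisym)
    have "v X \<in> nodal_space" if X: "X \<in> C" for X
    proof -
      have "i \<in> X \<longleftrightarrow> j \<in> X" if "(i, j) \<in> same_sign_edges" for i j
        using that X same_sign_edges_equiv unfolding C_def
        by (meson in_quotient_imp_closed r_into_rtrancl equivE symD)
      thus ?thesis using nonzero by (auto simp: nodal_space_def supported_def vI vR split: sum.splits)
          (metis rangeI sum.exhaust vR)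
    qed
    thus "span (v ` C) \<subseteq> nodal_space" by (intro span_minimal subspace_nodal_space) auto
  next
    show "nodal_space \<subseteq> span (v ` C)"
    proof
      fix u assume u: "u \<in> nodal_space"
      define f where "f = (\<lambda>i. u $ Inl i / \<psi> $ i)"
      have const: "f i = f j" if "(i, j) \<in> same_sign_edges\<^sup>*" for i j
        using that by (induction rule: rtrancl_induct) (use u in \<open>auto simp: nodal_space_def f_def\<close>)
      define c where "c = (\<lambda>X. f (SOME i. i \<in> X))"
      have "u $ x = (\<Sum>X\<in>C. c X *\<^sub>R v X) $ x" for x
      proof (cases x)
        case (Inl i)
        define Y where "Y = same_sign_edges\<^sup>* `` {i}"
        have Y: "Y \<in> C" "i \<in> Y" by (auto simp: Y_def C_def quotient_def)
        have "(SOME i. i \<in> Y) \<in> Y" using Y(2) by (rule someI)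
        hence cY: "c Y = f i" using const[of i "SOME i. i \<in> Y"] by (simp add: c_def Y_def)
        have only: "i \<in> X \<longleftrightarrow> X = Y" if "X \<in> C" for X
          using quotient_disj[OF same_sign_edges_equiv, of X Y] that Y by (auto simp: C_def)
        have "(\<Sum>X\<in>C. c X *\<^sub>R v X) $ x = (\<Sum>X\<in>C. if X = Y then u $ Inl i else 0)"
          unfolding sum_component
          by (rule sum.cong) (use only cY nonzero in \<open>auto simp: Inl vI f_def\<close>)
        thus ?thesis using Y(1) Inl by simp
      next
        case (Inr e)
        hence "u $ x = 0" using u by (auto simp: nodal_space_def supported_def)
        thus ?thesis by (simp add: Inr vR sum_component)
      qed
      hence "u = (\<Sum>X\<in>C. c X *\<^sub>R v X)" by (simp add: vec_eq_iff)
      also have "\<dots> \<in> span (v ` C)" by (intro span_sum span_scale span_base) auto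
      finally show "u \<in> span (v ` C)" .
    qed
  qed
  hence "dim nodal_space = card (v ` C)" by (metis dim_span_eq_card_independent indep)
  thus ?thesis using inj by (simp add: card_image nodal_count_eq C_def)
qed

lemma count_less_Linf: "count_less V Linf ev = 0"
  using count_less_upper[OF symmetric_Linf subspace_supported order_refl, of V ev] Linf_ground_nonneg
  by (simp add: dim_supported)

lemma eig_mult_Linf: "eig_mult V Linf ev = nodal_count w \<psi>"
  and count_le_Linf: "count_le V Linf ev = nodal_count w \<psi>"
proof -
  have "dim nodal_space \<le> count_le V Linf ev"
  proof (rule dim_le_count_le[OF symmetric_Linf subspace_nodal_space])
    show "nodal_space \<subseteq> supported V" by (auto simp: nodal_space_def)
    thus "u \<bullet> (Linf *v u) \<le> ev * (u \<bullet> u)" if "u \<in> nodal_space" for u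
      using nodal_space_iff[of u] that by auto
  qed
  moreover have "count_le V Linf ev = eig_mult V Linf ev"
    using count_le_split[OF symmetric_Linf, of V ev] count_less_Linf by simp
  moreover have "eig_mult V Linf ev \<le> dim nodal_space"
    unfolding eig_mult_def
  proof (rule dim_subset, rule subsetI)
    fix u assume "u \<in> eigenspace V Linf ev"
    hence u: "u \<in> supported V" "\<And>x. x \<in> V \<Longrightarrow> (Linf *v u) $ x = (ev *\<^sub>R u) $ x"
      by (auto simp: eigenspace_def supported_def)
    have "u \<bullet> (Linf *v u) = u \<bullet> (ev *\<^sub>R u)" using u by (rule inner_supported_cong)
    thus "u \<in> nodal_space" using nodal_space_iff[OF u(1)] by simp
  qed
  ultimately show "eig_mult V Linf ev = nodal_count w \<psi>" "count_le V Linf ev = nodal_count w \<psi>"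
    by (simp_all add: dim_nodal_space)
qed

lemma B_inf_eigenspace_eq: "B_inf_eigenspace w \<psi> \<mu> = eigenspace V Linf \<mu>"
proof -
  have "(\<forall>x. x \<notin> VG \<longrightarrow> u $ x = 0) \<and> (\<forall>x\<in>Vgh. u $ x = 0) \<longleftrightarrow> (\<forall>x. x \<notin> V \<longrightarrow> u $ x = 0)"
    for u :: "real^('v + 'v set)"
    using V_Vgh_disjoint unfolding sub_vertices_def by blast
  thus ?thesis unfolding B_inf_eigenspace_def eigenspace_def pos_neg_set_eq by blast
qed

lemma dim_B_inf_eigenspace: "dim (B_inf_eigenspace w \<psi> ev) = nodal_count w \<psi>"
  using eig_mult_Linf by (simp add: B_inf_eigenspace_eq eig_mult_def)

lemma extend_zero_component [simp]:
  "extend_zero u $ Inl i = u $ i" "extend_zero u $ Inr e = 0"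
  by (simp_all add: extend_zero_def)

lemma extend_zero_supported: "extend_zero u \<in> supported V"
  by (auto simp: supported_def extend_zero_def split: sum.splits)

text \<open>The identity \<open>(1 + q\<^sub>j\<^sub>i) \<psi>\<^sub>i = \<psi>\<^sub>i - \<psi>\<^sub>j\<close> shows that replacing a part of the edge by the half-edge leaves
  the net contribution at \<open>i\<close> unchanged, and that the contributions from the two ends cancel at the ghost.
  Consequently the eigenvalue \<open>ev\<close> persists for every \<open>\<sigma>\<close>.\<close>

lemma extend_zero_eigenvector:
  assumes "0 \<le> \<sigma>"
  shows "extend_zero \<psi> \<in> eigenspace VG (B \<sigma>) ev"
proof -
  have q1: "(1 + q j i) * \<psi> $ i = \<psi> $ i - \<psi> $ j" for i j
    using nonzero[of i] by (simp add: q_ratio_def field_simps)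
  have q2: "w i j * (1 + q j i) * \<psi> $ i = w i j * (\<psi> $ i - \<psi> $ j)" for i j
    by (simp only: mult.assoc q1)
  have lap: "(laplacian (sub_weight_aux w \<psi> (1 - t) t) *v extend_zero \<psi>) $ Inl i = ev * \<psi> $ i" for t i
  proof -
    have "(laplacian (sub_weight_aux w \<psi> (1 - t) t) *v extend_zero \<psi>) $ Inl i =
       (\<Sum>j\<in>UNIV. (if sgn_edge i j then (1 - t) * w i j else w i j) * (\<psi> $ i - \<psi> $ j)) +
       t * (\<Sum>e\<in>UNIV. ghost_weight w \<psi> i e * \<psi> $ i)"
      by (simp add: laplacian_mult_vector sum_UNIV_sum_type sum_distrib_left mult.assoc)
    also have "\<dots> = (\<Sum>j\<in>UNIV. w i j * (\<psi> $ i - \<psi> $ j))"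
      unfolding sum_ghost_weight sum_distrib_left sum.distrib[symmetric]
      by (intro sum.cong refl, unfold q2) (simp add: algebra_simps)
    finally show ?thesis by (simp add: eigenvector_component)
  qed
  have lap0: "(laplacian (sub_weight_aux w \<psi> a t) *v extend_zero \<psi>) $ Inr e = 0" for a t e
  proof -
    have "(laplacian (sub_weight_aux w \<psi> a t) *v extend_zero \<psi>) $ Inr e =
        - t * (\<Sum>i\<in>UNIV. ghost_weight w \<psi> i e * \<psi> $ i)"
      by (simp add: laplacian_mult_vector sum_UNIV_sum_type sum_distrib_left sum_negf mult_ac)
    also have "(\<Sum>i\<in>UNIV. ghost_weight w \<psi> i e * \<psi> $ i) =
        (\<Sum>i\<in>UNIV. \<Sum>j\<in>UNIV. if sgn_edge i j \<and> e = {i, j} then w i j * (\<psi> $ i - \<psi> $ j) else 0)"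
      unfolding ghost_weight_def sum_distrib_right mult.assoc q1
      by (rule sum.cong[OF refl], rule sum.mono_neutral_cong_left) auto
    also have "\<dots> = 0"
    proof (subst symmetric_sum_swap, rule sum.neutral, rule ballI, rule sum.neutral, rule ballI)
      fix i j :: 'v
      have "{j, i} = {i, j}" by auto
      thus "((if sgn_edge i j \<and> e = {i, j} then w i j * (\<psi> $ i - \<psi> $ j) else 0) +
          (if sgn_edge j i \<and> e = {j, i} then w j i * (\<psi> $ j - \<psi> $ i) else 0)) / 2 = 0"
        by (simp add: sgn_edge_sym[of j i] w_sym[of j i] algebra_simps)
    qed
    finally show ?thesis by simp
  qed
  have s: "sub_weight w \<psi> \<sigma> = sub_weight_aux w \<psi> (1 - \<sigma> / (1 + \<sigma>)) (\<sigma> / (1 + \<sigma>))"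
    using assms by (simp add: sub_weight_def field_simps)
  have "(B \<sigma> *v extend_zero \<psi>) $ x = ev * extend_zero \<psi> $ x" for x
    by (cases x) (auto simp: B_matrix_mult_vector s lap lap0 ghosts_def)
  moreover have "extend_zero \<psi> \<in> supported VG"
    using extend_zero_supported supported_mono[OF V_subset_VG] by blast
  ultimately show ?thesis by (simp add: eigenspace_def supported_def)
qed

end

section \<open>Counting the crossings\<close>

context signed_eigenvector
begin

text \<open>On a nodal vector, vanishing ghost energy says that \<open>f\<close> also agrees across the sign-change edges, so by
  connectedness \<open>f\<close> is constant.\<close>

lemma nodal_space_ghost_energy_zero:
  assumes u: "u \<in> nodal_space" and g: "ghost_energy u = 0"
  shows "\<exists>c. u = c *\<^sub>R extend_zero \<psi>"
proof -
  have uV: "u \<in> supported V" using u by (simp add: nodal_space_def)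
  define f where "f = (\<lambda>i. u $ Inl i / \<psi> $ i)"
  let ?h = "\<lambda>i j. if sgn_edge i j then w i j * (\<psi> $ i * \<psi> $ j) * (f i - f j)\<^sup>2 else 0"
  have "ghost_energy u = - (\<Sum>i\<in>UNIV. \<Sum>j\<in>UNIV. ?h i j) / 2"
    unfolding f_def by (rule ghost_energy_Dirichlet) (rule supported_V_ghost[OF uV])
  hence "(\<Sum>i\<in>UNIV. \<Sum>j\<in>UNIV. - ?h i j) = 0" using g by (simp add: sum_negf)
  moreover have nn: "0 \<le> - ?h i j" for i j
    by (auto simp: sgn_edge_iff mult_nonneg_nonpos mult_nonpos_nonneg)
  ultimately have h0: "\<forall>i j. - ?h i j = 0"
    by (subst (asm) sum_nonneg_eq_0_iff) (auto simp: sum_nonneg_eq_0_iff intro!: sum_nonneg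
        simp del: mult_eq_0_iff neg_equal_0_iff_equal neg_0_le_iff_le)
  hence sgn: "f i = f j" if "sgn_edge i j" for i j
  proof -
    have "w i j * (\<psi> $ i * \<psi> $ j) * (f i - f j)\<^sup>2 = 0" using h0[rule_format, of i j] that by simp
    moreover have "w i j \<noteq> 0" using that by (simp add: sgn_edge_iff)
    ultimately show ?thesis using nonzero[of i] nonzero[of j] by simp
  qed
  have edge: "f i = f j" if "(i, j) \<in> edges w" for i j
    using that sgn[of i j] u by (cases "sgn_edge i j") (auto simp: nodal_space_def same_sign_edges_iff edges_def f_def)
  have const: "f i = f j" for i j
  proof -
    have "(i, j) \<in> (edges w)\<^sup>*" using graph(2) by (simp add: connected_graph_def)
    thus ?thesis by (induction rule: rtrancl_induct) (auto dest: edge)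
  qed
  obtain i0 :: 'v where True by blast
  have "u $ x = f i0 * extend_zero \<psi> $ x" for x
  proof (cases x)
    case (Inl i)
    thus ?thesis using const[of i i0] nonzero[of i] by (simp add: f_def field_simps)
  next
    case (Inr e)
    thus ?thesis using uV by (auto simp: supported_def)
  qed
  thus ?thesis by (intro exI[of _ "f i0"]) (simp add: vec_eq_iff)
qed

lemma extend_zero_psi_nonzero: "extend_zero \<psi> \<noteq> 0"
  using nonzero by (metis extend_zero_component(1) zero_index)

text \<open>On a maximal subspace where the form at \<open>\<sigma> + 1\<close> is at most \<open>ev\<close>, the form at \<open>\<sigma>\<close> is even smaller. It is strictly below
  \<open>ev\<close> except where the form does not grow at all, and there the vector is a multiple of \<open>\<psi>\<close>. So only one
  dimension is lost.\<close>

lemma count_less_B_large: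
  assumes \<sigma>: "0 \<le> \<sigma>" and c: "count_le VG (B (\<sigma> + 1)) ev = nodal_count w \<psi>"
  shows "nodal_count w \<psi> \<le> count_less VG (B \<sigma>) ev + 1"
proof -
  obtain F where F: "subspace F" "F \<subseteq> supported VG" "dim F = count_le VG (B (\<sigma> + 1)) ev"
    "\<And>u. u \<in> F \<Longrightarrow> u \<bullet> (B (\<sigma> + 1) *v u) \<le> ev * (u \<bullet> u)"
    using count_le_subspace[OF symmetric_B_matrix, of VG "\<sigma> + 1" ev] by blast
  define F0 where "F0 = F \<inter> {u. extend_zero \<psi> \<bullet> u = 0}"
  have sub: "subspace F0" unfolding F0_def by (intro subspace_inter F(1) subspace_hyperplane)
  have "dim F \<le> dim F0 + 1"
    unfolding F0_def by (rule dim_subspace_hyperplane[OF F(1) extend_zero_psi_nonzero])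
  moreover have "dim F0 \<le> count_less VG (B \<sigma>) ev"
  proof (rule dim_le_count_less[OF symmetric_B_matrix sub])
    show "F0 \<subseteq> supported VG" using F(2) by (auto simp: F0_def)
    fix u assume u: "u \<in> F0" "u \<noteq> 0"
    have uF: "u \<in> F" and orth: "extend_zero \<psi> \<bullet> u = 0" using u(1) by (auto simp: F0_def)
    show "u \<bullet> (B \<sigma> *v u) < ev * (u \<bullet> u)"
    proof (rule ccontr)
      assume "\<not> ?thesis"
      hence ge: "ev * (u \<bullet> u) \<le> u \<bullet> (B \<sigma> *v u)" by simp
      define t where "t = \<sigma> / (1 + \<sigma>)"
      define t' where "t' = (\<sigma> + 1) / (1 + (\<sigma> + 1))"
      have "t < t'" using \<sigma> by (simp add: t_def t'_def field_simps)
      have form: "u \<bullet> (B \<sigma> *v u) = dirichlet_energy u + t * ghost_energy u + \<sigma> * penalty u"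
        "u \<bullet> (B (\<sigma> + 1) *v u) = dirichlet_energy u + t' * ghost_energy u + (\<sigma> + 1) * penalty u"
        using \<sigma> by (simp_all add: B_matrix_form t_def t'_def)
      have "(t' - t) * ghost_energy u + penalty u \<le> 0"
        using F(4)[OF uF] ge form by (simp add: algebra_simps)
      moreover have "0 \<le> (t' - t) * ghost_energy u"
        using \<open>t < t'\<close> ghost_energy_nonneg[of u] by simp
      ultimately have "(t' - t) * ghost_energy u = 0" and p0: "penalty u = 0"
        using penalty_nonneg[of u] by linarith+
      hence g0: "ghost_energy u = 0" using \<open>t < t'\<close> by simp
      have uV: "u \<in> supported V" using supported_V_iff p0 F(2) uF by blast
      have "u \<bullet> (Linf *v u) = ev * (u \<bullet> u)"
        using F(4)[OF uF] ge form g0 p0 by (simp add: Linf_form)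
      hence "u \<in> nodal_space" using nodal_space_iff[OF uV] by simp
      then obtain c where c: "u = c *\<^sub>R extend_zero \<psi>" using nodal_space_ghost_energy_zero g0 by blast
      hence "c = 0" using orth extend_zero_psi_nonzero by simp
      thus False using c u(2) by simp
    qed
  qed
  ultimately show ?thesis using F(3) c by simp
qed

lemma eig_mult_B_pos:
  assumes "0 \<le> \<sigma>" shows "1 \<le> eig_mult VG (B \<sigma>) ev"
proof -
  have "dim {extend_zero \<psi>} \<le> dim (eigenspace VG (B \<sigma>) ev)"
    by (rule dim_subset) (use extend_zero_eigenvector[OF assms] in simp)
  moreover have "dim {extend_zero \<psi>} = 1" using extend_zero_psi_nonzero by (simp add: dim_singleton)
  ultimately show ?thesis by (simp add: eig_mult_def)
qed

lemma counts_B_large: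
  obtains R where "0 \<le> R" "\<And>\<sigma>. R \<le> \<sigma> \<Longrightarrow> count_le VG (B \<sigma>) ev = nodal_count w \<psi>"
    "\<And>\<sigma>. R \<le> \<sigma> \<Longrightarrow> count_less VG (B \<sigma>) ev + 1 = nodal_count w \<psi>"
proof -
  obtain R0 where R0: "\<And>\<sigma>. R0 \<le> \<sigma> \<Longrightarrow> count_le VG (B \<sigma>) ev = nodal_count w \<psi>"
    using count_le_B_eventually[of ev] unfolding count_le_Linf eventually_at_top_linorder by blast
  show ?thesis
  proof (rule that[of "max 0 R0"])
    show le: "count_le VG (B \<sigma>) ev = nodal_count w \<psi>" if "max 0 R0 \<le> \<sigma>" for \<sigma> using R0 that by simp
    show "count_less VG (B \<sigma>) ev + 1 = nodal_count w \<psi>" if "max 0 R0 \<le> \<sigma>" for \<sigma>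
      using count_less_B_large[of \<sigma>] R0[of "\<sigma> + 1"] le[OF that] that
        count_le_split[OF symmetric_B_matrix, of VG \<sigma> ev] eig_mult_B_pos[of \<sigma>] by simp
  qed simp
qed

lemma laplacian_w_form: "x \<bullet> (laplacian w *v x) = dirichlet_energy (extend_zero x)"
  by (subst laplacian_form[OF w_sym]) (simp add: dirichlet_energy_def)

lemma symmetric_laplacian_w: "symmetric_matrix (laplacian w)"
  by (rule symmetric_laplacian) (rule w_sym)

lemma linear_extend_zero: "linear (extend_zero :: real^'v \<Rightarrow> real^('v + 'v set))"
  by (rule linearI) (auto simp: vec_eq_iff extend_zero_def split: sum.splits)

lemma inj_extend_zero: "inj (extend_zero :: real^'v \<Rightarrow> real^('v + 'v set))"
  by (rule injI) (metis extend_zero_component(1) vec_eq_iff)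

lemma dim_extend_zero_image: "subspace F \<Longrightarrow> dim (extend_zero ` F :: (real^('v + 'v set)) set) = dim F" for F :: "(real^'v) set"
  by (rule dim_image_eq[OF linear_extend_zero inj_on_subset[OF inj_extend_zero]]) auto

text \<open>A vanishing eigenvalue means that \<open>\<psi>\<close> is constant along edges, so there is no sign change. In all other cases
  the zero eigenvalues at \<open>\<sigma> = 0\<close> contributed by the isolated ghosts lie strictly below \<open>ev\<close>.\<close>

lemma ev_nonneg: "0 \<le> ev" and ev_zero_no_ghosts: "ev = 0 \<Longrightarrow> Vgh = {}"
proof -
  have e: "dirichlet_energy (extend_zero \<psi>) = ev * (\<psi> \<bullet> \<psi>)"
    using laplacian_w_form[of \<psi>] eigenvector by simp
  have "\<psi> \<noteq> 0" using nonzero by (metis zero_index)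
  hence pos: "0 < \<psi> \<bullet> \<psi>" by simp
  have "0 \<le> ev * (\<psi> \<bullet> \<psi>)" using e dirichlet_energy_nonneg[of "extend_zero \<psi>"] by simp
  thus "0 \<le> ev" using pos unfolding zero_le_mult_iff by linarith
  assume "ev = 0"
  hence "(\<Sum>i\<in>UNIV. \<Sum>j\<in>UNIV. w i j * (\<psi> $ i - \<psi> $ j)\<^sup>2) = 0"
    using e by (simp add: dirichlet_energy_def)
  hence "\<forall>i j. w i j * (\<psi> $ i - \<psi> $ j)\<^sup>2 = 0"
    by (subst (asm) sum_nonneg_eq_0_iff) (auto simp: sum_nonneg_eq_0_iff w_nonneg intro!: sum_nonneg
        simp del: mult_eq_0_iff)
  hence eq: "0 < w i j \<Longrightarrow> \<psi> $ i = \<psi> $ j" for i j by (metis eq_iff_diff_eq_0 less_irrefl mult_eq_0_iff power2_eq_square)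
  have "\<not> sgn_edge i j" for i j
  proof
    assume s: "sgn_edge i j"
    hence "\<psi> $ i = \<psi> $ j" using eq by (simp add: sgn_edge_iff)
    thus False using s by (simp add: sgn_edge_iff)
  qed
  thus "Vgh = {}" by (auto simp: ghosts_def)
qed

lemma B_0_form: "u \<bullet> (B 0 *v u) = dirichlet_energy u"
  by (simp add: B_matrix_form)

lemma dirichlet_energy_cong: "(\<And>i. u $ Inl i = v $ Inl i) \<Longrightarrow> dirichlet_energy u = dirichlet_energy v"
  by (simp add: dirichlet_energy_def)

lemma inner_extend_zero: "extend_zero x \<bullet> (extend_zero y :: real^('v + 'v set)) = x \<bullet> y" for x y :: "real^'v"
  by (simp add: inner_vec_def sum_UNIV_sum_type)

text \<open>At \<open>\<sigma> = 0\<close> the matrix is the direct sum of the original Laplacian and a zero block on the ghosts.\<close>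

lemma count_less_B_0: "count_less VG (B 0) ev = count_less UNIV (laplacian w) ev + card Vgh"
proof (rule antisym)
  obtain F where F: "subspace F" "F \<subseteq> supported UNIV" "dim F + count_less UNIV (laplacian w) ev = CARD('v)"
    "\<And>u. u \<in> F \<Longrightarrow> ev * (u \<bullet> u) \<le> u \<bullet> (laplacian w *v u)"
    using count_less_cosubspace[OF symmetric_laplacian_w, of UNIV ev] by blast
  have "dim (extend_zero ` F :: (real^('v + 'v set)) set) + count_less VG (B 0) ev \<le> card VG"
  proof (rule count_less_upper[OF symmetric_B_matrix])
    show "subspace (extend_zero ` F :: (real^('v + 'v set)) set)"
      by (rule linear_subspace_image[OF linear_extend_zero F(1)])
    show "extend_zero ` F \<subseteq> supported VG" using extend_zero_supported supported_mono[OF V_subset_VG] by blast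
    show "ev * (u \<bullet> u) \<le> u \<bullet> (B 0 *v u)" if "u \<in> extend_zero ` F" for u
      using that F(4) by (auto simp: B_0_form inner_extend_zero laplacian_w_form)
  qed
  thus "count_less VG (B 0) ev \<le> count_less UNIV (laplacian w) ev + card Vgh"
    using F(3) dim_extend_zero_image[OF F(1)] by (simp add: card_VG)
next
  obtain F where F: "subspace F" "F \<subseteq> supported UNIV" "dim F = count_less UNIV (laplacian w) ev"
    "\<And>u. u \<in> F \<Longrightarrow> u \<noteq> 0 \<Longrightarrow> u \<bullet> (laplacian w *v u) < ev * (u \<bullet> u)"
    using count_less_subspace[OF symmetric_laplacian_w, of UNIV ev] by blast
  let ?E = "extend_zero ` F :: (real^('v + 'v set)) set"
  have E: "subspace ?E" "?E \<subseteq> supported V"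
    using linear_subspace_image[OF linear_extend_zero F(1)] extend_zero_supported by auto
  \<comment> \<open>When \<open>x = 0\<close>, the inequality below is strict because ghosts exist only if \<open>ev\<close> is positive.\<close>
  define H where "H = {x + y |x y. x \<in> ?E \<and> y \<in> supported Vgh}"
  have H: "subspace H" "H \<subseteq> supported VG" "dim H = count_less UNIV (laplacian w) ev + card Vgh"
    using direct_sum_supported[OF E subspace_supported order_refl V_Vgh_disjoint] F(3)
      dim_extend_zero_image[OF F(1)]
    unfolding H_def sub_vertices_def by (auto simp: dim_supported)
  have "dim H \<le> count_less VG (B 0) ev"
  proof (rule dim_le_count_less[OF symmetric_B_matrix H(1,2)])
    fix u assume u: "u \<in> H" "u \<noteq> 0"
    obtain x y where xy: "u = extend_zero x + y" "x \<in> F" "y \<in> supported Vgh"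
      using u(1) by (auto simp: H_def)
    have uV: "u $ Inl i = x $ i" for i
      using xy(3) V_Vgh_disjoint by (auto simp: xy(1) supported_def)
    have e: "dirichlet_energy u = x \<bullet> (laplacian w *v x)"
      unfolding laplacian_w_form by (rule dirichlet_energy_cong) (simp add: uV)
    have uu: "u \<bullet> u = x \<bullet> x + penalty u"
      using inner_self_VG[of u] u(1) H(2) by (auto simp: uV inner_vec_def power2_eq_square)
    have "dirichlet_energy u < ev * (u \<bullet> u)"
    proof (cases "x = 0")
      case True
      hence "y \<noteq> 0" using u(2) xy(1) linear_0[OF linear_extend_zero] by simp
      hence "Vgh \<noteq> {}" using xy(3) by (auto simp: supported_def vec_eq_iff)
      hence "0 < ev" using ev_zero_no_ghosts ev_nonneg by (cases "ev = 0") auto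
      thus ?thesis using True e u(2) by simp
    next
      case False
      have "x \<bullet> (laplacian w *v x) < ev * (x \<bullet> x)" by (rule F(4)[OF xy(2) False])
      also have "\<dots> \<le> ev * (u \<bullet> u)"
        unfolding uu by (intro mult_left_mono ev_nonneg) (simp add: penalty_nonneg)
      finally show ?thesis using e by simp
    qed
    thus "u \<bullet> (B 0 *v u) < ev * (u \<bullet> u)" by (simp add: B_0_form)
  qed
  thus "count_less UNIV (laplacian w) ev + card Vgh \<le> count_less VG (B 0) ev" using H(3) by simp
qed

lemma sub_weight_aux_affine:
  "sub_weight_aux w \<psi> a b x y = sub_weight_aux w \<psi> 0 0 x y
     + a * (sub_weight_aux w \<psi> 1 0 x y - sub_weight_aux w \<psi> 0 0 x y) + b * sub_weight_aux w \<psi> 0 1 x y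
     - b * sub_weight_aux w \<psi> 0 0 x y"
  by (cases x; cases y) (auto simp: algebra_simps)

text \<open>Entries are rational functions of \<open>\<sigma>\<close> without poles on the half-line, whence their complex extension.\<close>

lemma B_matrix_entry:
  obtains c0 c1 c2 c3 where "\<And>\<sigma>. B \<sigma> $ x $ y = c0 + c1 * (1 / (1 + \<sigma>)) + c2 * (\<sigma> / (1 + \<sigma>)) + c3 * \<sigma>"
proof -
  define l where "l = (\<lambda>a b. laplacian (sub_weight_aux w \<psi> a b) $ x $ y)"
  have "l a b = l 0 0 + a * (l 1 0 - l 0 0) + b * (l 0 1 - l 0 0)" for a b
  proof -
    have E1: "(\<Sum>z\<in>UNIV. sub_weight_aux w \<psi> a b x z) = (\<Sum>z\<in>UNIV. sub_weight_aux w \<psi> 0 0 x z)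
      + a * ((\<Sum>z\<in>UNIV. sub_weight_aux w \<psi> 1 0 x z) - (\<Sum>z\<in>UNIV. sub_weight_aux w \<psi> 0 0 x z))
      + b * (\<Sum>z\<in>UNIV. sub_weight_aux w \<psi> 0 1 x z) - b * (\<Sum>z\<in>UNIV. sub_weight_aux w \<psi> 0 0 x z)"
      by (subst sub_weight_aux_affine) (simp add: sum.distrib sum_subtractf sum_distrib_left[symmetric])
    note E2 = sub_weight_aux_affine[of a b x y]
    show ?thesis
      unfolding l_def laplacian_def vec_lambda_beta E1 E2
      by (cases "x = y") (simp_all add: algebra_simps)
  qed
  hence "B \<sigma> $ x $ y = l 0 0 + (l 1 0 - l 0 0) * (1 / (1 + \<sigma>)) + (l 0 1 - l 0 0) * (\<sigma> / (1 + \<sigma>))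
      + (if x = y \<and> x \<in> Vgh then 1 else 0) * \<sigma>" for \<sigma>
    unfolding B_matrix_component sub_weight_def l_def by (metis mult.commute)
  thus ?thesis by (rule that)
qed

lemma real_germ_inverse_shift: "0 \<le> s \<Longrightarrow> real_germ (\<lambda>t. 1 / (1 + t)) s"
  unfolding real_germ_def
proof
  assume s: "0 \<le> s"
  have "1 + complex_of_real s \<noteq> 0" using s by (metis add_nonneg_eq_0_iff of_real_1 of_real_add of_real_eq_0_iff zero_le_one zero_neq_one)
  thus "(\<lambda>t. 1 / (1 + t)) analytic_on {complex_of_real s}" by (intro analytic_intros) auto
qed (auto intro!: always_eventually Reals_divide Reals_add)

lemma eigenvalue_branches_exist: "\<exists>b. eigenvalue_branches w \<psi> b"
proof -
  have "\<exists>m. (\<forall>s\<ge>0. real_germ m s) \<and> (\<forall>t. m (of_real t) = of_real (B t $ x $ y))" for x y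
  proof -
    obtain c0 c1 c2 c3 where c: "\<And>\<sigma>. B \<sigma> $ x $ y = c0 + c1 * (1 / (1 + \<sigma>)) + c2 * (\<sigma> / (1 + \<sigma>)) + c3 * \<sigma>"
      using B_matrix_entry by blast
    define m where "m = (\<lambda>t::complex. of_real c0 + of_real c1 * (1 / (1 + t)) + of_real c2 * (t * (1 / (1 + t))) + of_real c3 * t)"
    have "real_germ m s" if "0 \<le> s" for s
      unfolding m_def by (intro real_germ_intros real_germ_inverse_shift that) auto
    moreover have "m (of_real t) = of_real (B t $ x $ y)" for t by (simp add: m_def c)
    ultimately show ?thesis by blast
  qed
  then obtain m where m: "\<And>x y s. 0 \<le> s \<Longrightarrow> real_germ (m x y) s" "\<And>x y t. m x y (of_real t) = of_real (B t $ x $ y)"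
    by metis
  have "\<exists>b. represents (card VG) (\<lambda>t. eigenvalue_mset VG (B t)) b {0..}"
    by (rule analytic_symmetric_family_branches[of m]) (use m symmetric_B_matrix in auto)
  thus ?thesis by (auto simp: represents_def eigenvalue_branches_def)
qed

context
  fixes b assumes b: "eigenvalue_branches w \<psi> b"
begin

lemma branch_analytic: "n < card VG \<Longrightarrow> real_analytic_on (b n) {0..}"
  using b by (simp add: eigenvalue_branches_def)

lemma branch_mset: "0 \<le> \<sigma> \<Longrightarrow> image_mset (\<lambda>n. b n \<sigma>) (mset_set {..<card VG}) = eigenvalue_mset VG (B \<sigma>)"
  using b by (simp add: eigenvalue_branches_def)

lemma branch_count:
  assumes "0 \<le> \<sigma>"
  shows "card {n. n < card VG \<and> b n \<sigma> \<le> c} = count_le VG (B \<sigma>) c"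
    and "card {n. n < card VG \<and> b n \<sigma> < c} = count_less VG (B \<sigma>) c"
  unfolding count_le_def count_less_def branch_mset[OF assms, symmetric]
  by (simp_all add: filter_mset_image_mset conj_commute)

text \<open>The sorted eigenvalues increase with \<open>\<sigma>\<close> since the counts decrease.\<close>

lemma branch_mono:
  assumes n: "n < card VG" and st: "0 \<le> s" "s \<le> t"
  shows "b n s \<le> b n t"
proof (rule real_analytic_mono_of_mono_cover[OF branch_analytic[OF n], of "{1..card VG}" "\<lambda>j \<sigma>. eigenvalue VG (B \<sigma>) j"])
  show "eigenvalue VG (B s) j \<le> eigenvalue VG (B t) j" if j: "j \<in> {1..card VG}" and st: "0 \<le> s" "s \<le> t" for j s t
  proof -
    have "j \<le> count_le VG (B t) (eigenvalue VG (B t) j)"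
      using eigenvalue_le_iff_count[OF symmetric_B_matrix, of j VG t] j by auto
    also have "\<dots> \<le> count_le VG (B s) (eigenvalue VG (B t) j)" using st by (rule count_le_B_mono)
    finally show ?thesis using eigenvalue_le_iff_count[OF symmetric_B_matrix, of j VG s] j by auto
  qed
  show "\<exists>j\<in>{1..card VG}. b n t = eigenvalue VG (B t) j" if t: "0 \<le> t" for t
  proof -
    let ?xs = "sorted_list_of_multiset (eigenvalue_mset VG (B t))"
    have "b n t \<in># image_mset (\<lambda>n. b n t) (mset_set {..<card VG})" using n by auto
    hence "b n t \<in> set ?xs" using branch_mset[OF t] by simp
    then obtain i where i: "i < length ?xs" "?xs ! i = b n t" unfolding in_set_conv_nth by blast
    have "length ?xs = card VG"
      using size_eigenvalue_mset[OF symmetric_B_matrix, of VG t] by (metis mset_sorted_list_of_multiset size_mset)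
    thus ?thesis using i by (intro bexI[of _ "Suc i"]) (auto simp: eigenvalue_def)
  qed
qed (use st in auto)

text \<open>The sets \<open>Le \<sigma>\<close> and \<open>Lt \<sigma>\<close> of branches at most and strictly below \<open>ev\<close> shrink as \<open>\<sigma>\<close> grows. From \<open>R\<close> on their sizes do not
  change, so the sets do not change either. A branch in \<open>Le R - Lt R\<close> equals \<open>ev\<close> on \<open>[R,\<infinity>)\<close>, hence everywhere, and
  does not start below \<open>ev\<close>. Thus the crossing branches are those of \<open>Lt 0\<close> that are not in \<open>Lt R\<close>.\<close>

theorem card_crossing_branches:
  "card {n. n < card VG \<and> crosses (b n) ev} + nodal_count w \<psi> = count_less VG (B 0) ev + 1"
proof -
  obtain R where R: "0 \<le> R" "\<And>\<sigma>. R \<le> \<sigma> \<Longrightarrow> count_le VG (B \<sigma>) ev = nodal_count w \<psi>"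
    "\<And>\<sigma>. R \<le> \<sigma> \<Longrightarrow> count_less VG (B \<sigma>) ev + 1 = nodal_count w \<psi>"
    using counts_B_large by blast
  define Le where "Le = (\<lambda>\<sigma>. {n. n < card VG \<and> b n \<sigma> \<le> ev})"
  define Lt where "Lt = (\<lambda>\<sigma>. {n. n < card VG \<and> b n \<sigma> < ev})"
  have fin: "finite (Le \<sigma>)" "finite (Lt \<sigma>)" for \<sigma> by (auto simp: Le_def Lt_def)
  have cLe: "card (Le \<sigma>) = nodal_count w \<psi>" and cLt: "card (Lt \<sigma>) + 1 = nodal_count w \<psi>" if "R \<le> \<sigma>" for \<sigma>
    using branch_count[of \<sigma> ev] R(2,3)[OF that] R(1) that by (simp_all add: Le_def Lt_def)
  have Le_sub: "Le \<sigma>' \<subseteq> Le \<sigma>" and Lt_sub: "Lt \<sigma>' \<subseteq> Lt \<sigma>" if "0 \<le> \<sigma>" "\<sigma> \<le> \<sigma>'" for \<sigma> \<sigma>'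
    using branch_mono[OF _ that] by (fastforce simp: Le_def Lt_def)+
  have Le_eq: "Le \<sigma> = Le R" if "R \<le> \<sigma>" for \<sigma>
    using card_subset_eq[OF fin(1) Le_sub[OF R(1) that]] cLe[OF that] cLe[OF order_refl] by simp
  have Lt_eq: "Lt \<sigma> = Lt R" if "R \<le> \<sigma>" for \<sigma>
    using card_subset_eq[OF fin(2) Lt_sub[OF R(1) that]] cLt[OF that] cLt[OF order_refl] by simp
  have const: "b n 0 = ev" if n: "n \<in> Le R" "n \<notin> Lt R" for n
  proof -
    have nN: "n < card VG" using n by (simp add: Le_def)
    have "b n \<sigma> = ev" if "R \<le> \<sigma>" for \<sigma>
    proof -
      have "n \<in> Le \<sigma>" "n \<notin> Lt \<sigma>" using n by (simp_all only: Le_eq[OF that] Lt_eq[OF that] not_False_eq_True)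
      thus ?thesis by (simp add: Le_def Lt_def)
    qed
    hence sub: "{R..} \<subseteq> {t \<in> {0..}. b n t = ev}" using R(1) by auto
    have "R islimpt {R..}" using connected_interval_islimpt[of "{R..}" R "R + 1" R] by auto
    hence lim: "R islimpt {t \<in> {0..}. b n t = ev}" using sub by (rule islimpt_subset)
    show ?thesis
      by (rule real_analytic_identity[of "b n" "{0..}" "\<lambda>_. ev" R 0])
        (use branch_analytic[OF nN] real_analytic_on_const lim R(1) in auto)
  qed
  have "{n. n < card VG \<and> crosses (b n) ev} = Lt 0 - Le R"
  proof (intro subset_antisym subsetI)
    fix n assume "n \<in> {n. n < card VG \<and> crosses (b n) ev}"
    hence n: "n < card VG" "b n 0 < ev" "\<forall>\<^sub>F \<sigma> in at_top. ev < b n \<sigma>" by (auto simp: crosses_def)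
    have "n \<notin> Le R"
    proof
      assume "n \<in> Le R"
      hence "\<forall>\<^sub>F \<sigma> in at_top. b n \<sigma> \<le> ev"
        using Le_eq by (intro eventually_at_top_linorderI[of R]) (auto simp: Le_def)
      hence "\<forall>\<^sub>F \<sigma>::real in at_top. False" using n(3) by eventually_elim simp
      thus False by simp
    qed
    thus "n \<in> Lt 0 - Le R" using n by (simp add: Lt_def)
  next
    fix n assume "n \<in> Lt 0 - Le R"
    hence n: "n < card VG" "b n 0 < ev" "ev < b n R" by (auto simp: Lt_def Le_def)
    define l where "l = (SUP \<sigma>\<in>{0..}. ereal (b n \<sigma>))"
    have upper: "ereal (b n \<sigma>) \<le> l" if "0 \<le> \<sigma>" for \<sigma>
      unfolding l_def using that by (intro SUP_upper) simp
    have "((\<lambda>\<sigma>. ereal (b n \<sigma>)) \<longlongrightarrow> l) at_top"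
    proof (rule order_tendstoI)
      fix a assume "a < l"
      then obtain s where s: "0 \<le> s" "a < ereal (b n s)" unfolding l_def less_SUP_iff by auto
      show "\<forall>\<^sub>F \<sigma> in at_top. a < ereal (b n \<sigma>)"
        using eventually_ge_at_top[of s]
      proof eventually_elim
        case (elim \<sigma>)
        have "ereal (b n s) \<le> ereal (b n \<sigma>)" using branch_mono[OF n(1) s(1) elim] by simp
        thus ?case using s(2) by (rule order.strict_trans2[rotated])
      qed
    next
      fix a assume "l < a"
      show "\<forall>\<^sub>F \<sigma> in at_top. ereal (b n \<sigma>) < a"
        using eventually_ge_at_top[of 0] by eventually_elim (use upper \<open>l < a\<close> in \<open>blast intro: order.strict_trans1\<close>)
    qed
    moreover have "ereal ev < l" using upper[OF R(1)] n(3) 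
      by (intro order.strict_trans2[of "ereal ev" "ereal (b n R)" l]) simp_all
    moreover have "\<forall>\<^sub>F \<sigma> in at_top. ev < b n \<sigma>"
      using eventually_ge_at_top[of R] by eventually_elim (use branch_mono[OF n(1) R(1)] n(3) in \<open>blast intro: order.strict_trans2\<close>)
    ultimately show "n \<in> {n. n < card VG \<and> crosses (b n) ev}" using n by (auto simp: crosses_def)
  qed
  also have "Lt 0 - Le R = Lt 0 - Lt R" using const by (fastforce simp: Lt_def Le_def)
  finally have "card {n. n < card VG \<and> crosses (b n) ev} = card (Lt 0) - card (Lt R)"
    using card_Diff_subset[OF fin(2) Lt_sub[OF order_refl R(1)]] by simp
  moreover have "card (Lt R) \<le> card (Lt 0)" using card_mono[OF fin(2) Lt_sub[OF order_refl R(1)]] .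
  moreover have "card (Lt 0) = count_less VG (B 0) ev" using branch_count(2)[of 0 ev] by (simp add: Lt_def)
  ultimately show ?thesis using cLt[OF order_refl] by simp
qed

end

end


section \<open>Dirichlet limit, nodal deficiency and crossing branches\<close>

theorem theorem3p6:
  fixes w :: "'v::finite \<Rightarrow> 'v \<Rightarrow> real" and \<psi> :: "real^'v" and k :: nat
  defines "lam \<equiv> eigenvalue UNIV (laplacian w)"
    and "VG \<equiv> sub_vertices w \<psi>" and "Vgh \<equiv> ghosts w \<psi>"
    and "winf \<equiv> sub_weight_inf w \<psi>" and "S \<equiv> pos_neg_set \<psi>"
  assumes graph: "weighted_graph w" "connected_graph w"
    and nonzero: "\<forall>i. \<psi> $ i \<noteq> 0"
    and k_range: "1 \<le> k" "k \<le> CARD('v)"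
    and eigenvector: "laplacian w *v \<psi> = lam k *\<^sub>R \<psi>"
    and k_least: "\<forall>m. 1 \<le> m \<and> m \<le> CARD('v) \<and> laplacian w *v \<psi> = lam m *\<^sub>R \<psi> \<longrightarrow> k \<le> m"
  shows
    "((\<forall>m\<in>{1..card S}.
         ((\<lambda>\<sigma>. eigenvalue VG (B_matrix w \<psi> \<sigma>) m) \<longlongrightarrow> dirichlet_eigenvalue winf S m) at_top) \<and>
      (\<forall>m\<in>{card S + 1..card VG}.
         filterlim (\<lambda>\<sigma>. eigenvalue VG (B_matrix w \<psi> \<sigma>) m) at_top at_top))
     \<and>
     (card (D_components winf S) = dim (B_inf_eigenspace w \<psi> (lam k)) \<and>
      nodal_deficiency winf (extend_zero \<psi>) k = int k - int (nodal_count w \<psi>))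
     \<and>
     ((\<exists>b. eigenvalue_branches w \<psi> b) \<and>
      (\<forall>b. eigenvalue_branches w \<psi> b \<longrightarrow>
         int (card {n. n < card VG \<and> crosses (b n) (lam k)})
           = int k - int (nodal_count w \<psi>) + int (card Vgh)))"
proof -
  interpret signed_eigenvector w \<psi> "lam k"
    by standard (use graph nonzero eigenvector in auto)
  have "count_less UNIV (laplacian w) (lam k) = k - 1"
    unfolding lam_def
    by (rule count_less_eigenvalue_least[OF symmetric_laplacian_w])
      (use k_range k_least eigenvector in \<open>auto simp: lam_def\<close>)
  hence "count_less (sub_vertices w \<psi>) (B_matrix w \<psi> 0) (lam k) = k - 1 + card (ghosts w \<psi>)"
    using count_less_B_0 by simp
  hence "int (card {n. n < card (sub_vertices w \<psi>) \<and> crosses (b n) (lam k)})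
           = int k - int (nodal_count w \<psi>) + int (card (ghosts w \<psi>))" if "eigenvalue_branches w \<psi> b" for b
    using card_crossing_branches[OF that] k_range by simp
  thus ?thesis
    unfolding VG_def Vgh_def winf_def S_def pos_neg_set_eq nodal_deficiency_def dirichlet_eigenvalue_def
    using eigenvalue_B_converges eigenvalue_B_diverges card_D_components dim_B_inf_eigenspace
      nodal_count_extend_zero eigenvalue_branches_exist
    by simp
qed

end
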